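(* Let $(\mathfrak g,(\cdot,\cdot),\mathfrak h)$ be a tame reduced extended affine Lie algebra of rank $\ell>1$ and nullity $\nu$ with root system $R$, admitting a Chevalley automorphism $\tau$. Let $\dot\Pi=\{\alpha_1,\dots,\alpha_\ell\}$ be a base of $\dot R$, and fix a reflectable base $\Pi$ for $R$ such that $\dot\Pi\subseteq\Pi$. Then the core $\mathfrak g_c$ admits a basis $$\mathcal B=\{x_\alpha\in\mathfrak g_\alpha\mid\alpha\in R^\times\}\cup\{h_i,c_j\in\mathfrak h\mid1\le i\le\ell,\ 1\le j\le\nu\}\cup\Big(\bigcup_{\delta\in R^0\setminus\{0\}}\mathcal X_\delta\Big),$$ where $\mathcal X_\delta\subseteq\{x_\delta^\alpha\mid\alpha\in\Pi,\ \alpha+\delta\in R\}$ is a basis of $\mathfrak g_\delta\cap\mathfrak g_c$ (with $x_\delta^\alpha:=[x_{\alpha+\delta},x_{-\alpha}]$), such that (i) $[c_j,\mathfrak g]=0$ for all $j$; (ii) $[h_i,h_j]=0$ for all $i,j$; (iii) $[h_i,x_\alpha]=(\alpha,\alpha_i^\vee)x_\alpha$ for $\alpha\in R\setminus\{0\}$, $x_\alpha\in\mathcal B\cap\mathfrak g_\alpha$, $1\le i\le\ell$; (iv) $[x_\alpha,x_{-\alpha}]\in\sum_{i=1}^\ell\mathbb Zh_i+\sum_{j=1}^\nu\mathbb Zc_j$ for $\alpha\in R^\times$; (v) for $\alpha,\beta\in R^\times$, $[x_\alpha,x_\beta]=0$ if $\alpha+\beta\notin R$; and if $\{\alpha,\beta\}$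 is nilpotent (i.e. $\alpha+\beta\in R^\times$) then $[x_\alpha,x_\beta]=c_{\alpha,\beta}x_{\alpha+\beta}$ with $$c_{\alpha,\beta}=-c_{-\alpha,-\beta}\quad\text{and}\quad c_{\alpha,\beta}^2=\frac{u(d+1)(\alpha+\beta,\alpha+\beta)}{(\beta,\beta)},$$ where $u,d$ are the non-negative integers such that the $\alpha$-string through $\beta$ is $\beta-d\alpha,\dots,\beta+u\alpha$; in particular, $c_{\alpha,\beta}\in\mathbb Z$; (vi) $[x_\alpha,x_\delta]\in\mathbb Zx_{\alpha+\delta}$ for $\alpha\in R^\times$, $0\neq\delta\in R^0$, $x_\delta\in\mathcal X_\delta$ (where $x_{\alpha+\delta}:=0$ if $\alpha+\delta\notin R$); (vii) for $0\ne\delta\in R^0$: $[x_\beta,x_{-\beta+\delta}]$ and $[x_\eta,x_\mu]$ lie in $\mathrm{span}_{\mathbb Z}\{x_\delta^\alpha\mid\alpha\in\Pi,\ \alpha+\delta\in R\}$, for all $\beta\in R^\times$ with $-\beta+\delta\in R$ and all $\eta,\mu\in R^0\setminus\{0\}$ with $\eta+\mu=\delta$, $x_\eta\in\mathcal X_\eta$, $x_\mu\in\mathcal X_\mu$.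
   Context: All algebras are over $\mathbb C$. Extended affine Lie algebra (EALA): a triple $(\mathfrak g,(\cdot,\cdot),\mathfrak h)$ with $\mathfrak g$ a Lie algebra, $\mathfrak h$ a non-trivial subalgebra, $(\cdot,\cdot)$ a symmetric bilinear form on $\mathfrak g$ such that: (A1) the form is invariant and non-degenerate; (A2) $\mathfrak h$ is finite-dimensional and $\mathfrak g=\sum_{\alpha\in\mathfrak h^\star}\mathfrak g_\alpha$, $\mathfrak g_\alpha=\{x\mid [h,x]=\alpha(h)x\ \forall h\in\mathfrak h\}$, $\mathfrak g_0=\mathfrak h$; let $R=\{\alpha\mid\mathfrak g_\alpha\ne0\}$, transfer the form to $\mathfrak h^\star$ by $(\alpha,\beta)=(t_\alpha,t_\beta)$ where $\alpha(h)=(h,t_\alpha)$, let $V=\mathrm{span}_{\mathbb R}R$, $V^0$ the radical of the form on $V$, $R^0=\{\alpha\in R\mid(\alpha,\alpha)=0\}$, $R^\times=R\setminus R^0$; (A3) for $\alpha\in R^\times$, $x\in\mathfrak g_\alpha$, $\mathrm{ad}(x)$ is locally nilpotent; (A4) the $\mathbb Z$-span of $R$ is free abelian of rank $\dim V$; (A5) $R^\times$ is indecomposable, and $R^0=(R^\times-R^\times)\cap V^0$. The form is normalized so that it is positive semidefinite on $V$ with $(\alpha,\alpha)=2$ for short non-isotropic roots. For $\alpha\in R^\times$, $\alpha^\vee=2\alpha/(\alpha,\alpha)$ and $w_\alpha(\beta)=\beta-(\beta,\alpha^\vee)\alpha$. The image $\bar R$ of $R$ in $V/V^0$ is an irreducible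 finite root system; the rank of $R$ (of $\mathfrak g$) is the rank of $\bar R$, the nullity is $\nu=\dim V^0$, and $R$ (and $\mathfrak g$) is reduced if $\bar R$ is. Fixing preimages in $R$ of a base of $\bar R$, with real span $\dot V$ (so $V=\dot V\oplus V^0$), $\dot R:=\{\dot\alpha\in\dot V\mid\dot\alpha+\sigma\in R\text{ for some }\sigma\in V^0\}$ is a finite root system isomorphic to $\bar R$. The core $\mathfrak g_c$ is the subalgebra generated by the $\mathfrak g_\alpha$, $\alpha\in R^\times$. $\mathfrak g$ is tame if $\{x\in\mathfrak g\mid(x,\mathfrak g_c)=0\}$ equals the center of $\mathfrak g_c$. A Chevalley automorphism is a finite order automorphism $\tau$ of $\mathfrak g$ with $\tau(h)=-h$ for all $h\in\mathfrak h$. A reflectable base for $R$ is a subset $\Pi\subseteq R^\times$ minimal with the property $\mathcal W_\Pi\Pi=R^\times$, where $\mathcal W_\Pi=\langle w_\alpha\mid\alpha\in\Pi\rangle$.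
   Formalization: The formal theorem also assumes that V^0 spans a complex subspace of dimension ν (nondegeneracy); without it the claim fails, e.g. for sl_3 over Laurent polynomials in t_1, t_2 extended by c and d with d acting by m+in, where the core meets h in dimension 3 < ℓ+ν = 4. *)

theory Defs
  imports Complex_Main "HOL-Library.Function_Algebras"
begin

text \<open>
  A linear functional on the subalgebra \<open>h\<close> of a Lie algebra on the type \<open>'g\<close> is represented by
  the function of type \<open>'g \<Rightarrow> complex\<close> that extends it by \<open>0\<close> outside \<open>h\<close>.  Addition of
  such functions is pointwise (\<^theory>\<open>HOL-Library.Function_Algebras\<close>); they are scaled by
  integers, reals and complex numbers as follows.
\<close>

type_synonym 'g functional = "'g \<Rightarrow> complex"

definition cscale :: "complex \<Rightarrow> 'g functional \<Rightarrow> 'g functional" where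
  "cscale a \<alpha> = (\<lambda>y. a * \<alpha> y)"

definition rscale :: "real \<Rightarrow> 'g functional \<Rightarrow> 'g functional" where
  "rscale r = cscale (of_real r)"

definition zscale :: "int \<Rightarrow> 'g functional \<Rightarrow> 'g functional" where
  "zscale k = cscale (of_int k)"

global_interpretation funC: vector_space cscale
  by standard (auto simp: cscale_def fun_eq_iff algebra_simps)

global_interpretation funR: vector_space rscale
  by standard (auto simp: rscale_def cscale_def fun_eq_iff algebra_simps)

global_interpretation funZ: module zscale
  by standard (auto simp: zscale_def cscale_def fun_eq_iff algebra_simps)

text \<open>
  A base of (the image of) \<open>\<Phi>\<close> in the quotient by the real subspace \<open>W\<close>, written out on
  representatives: the classes of the elements of \<open>B\<close> are linearly independent, and every class of
  an element of \<open>\<Phi>\<close> is an integral combination of them with coefficients of one sign.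
  For \<open>W = {0}\<close> this is a base of \<open>\<Phi>\<close> itself.  Root systems contain \<open>0\<close> here.
\<close>

definition root_base_mod :: "'g functional set \<Rightarrow> 'g functional set \<Rightarrow> 'g functional set \<Rightarrow> bool" where
  "root_base_mod W \<Phi> B \<longleftrightarrow>
     finite B \<and> B \<subseteq> \<Phi> \<and>
     (\<forall>f. (\<Sum>b\<in>B. rscale (f b) b) \<in> W \<longrightarrow> (\<forall>b\<in>B. f b = 0)) \<and>
     (\<forall>\<alpha>\<in>\<Phi>. \<exists>k. \<alpha> - (\<Sum>b\<in>B. zscale (k b) b) \<in> W \<and>
                 ((\<forall>b\<in>B. 0 \<le> k b) \<or> (\<forall>b\<in>B. k b \<le> 0)))"

abbreviation root_base :: "'g functional set \<Rightarrow> 'g functional set \<Rightarrow> bool" where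
  "root_base \<equiv> root_base_mod {0}"

locale lie_algebra = vector_space scale
  for scale :: "complex \<Rightarrow> 'g::ab_group_add \<Rightarrow> 'g" (infixr \<open>*s\<close> 75) +
  fixes bracket :: "'g \<Rightarrow> 'g \<Rightarrow> 'g" (\<open>\<^bold>[_, _\<^bold>]\<close>)
  assumes bracket_add_left: "\<^bold>[x + y, z\<^bold>] = \<^bold>[x, z\<^bold>] + \<^bold>[y, z\<^bold>]"
    and bracket_add_right: "\<^bold>[x, y + z\<^bold>] = \<^bold>[x, y\<^bold>] + \<^bold>[x, z\<^bold>]"
    and bracket_scale_left: "\<^bold>[a *s x, y\<^bold>] = a *s \<^bold>[x, y\<^bold>]"
    and bracket_scale_right: "\<^bold>[x, a *s y\<^bold>] = a *s \<^bold>[x, y\<^bold>]"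
    and bracket_self: "\<^bold>[x, x\<^bold>] = 0"
    and jacobi: "\<^bold>[x, \<^bold>[y, z\<^bold>]\<^bold>] + \<^bold>[y, \<^bold>[z, x\<^bold>]\<^bold>] + \<^bold>[z, \<^bold>[x, y\<^bold>]\<^bold>] = 0"
begin

definition subalgebra :: "'g set \<Rightarrow> bool" where
  "subalgebra S \<longleftrightarrow> subspace S \<and> (\<forall>x\<in>S. \<forall>y\<in>S. \<^bold>[x, y\<^bold>] \<in> S)"

definition centre :: "'g set \<Rightarrow> 'g set" where
  "centre S = {z \<in> S. \<forall>y\<in>S. \<^bold>[z, y\<^bold>] = 0}"

definition lie_automorphism :: "('g \<Rightarrow> 'g) \<Rightarrow> bool" where
  "lie_automorphism \<tau> \<longleftrightarrow>
     bij \<tau> \<and> Vector_Spaces.linear scale scale \<tau> \<and> (\<forall>x y. \<tau> \<^bold>[x, y\<^bold>] = \<^bold>[\<tau> x, \<tau> y\<^bold>])"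

definition int_span :: "'g set \<Rightarrow> 'g set" where
  "int_span S = module.span (\<lambda>k x. of_int k *s x) S"

end

locale eala_data = lie_algebra scale bracket
  for scale :: "complex \<Rightarrow> 'g::ab_group_add \<Rightarrow> 'g" (infixr \<open>*s\<close> 75)
    and bracket :: "'g \<Rightarrow> 'g \<Rightarrow> 'g" (\<open>\<^bold>[_, _\<^bold>]\<close>) +
  fixes form :: "'g \<Rightarrow> 'g \<Rightarrow> complex"
    and h :: "'g set"
begin

definition dual :: "'g functional set" where
  "dual = {\<alpha>. (\<forall>x\<in>h. \<forall>y\<in>h. \<alpha> (x + y) = \<alpha> x + \<alpha> y) \<and> (\<forall>a. \<forall>x\<in>h. \<alpha> (a *s x) = a * \<alpha> x) \<and>
              (\<forall>x. x \<notin> h \<longrightarrow> \<alpha> x = 0)}"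

definition root_space :: "'g functional \<Rightarrow> 'g set" where
  "root_space \<alpha> = {x. \<forall>y\<in>h. \<^bold>[y, x\<^bold>] = \<alpha> y *s x}"

definition roots :: "'g functional set" where
  "roots = {\<alpha> \<in> dual. root_space \<alpha> \<noteq> {0}}"

definition dual_vec :: "'g functional \<Rightarrow> 'g" where
  "dual_vec \<alpha> = (THE t. t \<in> h \<and> (\<forall>y\<in>h. \<alpha> y = form y t))"

definition dform :: "'g functional \<Rightarrow> 'g functional \<Rightarrow> complex" where
  "dform \<alpha> \<beta> = form (dual_vec \<alpha>) (dual_vec \<beta>)"

definition V :: "'g functional set" where
  "V = funR.span roots"

definition V0 :: "'g functional set" where
  "V0 = {v \<in> V. \<forall>w\<in>V. dform v w = 0}"

definition isotropic_roots :: "'g functional set" where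
  "isotropic_roots = {\<alpha> \<in> roots. dform \<alpha> \<alpha> = 0}"

definition nonisotropic_roots :: "'g functional set" where
  "nonisotropic_roots = roots - isotropic_roots"

definition core :: "'g set" where
  "core = subalgebra hull (\<Union>\<alpha>\<in>nonisotropic_roots. root_space \<alpha>)"

definition tame :: bool where
  "tame \<longleftrightarrow> {x. \<forall>y\<in>core. form x y = 0} = centre core"

definition chevalley_automorphism :: "('g \<Rightarrow> 'g) \<Rightarrow> bool" where
  "chevalley_automorphism \<tau> \<longleftrightarrow>
     lie_automorphism \<tau> \<and> (\<exists>n>0. \<tau> ^^ n = id) \<and> (\<forall>y\<in>h. \<tau> y = - y)"

text \<open>Short roots are the non-isotropic roots of minimal length.\<close>

definition normalized :: bool where
  "normalized \<longleftrightarrow>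
     (\<forall>v\<in>V. \<forall>w\<in>V. dform v w \<in> \<real>) \<and> (\<forall>v\<in>V. 0 \<le> Re (dform v v)) \<and>
     (\<forall>\<alpha>\<in>nonisotropic_roots.
        (\<forall>\<beta>\<in>nonisotropic_roots. Re (dform \<alpha> \<alpha>) \<le> Re (dform \<beta> \<beta>)) \<longrightarrow> dform \<alpha> \<alpha> = 2)"

definition coset :: "'g functional \<Rightarrow> 'g functional set" where
  "coset v = {v + \<sigma> |\<sigma>. \<sigma> \<in> V0}"

definition roots_bar :: "'g functional set set" where
  "roots_bar = coset ` roots"

definition reduced :: bool where
  "reduced \<longleftrightarrow>
     (\<forall>\<alpha>\<in>roots. \<forall>r. coset \<alpha> \<noteq> coset 0 \<and> coset (rscale r \<alpha>) \<in> roots_bar - {coset 0} \<longrightarrow>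
        r = 1 \<or> r = -1)"

text \<open>The rank is the real dimension of the span \<open>V/V\<^sup>0\<close> of \<open>roots_bar\<close>.\<close>

definition rank :: nat where
  "rank = funR.dim V - funR.dim V0"

definition nullity :: nat where
  "nullity = funR.dim V0"

text \<open>
  Non-degeneracy in the sense of Gao (The degeneracy of extended affine Lie algebras, 1998):
  the real space \<open>V\<^sup>0\<close> spans a complex subspace of the dual of \<open>h\<close> of dimension \<open>\<nu>\<close>, i.e. vectors
  of \<open>V\<^sup>0\<close> independent over the reals stay independent over the complex numbers.  This
  does not follow from the axioms of \<open>eala\<close> below: let \<open>L\<close> be \<open>sl\<^sub>3\<close> tensored with Laurent polynomials in \<open>t\<^sub>1\<close>,
  \<open>t\<^sub>2\<close>, let \<open>d\<close> multiply degree \<open>(m, n)\<close> by \<open>m + \<i> n\<close>, and extend \<open>L\<close> by \<open>d\<close> and by the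
  central element \<open>c\<close> dual to \<open>d\<close>.  Then \<open>V\<^sup>0\<close> is spanned by \<open>\<delta>\<close> and \<open>\<i> \<delta>\<close>, the nullity is 2, and
  the intersection of the core with \<open>h\<close> has dimension \<open>3 < l + \<nu> = 4\<close>, so that the core has no
  basis with \<open>l + \<nu>\<close> elements \<open>h\<^sub>i\<close>, \<open>c\<^sub>j\<close> in \<open>h\<close>.
\<close>

definition nondegenerate :: bool where
  "nondegenerate \<longleftrightarrow> funC.dim V0 = nullity"

text \<open>\<open>P\<close> consists of one preimage in \<open>R\<close> for each element of a base of \<open>roots_bar\<close>.\<close>

definition preimage_of_base :: "'g functional set \<Rightarrow> bool" where
  "preimage_of_base P \<longleftrightarrow> root_base_mod V0 roots P"

definition dot_roots :: "'g functional set \<Rightarrow> 'g functional set" where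
  "dot_roots P = {\<alpha> \<in> funR.span P. \<exists>\<sigma>\<in>V0. \<alpha> + \<sigma> \<in> roots}"

definition coroot :: "'g functional \<Rightarrow> 'g functional" where
  "coroot \<alpha> = cscale (2 / dform \<alpha> \<alpha>) \<alpha>"

definition reflection :: "'g functional \<Rightarrow> 'g functional \<Rightarrow> 'g functional" where
  "reflection \<alpha> \<beta> = \<beta> - cscale (dform \<beta> (coroot \<alpha>)) \<alpha>"

text \<open>Reflections are involutions on \<open>dual\<close>, so the group they generate consists of products of them.\<close>

inductive_set weyl :: "'g functional set \<Rightarrow> ('g functional \<Rightarrow> 'g functional) set"
  for \<Pi> :: "'g functional set" where
  id: "id \<in> weyl \<Pi>"
| step: "\<alpha> \<in> \<Pi> \<Longrightarrow> w \<in> weyl \<Pi> \<Longrightarrow> reflection \<alpha> \<circ> w \<in> weyl \<Pi>"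

definition weyl_orbit :: "'g functional set \<Rightarrow> 'g functional set" where
  "weyl_orbit \<Pi> = {w \<alpha> |w \<alpha>. w \<in> weyl \<Pi> \<and> \<alpha> \<in> \<Pi>}"

definition reflectable_base :: "'g functional set \<Rightarrow> bool" where
  "reflectable_base \<Pi> \<longleftrightarrow>
     \<Pi> \<subseteq> nonisotropic_roots \<and> weyl_orbit \<Pi> = nonisotropic_roots \<and>
     (\<forall>\<Pi>'. \<Pi>' \<subset> \<Pi> \<longrightarrow> weyl_orbit \<Pi>' \<noteq> nonisotropic_roots)"

definition x_iso :: "'g functional set \<Rightarrow> ('g functional \<Rightarrow> 'g) \<Rightarrow> 'g functional \<Rightarrow> 'g set" where
  "x_iso \<Pi> x \<delta> = {\<^bold>[x (\<alpha> + \<delta>), x (- \<alpha>)\<^bold>] |\<alpha>. \<alpha> \<in> \<Pi> \<and> \<alpha> + \<delta> \<in> roots}"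

definition basis_set ::
  "nat \<Rightarrow> nat \<Rightarrow> ('g functional \<Rightarrow> 'g) \<Rightarrow> (nat \<Rightarrow> 'g) \<Rightarrow> (nat \<Rightarrow> 'g) \<Rightarrow> ('g functional \<Rightarrow> 'g set) \<Rightarrow> 'g set"
  where
  "basis_set l \<nu> x hh c X =
     x ` nonisotropic_roots \<union> (hh ` {1..l} \<union> c ` {1..\<nu>}) \<union> (\<Union>\<delta>\<in>isotropic_roots - {0}. X \<delta>)"

definition core_basis ::
  "'g functional set \<Rightarrow> nat \<Rightarrow> nat \<Rightarrow> ('g functional \<Rightarrow> 'g) \<Rightarrow> (nat \<Rightarrow> 'g) \<Rightarrow> (nat \<Rightarrow> 'g) \<Rightarrow>
     ('g functional \<Rightarrow> 'g set) \<Rightarrow> bool" where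
  "core_basis \<Pi> l \<nu> x hh c X \<longleftrightarrow>
     (\<forall>\<alpha>\<in>nonisotropic_roots. x \<alpha> \<in> root_space \<alpha>) \<and>
     (\<forall>i\<in>{1..l}. hh i \<in> h) \<and> (\<forall>j\<in>{1..\<nu>}. c j \<in> h) \<and>
     inj_on hh {1..l} \<and> inj_on c {1..\<nu>} \<and> hh ` {1..l} \<inter> c ` {1..\<nu>} = {} \<and>
     (\<forall>\<delta>\<in>isotropic_roots - {0}.
        X \<delta> \<subseteq> x_iso \<Pi> x \<delta> \<and> independent (X \<delta>) \<and> span (X \<delta>) = root_space \<delta> \<inter> core) \<and>
     independent (basis_set l \<nu> x hh c X) \<and> span (basis_set l \<nu> x hh c X) = core"

end

locale eala = eala_data scale bracket form h
  for scale :: "complex \<Rightarrow> 'g::ab_group_add \<Rightarrow> 'g" (infixr \<open>*s\<close> 75)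
    and bracket :: "'g \<Rightarrow> 'g \<Rightarrow> 'g" (\<open>\<^bold>[_, _\<^bold>]\<close>)
    and form :: "'g \<Rightarrow> 'g \<Rightarrow> complex"
    and h :: "'g set" +
  assumes form_add: "form (x + y) z = form x z + form y z"
    and form_scale: "form (a *s x) y = a * form x y"
    and form_sym: "form x y = form y x"
    and h_subalgebra: "subalgebra h"
    and h_nontrivial: "h \<noteq> {0}"
    and form_invariant: "form \<^bold>[x, y\<^bold>] z = form x \<^bold>[y, z\<^bold>]"
    and form_nondegenerate: "(\<And>y. form x y = 0) \<Longrightarrow> x = 0"
    and h_finite_dim: "\<exists>B. finite B \<and> span B = h"
    and root_decomposition: "span (\<Union>\<alpha>\<in>dual. root_space \<alpha>) = UNIV"
    and root_space_zero: "root_space 0 = h"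
    and ad_nilpotent: "\<alpha> \<in> nonisotropic_roots \<Longrightarrow> x \<in> root_space \<alpha> \<Longrightarrow> \<exists>n. (bracket x ^^ n) y = 0"
    and root_lattice:
      "\<exists>B. finite B \<and> funZ.independent B \<and> funZ.span B = funZ.span roots \<and> card B = funR.dim V"
    and indecomposable:
      "\<not> (\<exists>R1 R2. R1 \<noteq> {} \<and> R2 \<noteq> {} \<and> R1 \<inter> R2 = {} \<and> R1 \<union> R2 = nonisotropic_roots \<and>
              (\<forall>\<alpha>\<in>R1. \<forall>\<beta>\<in>R2. dform \<alpha> \<beta> = 0))"
    and isotropic_eq:
      "isotropic_roots = {\<alpha> - \<beta> |\<alpha> \<beta>. \<alpha> \<in> nonisotropic_roots \<and> \<beta> \<in> nonisotropic_roots} \<inter> V0"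

end

theory Submission
  imports Defs
begin

text \<open>
  For every non-isotropic root the root space is a line, because \<open>ad x\<close> is injective on negative
  weights of an integrable \<open>sl\<^sub>2\<close>-module.  Choosing \<open>x (- \<alpha>) = - \<tau> (x \<alpha>)\<close> with
  \<open>[x \<alpha>, x (- \<alpha>)]\<close> the coroot gives the structure constants of (v) by the classical string
  computation.  The automorphism \<open>\<theta> = exp(ad x \<gamma>) exp(- ad x (- \<gamma>)) exp(ad x \<gamma>)\<close> commutes with
  \<open>\<tau>\<close>, so it maps each \<open>x \<beta>\<close> to \<open>\<plusminus> x (w \<beta>)\<close>; on an isotropic root space it is
  \<open>y \<mapsto> y + k [x (\<gamma> + \<delta>), x (- \<gamma>)]\<close>, where \<open>[x \<gamma>, y] = k x (\<gamma> + \<delta>)\<close>.  The Jacobi identity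
  gives the integrality in (vi) for roots that are not proportional modulo \<open>V\<^sup>0\<close>, and \<open>\<theta>\<close>, for a
  root \<open>\<gamma>\<close> proportional to neither and not orthogonal, carries it to the proportional case (this needs rank
  \<open>> 1\<close>).  Applying the \<open>\<theta>\<close> with \<open>\<gamma> \<in> \<Pi>\<close> along a word of the Weyl group then gives (vii).
  Finally, the coroot of \<open>\<beta>\<close> is an integral combination of the coroots of the base plus a
  null vector; root lengths are finite in number and rational, so these null vectors lie in a lattice, and
  the \<open>c j\<close> form a basis of the subgroup they generate.
\<close>

text \<open>The obstacle is the isotropic root spaces: they may have dimension greater than one and
  no \<open>sl2\<close>-triple normalizes their vectors, so integrality has to be imported from the
  non-isotropic lines. The Jacobi expansion of [x \<alpha>, [x (\<beta> + \<delta>), x (- \<beta>)]]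
  passes through the weights \<alpha> + \<beta> + \<delta> and \<alpha> - \<beta>. If \<alpha> and
  \<beta> are proportional modulo \<open>V0\<close>, one of these lies in \<open>V0\<close> and the
  argument would be circular; replacing \<alpha> by w \<alpha> keeps every intermediate weight
  outside \<open>V0\<close>. The signs come from two constraints on the scalars by which \<theta>
  acts on the lines of \<beta> and - \<beta>: the bracket makes their product 1, and
  \<open>\<tau>\<close> makes them equal. In (vii) the choice of \<gamma> in \<open>\<Pi>\<close>
  matters because the correction added by \<theta> is then an integral multiple of one of the listed
  generators. The null parts of infinitely many coroots must be generated over the integers by
  exactly \<open>nullity\<close> elements. Bounded denominators make this possible: the generated
  group is a lattice, and a lattice basis is a real basis of \<open>V0\<close>. Non-degeneracy keeps
  it independent over the complex numbers.\<close>

section \<open>\<open>sl\<^sub>2\<close>-triples and exponentials\<close>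

context lie_algebra
begin

text \<open>The integer action is not registered as an interpretation; the facts on
  \<open>int_span\<close> below instantiate the library's \<open>module\<close> lemmas through this
  one.\<close>

lemma int_module: "module (\<lambda>k x. of_int k *s x)"
  by standard (simp_all add: scale_right_distrib scale_left_distrib)

lemma int_span_base: "a \<in> S \<Longrightarrow> a \<in> int_span S"
  unfolding int_span_def by (rule module.span_base[OF int_module])

lemma int_span_zero: "0 \<in> int_span S"
  unfolding int_span_def by (rule module.span_zero[OF int_module])

lemma int_span_add: "a \<in> int_span S \<Longrightarrow> b \<in> int_span S \<Longrightarrow> a + b \<in> int_span S"
  unfolding int_span_def by (rule module.span_add[OF int_module])

lemma int_span_scale: "a \<in> int_span S \<Longrightarrow> of_int k *s a \<in> int_span S"
  unfolding int_span_def by (rule module.span_scale[OF int_module])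

lemma int_span_sum: "(\<And>i. i \<in> A \<Longrightarrow> g i \<in> int_span S) \<Longrightarrow> (\<Sum>i\<in>A. g i) \<in> int_span S"
  unfolding int_span_def by (rule module.span_sum[OF int_module])

lemma int_span_span: "int_span S \<subseteq> span S"
proof -
  have "module.subspace (\<lambda>k x. of_int k *s x) (span S)"
    unfolding module.subspace_def[OF int_module] by (auto intro: span_add span_scale span_zero)
  then show ?thesis
    unfolding int_span_def by (intro module.span_minimal[OF int_module] span_superset)
qed

lemma int_span_mono: "S \<subseteq> T \<Longrightarrow> int_span S \<subseteq> int_span T"
  unfolding int_span_def by (rule module.span_mono[OF int_module])

section \<open>Bracket identities and iterated brackets\<close>

lemma bracket_zero_left [simp]: "\<^bold>[0, x\<^bold>] = 0"
  using bracket_scale_left[of 0 0 x] by simp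

lemma bracket_zero_right [simp]: "\<^bold>[x, 0\<^bold>] = 0"
  using bracket_scale_right[of x 0 0] by simp

lemma bracket_minus_left: "\<^bold>[- x, y\<^bold>] = - \<^bold>[x, y\<^bold>]"
  using bracket_scale_left[of "-1" x y] by simp

lemma bracket_minus_right: "\<^bold>[x, - y\<^bold>] = - \<^bold>[x, y\<^bold>]"
  using bracket_scale_right[of x "-1" y] by simp

lemma bracket_sum_left: "\<^bold>[\<Sum>i\<in>A. f i, y\<^bold>] = (\<Sum>i\<in>A. \<^bold>[f i, y\<^bold>])"
  by (induction A rule: infinite_finite_induct) (auto simp: bracket_add_left)

lemma bracket_sum_right: "\<^bold>[x, \<Sum>i\<in>A. f i\<^bold>] = (\<Sum>i\<in>A. \<^bold>[x, f i\<^bold>])"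
  by (induction A rule: infinite_finite_induct) (auto simp: bracket_add_right)

lemma bracket_antisym: "\<^bold>[y, x\<^bold>] = - \<^bold>[x, y\<^bold>]"
proof -
  have "\<^bold>[x + y, x + y\<^bold>] = \<^bold>[x, y\<^bold>] + \<^bold>[y, x\<^bold>]"
    by (simp only: bracket_add_left bracket_add_right) (simp add: bracket_self)
  then have "\<^bold>[y, x\<^bold>] + \<^bold>[x, y\<^bold>] = 0"
    by (simp only: bracket_self add.commute)
  then show ?thesis
    by (simp only: eq_neg_iff_add_eq_0)
qed

lemma bracket_derivation: "\<^bold>[a, \<^bold>[x, y\<^bold>]\<^bold>] = \<^bold>[\<^bold>[a, x\<^bold>], y\<^bold>] + \<^bold>[x, \<^bold>[a, y\<^bold>]\<^bold>]"
proof -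
  have "\<^bold>[\<^bold>[a, x\<^bold>], y\<^bold>] = - \<^bold>[y, \<^bold>[a, x\<^bold>]\<^bold>]" "\<^bold>[x, \<^bold>[a, y\<^bold>]\<^bold>] = - \<^bold>[x, \<^bold>[y, a\<^bold>]\<^bold>]"
    using bracket_antisym[of y "\<^bold>[a, x\<^bold>]"] bracket_antisym[of y a]
    by (simp_all add: bracket_minus_right)
  then show ?thesis
    using jacobi[of a x y] by (simp only: add.commute add.left_commute) (metis add.commute add_eq_0_iff minus_add_distrib minus_minus)
qed

lemma bracket_derivation_left: "\<^bold>[\<^bold>[x, y\<^bold>], a\<^bold>] = \<^bold>[\<^bold>[x, a\<^bold>], y\<^bold>] + \<^bold>[x, \<^bold>[y, a\<^bold>]\<^bold>]"
proof -
  have "\<^bold>[\<^bold>[x, y\<^bold>], a\<^bold>] = - \<^bold>[a, \<^bold>[x, y\<^bold>]\<^bold>]" "\<^bold>[x, a\<^bold>] = - \<^bold>[a, x\<^bold>]" "\<^bold>[y, a\<^bold>] = - \<^bold>[a, y\<^bold>]"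
    by (rule bracket_antisym)+
  then show ?thesis
    by (simp add: bracket_derivation[of a] bracket_minus_left bracket_minus_right)
qed

lemma iter_add: "(bracket a ^^ n) (x + y) = (bracket a ^^ n) x + (bracket a ^^ n) y"
  by (induction n) (auto simp: bracket_add_right)

lemma iter_scale: "(bracket a ^^ n) (c *s x) = c *s (bracket a ^^ n) x"
  by (induction n) (auto simp: bracket_scale_right)

lemma iter_zero [simp]: "(bracket a ^^ n) 0 = 0"
  by (induction n) auto

lemma iter_zero_mono: "(bracket a ^^ m) x = 0 \<Longrightarrow> m \<le> n \<Longrightarrow> (bracket a ^^ n) x = 0"
  by (metis funpow_add iter_zero le_add_diff_inverse2 o_apply)

lemma iter_minus: "(bracket (- a) ^^ n) x = (-1) ^ n *s (bracket a ^^ n) x"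
  by (induction n) (auto simp: bracket_scale_right bracket_minus_left)

section \<open>Highest weight vectors of \<open>sl2\<close>-triples\<close>

definition sl2_triple :: "'g \<Rightarrow> 'g \<Rightarrow> 'g \<Rightarrow> bool" where
  "sl2_triple e hh f \<longleftrightarrow> \<^bold>[e, f\<^bold>] = hh \<and> \<^bold>[hh, e\<^bold>] = 2 *s e \<and> \<^bold>[hh, f\<^bold>] = (-2) *s f"

text \<open>The facts below lower a vector with \<open>f\<close>; through this exchange they also
  apply to raising it with \<open>e\<close>.\<close>

lemma sl2_triple_swap:
  assumes "sl2_triple e hh f"
  shows "sl2_triple f (- hh) e"
  using assms bracket_antisym[of f e] by (auto simp: sl2_triple_def bracket_minus_left)

lemma sl2_weight:
  assumes "sl2_triple e hh f" "\<^bold>[hh, v\<^bold>] = r *s v"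
  shows "\<^bold>[hh, (bracket f ^^ n) v\<^bold>] = (r - 2 * of_nat n) *s (bracket f ^^ n) v"
proof (induction n)
  case (Suc n)
  have "\<^bold>[hh, \<^bold>[f, (bracket f ^^ n) v\<^bold>]\<^bold>] = (-2) *s \<^bold>[f, (bracket f ^^ n) v\<^bold>] + (r - 2 * of_nat n) *s \<^bold>[f, (bracket f ^^ n) v\<^bold>]"
    using assms(1) Suc
    by (simp only: bracket_derivation[of hh] sl2_triple_def bracket_scale_left bracket_scale_right)
  also have "\<dots> = (r - 2 * of_nat (Suc n)) *s \<^bold>[f, (bracket f ^^ n) v\<^bold>]"
    by (simp only: scale_left_distrib[symmetric]) (simp add: algebra_simps)
  finally show ?case by simp
qed (use assms in simp)

text \<open>The factor is the sum of the weights \<open>r - 2 * k\<close>, 0 \<le> k \<le> n, that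
  appear while \<open>e\<close> is moved past \<open>n + 1\<close> copies of
  \<open>f\<close>.\<close>

lemma sl2_raise_lower:
  assumes "sl2_triple e hh f" "\<^bold>[hh, v\<^bold>] = r *s v" "\<^bold>[e, v\<^bold>] = 0"
  shows "\<^bold>[e, (bracket f ^^ Suc n) v\<^bold>] = (of_nat (Suc n) * (r - of_nat n)) *s (bracket f ^^ n) v"
proof (induction n)
  case 0
  then show ?case
    using assms by (simp add: bracket_derivation[of e] sl2_triple_def)
next
  case (Suc n)
  let ?w = "(bracket f ^^ Suc n) v"
  have "\<^bold>[e, \<^bold>[f, ?w\<^bold>]\<^bold>] = \<^bold>[hh, ?w\<^bold>] + \<^bold>[f, \<^bold>[e, ?w\<^bold>]\<^bold>]"
    using assms(1) by (simp only: bracket_derivation[of e] sl2_triple_def)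
  also have "\<dots> = (r - 2 * of_nat (Suc n)) *s ?w + (of_nat (Suc n) * (r - of_nat n)) *s ?w"
    by (simp only: sl2_weight[OF assms(1,2)] Suc bracket_scale_right) simp
  also have "\<dots> = (of_nat (Suc (Suc n)) * (r - of_nat (Suc n))) *s ?w"
    by (simp only: scale_left_distrib[symmetric]) (simp add: algebra_simps)
  finally show ?case by simp
qed

text \<open>Let \<open>m + 1\<close> be the first power of \<open>f\<close> that kills
  \<open>v\<close>. Raising this zero vector with \<open>e\<close> gives
  \<open>(m + 1) * (r - m)\<close> times a non-zero vector, hence \<open>r = m\<close>.\<close>

lemma sl2_highest_weight:
  assumes "sl2_triple e hh f" "\<^bold>[hh, v\<^bold>] = r *s v" "\<^bold>[e, v\<^bold>] = 0" "v \<noteq> 0"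
    and "(bracket f ^^ N) v = 0"
  obtains m where "r = of_nat m" "\<And>k. k \<le> m \<Longrightarrow> (bracket f ^^ k) v \<noteq> 0"
proof -
  define M where "M = (LEAST n. (bracket f ^^ n) v = 0)"
  have M: "(bracket f ^^ M) v = 0"
    unfolding M_def by (rule LeastI) (rule assms(5))
  have lt: "(bracket f ^^ n) v \<noteq> 0" if "n < M" for n
    using that not_less_Least unfolding M_def by blast
  have "M \<noteq> 0"
    using M assms(4) by (cases M) auto
  then obtain m where m: "M = Suc m" by (cases M) auto
  have "(of_nat (Suc m) * (r - of_nat m)) *s (bracket f ^^ m) v = 0"
    using sl2_raise_lower[OF assms(1-3), of m] M m by simp
  then have "r = of_nat m"
    using lt[of m] m by (simp del: of_nat_Suc)
  then show ?thesis
    using that[of m] lt m by auto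
qed

text \<open>Nilpotency at the single vector \<open>v\<close> is enough, so no finite-dimensional
  module is involved. This yields the one-dimensional root spaces, the downward steps in root
  strings and the vectors fixed by \<open>refl_aut\<close>.\<close>

lemma sl2_injective_negative:
  assumes "sl2_triple e hh f" "\<^bold>[hh, v\<^bold>] = r *s v" "\<^bold>[e, v\<^bold>] = 0"
    and "(bracket f ^^ N) v = 0" "Re r < 0"
  shows "v = 0"
proof (rule ccontr)
  assume "v \<noteq> 0"
  from sl2_highest_weight[OF assms(1-3) this assms(4)] obtain m where "r = of_nat m" by blast
  with assms(5) show False by simp
qed

section \<open>Exponentials of locally nilpotent inner derivations\<close>

definition ad_nilpotent_on :: "'g \<Rightarrow> bool" where
  "ad_nilpotent_on a \<longleftrightarrow> (\<forall>y. \<exists>n. (bracket a ^^ n) y = 0)"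

lemma ad_nilpotent_on_minus: "ad_nilpotent_on a \<Longrightarrow> ad_nilpotent_on (- a)"
  unfolding ad_nilpotent_on_def iter_minus by (metis scale_zero_right)

text \<open>The index set is an initial segment of the naturals. It is finite exactly when
  \<open>bracket a\<close> is nilpotent at \<open>z\<close>; otherwise the sum is 0 by the
  convention for infinite sets.\<close>

definition expad :: "'g \<Rightarrow> 'g \<Rightarrow> 'g" where
  "expad a z = (\<Sum>n | (bracket a ^^ n) z \<noteq> 0. (1 / fact n) *s (bracket a ^^ n) z)"

lemma expad_eq:
  assumes "(bracket a ^^ m) z = 0"
  shows "expad a z = (\<Sum>n<m. (1 / fact n) *s (bracket a ^^ n) z)"
  unfolding expad_def
proof (rule sum.mono_neutral_left)
  show "{n. (bracket a ^^ n) z \<noteq> 0} \<subseteq> {..<m}"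
    using iter_zero_mono[OF assms] by (metis (mono_tags) lessThan_iff mem_Collect_eq not_le subsetI)
qed auto

lemma expad_1: "\<^bold>[a, z\<^bold>] = 0 \<Longrightarrow> expad a z = z"
  by (subst expad_eq[where m = 1]) auto

lemma expad_2: "\<^bold>[a, \<^bold>[a, z\<^bold>]\<^bold>] = 0 \<Longrightarrow> expad a z = z + \<^bold>[a, z\<^bold>]"
  by (subst expad_eq[where m = 2]) (auto simp: eval_nat_numeral)

lemma expad_3:
  "\<^bold>[a, \<^bold>[a, \<^bold>[a, z\<^bold>]\<^bold>]\<^bold>] = 0 \<Longrightarrow> expad a z = z + \<^bold>[a, z\<^bold>] + (1 / 2) *s \<^bold>[a, \<^bold>[a, z\<^bold>]\<^bold>]"
  by (subst expad_eq[where m = 3]) (auto simp: eval_nat_numeral)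

lemma expad_add:
  assumes "ad_nilpotent_on a"
  shows "expad a (x + y) = expad a x + expad a y"
proof -
  obtain m n where "(bracket a ^^ m) x = 0" "(bracket a ^^ n) y = 0"
    using assms unfolding ad_nilpotent_on_def by blast
  then have *: "(bracket a ^^ max m n) x = 0" "(bracket a ^^ max m n) y = 0"
    by (auto elim: iter_zero_mono)
  then have "(bracket a ^^ max m n) (x + y) = 0"
    by (simp add: iter_add)
  from expad_eq[OF this] *[THEN expad_eq] show ?thesis
    by (simp add: iter_add scale_right_distrib sum.distrib)
qed

lemma expad_scale:
  assumes "ad_nilpotent_on a"
  shows "expad a (c *s x) = c *s expad a x"
proof -
  obtain m where m: "(bracket a ^^ m) x = 0"
    using assms unfolding ad_nilpotent_on_def by blast
  then have "(bracket a ^^ m) (c *s x) = 0"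
    by (simp add: iter_scale)
  from expad_eq[OF this] expad_eq[OF m] show ?thesis
    by (simp add: iter_scale scale_sum_right mult.commute)
qed

text \<open>The Leibniz rule for divided powers: the factorials absorb the binomial coefficients,
  which is why the exponential respects brackets.\<close>

lemma iter_bracket:
  "(1 / fact n) *s (bracket a ^^ n) \<^bold>[x, y\<^bold>] =
   (\<Sum>i\<le>n. \<^bold>[(1 / fact i) *s (bracket a ^^ i) x, (1 / fact (n - i)) *s (bracket a ^^ (n - i)) y\<^bold>])"
proof (induction n)
  case (Suc n)
  define X where "X i = (1 / fact i) *s (bracket a ^^ i) x" for i
  define Y where "Y i = (1 / fact i) *s (bracket a ^^ i) y" for i
  have aX: "\<^bold>[a, X i\<^bold>] = of_nat (Suc i) *s X (Suc i)" and aY: "\<^bold>[a, Y i\<^bold>] = of_nat (Suc i) *s Y (Suc i)" for i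
    by (simp_all add: X_def Y_def bracket_scale_right divide_simps del: of_nat_Suc)
  have "(of_nat (Suc n) * (1 / fact (Suc n))) *s (bracket a ^^ Suc n) \<^bold>[x, y\<^bold>]
      = \<^bold>[a, (1 / fact n) *s (bracket a ^^ n) \<^bold>[x, y\<^bold>]\<^bold>]"
    by (simp add: bracket_scale_right divide_simps del: of_nat_Suc)
  also have "\<dots> = (\<Sum>i\<le>n. \<^bold>[a, \<^bold>[X i, Y (n - i)\<^bold>]\<^bold>])"
    by (simp add: Suc bracket_sum_right X_def Y_def)
  also have "\<dots> = (\<Sum>i\<le>n. of_nat (Suc i) *s \<^bold>[X (Suc i), Y (n - i)\<^bold>])
      + (\<Sum>i\<le>n. of_nat (Suc n - i) *s \<^bold>[X i, Y (Suc n - i)\<^bold>])"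
    by (simp add: bracket_derivation[of a] aX aY bracket_scale_left bracket_scale_right sum.distrib
        Suc_diff_le del: of_nat_Suc)
  \<comment> \<open>The new summand at \<open>i = 0\<close> has coefficient 0, as has the one at
    \<open>i = Suc n\<close> added to the second sum. The coefficients \<open>i\<close> and
    \<open>Suc n - i\<close> then add up to \<open>Suc n\<close>.\<close>
  also have "(\<Sum>i\<le>n. of_nat (Suc i) *s \<^bold>[X (Suc i), Y (n - i)\<^bold>])
      = (\<Sum>i\<le>Suc n. of_nat i *s \<^bold>[X i, Y (Suc n - i)\<^bold>])"
    by (simp only: sum.atMost_Suc_shift[of _ n]) simp
  also have "(\<Sum>i\<le>n. of_nat (Suc n - i) *s \<^bold>[X i, Y (Suc n - i)\<^bold>])
      = (\<Sum>i\<le>Suc n. of_nat (Suc n - i) *s \<^bold>[X i, Y (Suc n - i)\<^bold>])"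
    by simp
  also have "(\<Sum>i\<le>Suc n. of_nat i *s \<^bold>[X i, Y (Suc n - i)\<^bold>]) + \<dots>
      = (\<Sum>i\<le>Suc n. of_nat (Suc n) *s \<^bold>[X i, Y (Suc n - i)\<^bold>])"
    by (simp only: sum.distrib[symmetric] scale_left_distrib[symmetric] of_nat_add[symmetric])
      (intro sum.cong, auto)
  finally have "of_nat (Suc n) *s ((1 / fact (Suc n)) *s (bracket a ^^ Suc n) \<^bold>[x, y\<^bold>])
      = of_nat (Suc n) *s (\<Sum>i\<le>Suc n. \<^bold>[X i, Y (Suc n - i)\<^bold>])"
    by (simp only: scale_sum_right scale_scale)
  then show ?case
    by (simp only: scale_cancel_left X_def Y_def) (simp del: of_nat_Suc)
qed simp

lemma expad_bracket:
  assumes "ad_nilpotent_on a"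
  shows "expad a \<^bold>[x, y\<^bold>] = \<^bold>[expad a x, expad a y\<^bold>]"
proof -
  obtain m n where mn: "(bracket a ^^ m) x = 0" "(bracket a ^^ n) y = 0"
    using assms unfolding ad_nilpotent_on_def by blast
  define X where "X i = (1 / fact i) *s (bracket a ^^ i) x" for i
  define Y where "Y i = (1 / fact i) *s (bracket a ^^ i) y" for i
  have X0: "X i = 0" if "m \<le> i" for i
    using iter_zero_mono[OF mn(1) that] by (simp add: X_def)
  have Y0: "Y i = 0" if "n \<le> i" for i
    using iter_zero_mono[OF mn(2) that] by (simp add: Y_def)
  \<comment> \<open>In degree \<open>m + n\<close> one index is at least \<open>m\<close> or the
    other at least \<open>n\<close>, so every summand vanishes. This bounds the nilpotency at the
    bracket.\<close>
  have "(1 / fact (m + n)) *s (bracket a ^^ (m + n)) \<^bold>[x, y\<^bold>] = (\<Sum>i\<le>m + n. \<^bold>[X i, Y (m + n - i)\<^bold>])"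
    unfolding X_def Y_def by (rule iter_bracket)
  also have "\<dots> = 0"
  proof (rule sum.neutral, rule)
    fix i
    show "\<^bold>[X i, Y (m + n - i)\<^bold>] = 0"
      by (cases "m \<le> i") (auto simp: X0 Y0)
  qed
  finally have "(bracket a ^^ (m + n)) \<^bold>[x, y\<^bold>] = 0"
    by simp
  then have "expad a \<^bold>[x, y\<^bold>] = (\<Sum>k<m + n. \<Sum>i\<le>k. \<^bold>[X i, Y (k - i)\<^bold>])"
    by (simp only: expad_eq iter_bracket X_def Y_def)
  also have "\<dots> = (\<Sum>(i, j)\<in>{(i, j). i + j < m + n}. \<^bold>[X i, Y j\<^bold>])"
    by (rule sum.triangle_reindex[symmetric])
  \<comment> \<open>The rectangle lies inside the triangle, and each term outside it has a zero
    factor.\<close>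
  also have "\<dots> = (\<Sum>(i, j)\<in>{..<m} \<times> {..<n}. \<^bold>[X i, Y j\<^bold>])"
  proof (rule sum.mono_neutral_right)
    show "finite {(i, j). i + j < m + n}"
      by (rule finite_subset[of _ "{..m + n} \<times> {..m + n}"]) auto
  qed (use X0 Y0 in \<open>fastforce simp: not_less[symmetric]\<close>)+
  also have "\<dots> = \<^bold>[\<Sum>i<m. X i, \<Sum>j<n. Y j\<^bold>]"
    by (simp add: sum.cartesian_product[symmetric] bracket_sum_left bracket_sum_right)
      (rule sum.swap)
  also have "\<dots> = \<^bold>[expad a x, expad a y\<^bold>]"
    using mn by (simp add: expad_eq X_def Y_def)
  finally show ?thesis .
qed

lemma expad_hom:
  assumes "ad_nilpotent_on a"
    and add: "\<And>x y. \<phi> (x + y) = \<phi> x + \<phi> y" and sc: "\<And>c x. \<phi> (c *s x) = c *s \<phi> x"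
    and br: "\<And>x y. \<phi> \<^bold>[x, y\<^bold>] = \<^bold>[\<phi> x, \<phi> y\<^bold>]"
  shows "\<phi> (expad a z) = expad (\<phi> a) (\<phi> z)"
proof -
  obtain m where m: "(bracket a ^^ m) z = 0"
    using assms unfolding ad_nilpotent_on_def by blast
  have \<phi>0: "\<phi> 0 = 0"
    using sc[of 0 0] by simp
  have \<phi>s: "\<phi> (\<Sum>i\<in>A. g i) = (\<Sum>i\<in>A. \<phi> (g i))" for g and A :: "nat set"
    by (induction A rule: infinite_finite_induct) (auto simp: add \<phi>0)
  have it: "\<phi> ((bracket a ^^ n) z) = (bracket (\<phi> a) ^^ n) (\<phi> z)" for n
    by (induction n) (auto simp: br)
  have "(bracket (\<phi> a) ^^ m) (\<phi> z) = 0"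
    using m it[of m] by (simp add: \<phi>0)
  with m show ?thesis
    by (simp add: expad_eq \<phi>s sc it)
qed

text \<open>In the group \<open>SL2\<close> this product of exponentials is the matrix with rows (0,
  1) and (-1, 0), the usual lift of the Weyl reflection.\<close>

definition sl2_reflection :: "'g \<Rightarrow> 'g \<Rightarrow> 'g \<Rightarrow> 'g" where
  "sl2_reflection e f z = expad e (expad (- f) (expad e z))"

text \<open>Stated for an arbitrary endomorphism \<phi>, because it is applied both to the Chevalley
  automorphism and to \<open>sl2_reflection\<close> itself.\<close>

lemma sl2_reflection_hom:
  assumes "ad_nilpotent_on e" "ad_nilpotent_on f"
    and add: "\<And>x y. \<phi> (x + y) = \<phi> x + \<phi> y" and sc: "\<And>c x. \<phi> (c *s x) = c *s \<phi> x"
    and br: "\<And>x y. \<phi> \<^bold>[x, y\<^bold>] = \<^bold>[\<phi> x, \<phi> y\<^bold>]"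
  shows "\<phi> (sl2_reflection e f z) = sl2_reflection (\<phi> e) (\<phi> f) (\<phi> z)"
proof -
  have "\<phi> (- f) = - \<phi> f"
    using sc[of "-1" f] by simp
  then show ?thesis
    using expad_hom[OF assms(1) add sc br] expad_hom[OF ad_nilpotent_on_minus[OF assms(2)] add sc br]
    by (simp add: sl2_reflection_def)
qed

lemma sl2_reflection_add:
  "ad_nilpotent_on e \<Longrightarrow> ad_nilpotent_on f \<Longrightarrow>
   sl2_reflection e f (x + y) = sl2_reflection e f x + sl2_reflection e f y"
  by (simp add: sl2_reflection_def expad_add ad_nilpotent_on_minus)

lemma sl2_reflection_scale:
  "ad_nilpotent_on e \<Longrightarrow> ad_nilpotent_on f \<Longrightarrow>
   sl2_reflection e f (c *s x) = c *s sl2_reflection e f x"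
  by (simp add: sl2_reflection_def expad_scale ad_nilpotent_on_minus)

lemma sl2_reflection_bracket:
  "ad_nilpotent_on e \<Longrightarrow> ad_nilpotent_on f \<Longrightarrow>
   sl2_reflection e f \<^bold>[x, y\<^bold>] = \<^bold>[sl2_reflection e f x, sl2_reflection e f y\<^bold>]"
  by (simp add: sl2_reflection_def expad_bracket ad_nilpotent_on_minus)

lemma sl2_bracket_simps:
  assumes "sl2_triple e hh f"
  shows "\<^bold>[e, f\<^bold>] = hh" "\<^bold>[f, e\<^bold>] = - hh" "\<^bold>[hh, e\<^bold>] = 2 *s e" "\<^bold>[e, hh\<^bold>] = (-2) *s e"
    "\<^bold>[hh, f\<^bold>] = (-2) *s f" "\<^bold>[f, hh\<^bold>] = 2 *s f"
  using assms bracket_antisym[of f e] bracket_antisym[of e hh] bracket_antisym[of f hh]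
  by (auto simp: sl2_triple_def)

lemma scale_double: "2 *s x = x + x"
  using scale_left_distrib[of 1 1 x] by simp

text \<open>The span of \<open>y\<close>, \<open>e\<close>, \<open>hh\<close>, \<open>f\<close> is
  stable under both exponentials, and on these vectors each series ends after at most three
  terms.\<close>

lemma sl2_reflection_cartan:
  assumes "sl2_triple e hh f" "ad_nilpotent_on e" "ad_nilpotent_on f"
    and "\<^bold>[y, e\<^bold>] = a *s e" "\<^bold>[y, f\<^bold>] = (- a) *s f" "\<^bold>[y, hh\<^bold>] = 0"
  shows "sl2_reflection e f y = y - a *s hh"
proof -
  note b = sl2_bracket_simps[OF assms(1)]
  have y: "\<^bold>[e, y\<^bold>] = - (a *s e)" "\<^bold>[f, y\<^bold>] = a *s f"
    using assms(4,5) bracket_antisym[of e y] bracket_antisym[of f y] by auto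
  have ne: "\<And>u v. expad e (u + v) = expad e u + expad e v" "\<And>c u. expad e (c *s u) = c *s expad e u"
    "\<And>u v. expad (- f) (u + v) = expad (- f) u + expad (- f) v"
    "\<And>c u. expad (- f) (c *s u) = c *s expad (- f) u"
    using assms(2,3) by (simp_all add: expad_add expad_scale ad_nilpotent_on_minus)
  have 1: "expad e y = y + (- a) *s e" "expad (- f) y = y + (- a) *s f"
    by (subst expad_2; simp add: y bracket_minus_left bracket_minus_right bracket_scale_right bracket_self)+
  have 2: "expad e hh = hh + (-2) *s e"
    by (subst expad_2; simp add: b bracket_minus_right bracket_scale_right bracket_self)
  have 3: "expad (- f) e = e + hh + (-1) *s f"
    by (subst expad_3; simp add: b bracket_minus_left bracket_minus_right bracket_scale_right bracket_self)
  have 4: "expad e e = e"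
    by (rule expad_1) (rule bracket_self)
  have "expad (- f) (expad e y) = y + (- a) *s e + (- a) *s hh"
    by (simp only: 1 ne 3) (simp add: scale_right_distrib scale_right_diff_distrib)
  then have "sl2_reflection e f y = y + (- a) *s e + (- a) *s e + (- a) *s (hh + (-2) *s e)"
    by (simp only: sl2_reflection_def ne 1 2 4)
  also have "\<dots> = y - a *s hh"
    by (simp add: scale_right_distrib scale_right_diff_distrib scale_double)
  finally show ?thesis .
qed

lemma sl2_reflection_e:
  assumes "sl2_triple e hh f" "ad_nilpotent_on e" "ad_nilpotent_on f"
  shows "sl2_reflection e f e = - f"
proof -
  note b = sl2_bracket_simps[OF assms(1)]
  have 2: "expad e hh = hh + (-2) *s e"
    by (subst expad_2; simp add: b bracket_minus_right bracket_scale_right bracket_self)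
  have 3: "expad (- f) e = e + hh + (-1) *s f"
    by (subst expad_3; simp add: b bracket_minus_left bracket_minus_right bracket_scale_right bracket_self)
  have 4: "expad e e = e"
    by (rule expad_1) (rule bracket_self)
  have 5: "expad e f = f + hh - e"
    by (subst expad_3; simp add: b bracket_minus_left bracket_minus_right bracket_scale_right bracket_self)
  have "sl2_reflection e f e = e + (hh + (-2) *s e) + (-1) *s (f + hh - e)"
    by (simp only: sl2_reflection_def 4 3 expad_add[OF assms(2)] expad_scale[OF assms(2)] 2 5)
  also have "\<dots> = - f"
    by (simp add: scale_double)
  finally show ?thesis .
qed

lemma sl2_reflection_f:
  assumes "sl2_triple e hh f" "ad_nilpotent_on e" "ad_nilpotent_on f"
  shows "sl2_reflection e f f = - e"
proof -
  note b = sl2_bracket_simps[OF assms(1)]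
  note nf = ad_nilpotent_on_minus[OF assms(3)]
  have 2: "expad (- f) hh = hh + (-2) *s f"
    by (subst expad_2; simp add: b bracket_minus_left bracket_minus_right bracket_scale_right bracket_self)
  have 3: "expad (- f) e = e + hh + (-1) *s f"
    by (subst expad_3; simp add: b bracket_minus_left bracket_minus_right bracket_scale_right bracket_self)
  have 4: "expad e e = e" "expad (- f) f = f"
    by (rule expad_1, simp add: bracket_minus_left bracket_self)+
  have 5: "expad e f = f + hh + (-1) *s e"
    by (subst expad_3; simp add: b bracket_minus_left bracket_minus_right bracket_scale_right bracket_self)
  have "expad (- f) (expad e f) = f + (hh + (-2) *s f) + (-1) *s (e + hh + (-1) *s f)"
    by (simp only: 5 expad_add[OF nf] expad_scale[OF nf] 2 3 4)
  also have "\<dots> = (-1) *s e"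
    by (simp add: scale_double)
  finally show ?thesis
    by (simp only: sl2_reflection_def expad_scale[OF assms(2)] 4) simp
qed

text \<open>Conjugating by the reflection exchanges \<open>e\<close> with \<open>- f\<close>; this gives
  \<open>exp(e) exp(-f) exp(e) = exp(-f) exp(e) exp(-f)\<close> on its image.\<close>

lemma sl2_reflection_twice:
  assumes "sl2_triple e hh f" "ad_nilpotent_on e" "ad_nilpotent_on f"
  shows "sl2_reflection e f (sl2_reflection e f z) = sl2_reflection (- f) (- e) (sl2_reflection e f z)"
  using sl2_reflection_hom[OF assms(2,3), of "sl2_reflection e f" z] sl2_reflection_e[OF assms]
    sl2_reflection_f[OF assms] sl2_reflection_add[OF assms(2,3)] sl2_reflection_scale[OF assms(2,3)]
    sl2_reflection_bracket[OF assms(2,3)]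
  by simp

end

section \<open>Root spaces and the form\<close>

lemma rscale_apply: "rscale a \<alpha> y = of_real a * \<alpha> y"
  by (simp add: rscale_def cscale_def)

lemma zscale_eq_rscale: "zscale k \<alpha> = rscale (of_int k) \<alpha>"
  by (simp add: zscale_def rscale_def)

context eala_data
begin

text \<open>The functionals on which the definite description in \<^const>\<open>dual_vec\<close> is not junk.\<close>

definition representable :: "'g functional set" where
  "representable = {\<alpha> \<in> dual. \<exists>t\<in>h. \<forall>y\<in>h. \<alpha> y = form y t}"

end

context eala
begin

section \<open>The invariant form on root spaces and its transfer to functionals\<close>

lemma form_add_right: "form x (y + z) = form x y + form x z"
  by (metis form_add form_sym)

lemma form_scale_right: "form x (a *s y) = a * form x y"
  by (metis form_scale form_sym)

lemma form_zero [simp]: "form 0 x = 0" "form x 0 = 0"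
  using form_scale[of 0 0 x] form_scale_right[of x 0 0] by simp_all

lemma form_minus: "form (- x) y = - form x y" "form x (- y) = - form x y"
  using form_scale[of "-1" x y] form_scale_right[of x "-1" y] by simp_all

lemma form_diff: "form (x - y) z = form x z - form y z" "form x (y - z) = form x y - form x z"
  using form_add[of x "- y" z] form_add_right[of x y "- z"] by (simp_all add: form_minus)

lemma form_sum: "form (\<Sum>i\<in>A. g i) y = (\<Sum>i\<in>A. form (g i) y)"
  by (induction A rule: infinite_finite_induct) (auto simp: form_add)

lemma form_skew: "form \<^bold>[x, y\<^bold>] z = - form y \<^bold>[x, z\<^bold>]"
  by (metis bracket_antisym form_invariant form_minus(1))

lemma h_subspace: "subspace h"
  using h_subalgebra by (simp add: subalgebra_def)

lemmas h_closed = subspace_add[OF h_subspace] subspace_scale[OF h_subspace]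
  subspace_0[OF h_subspace] subspace_neg[OF h_subspace] subspace_diff[OF h_subspace]
  subspace_sum[OF h_subspace]

lemma h_abelian: "x \<in> h \<Longrightarrow> y \<in> h \<Longrightarrow> \<^bold>[x, y\<^bold>] = 0"
  using root_space_zero by (auto simp: root_space_def)

lemma dualD:
  assumes "\<alpha> \<in> dual"
  shows "x \<in> h \<Longrightarrow> y \<in> h \<Longrightarrow> \<alpha> (x + y) = \<alpha> x + \<alpha> y"
    and "x \<in> h \<Longrightarrow> \<alpha> (a *s x) = a * \<alpha> x"
    and "x \<notin> h \<Longrightarrow> \<alpha> x = 0"
  using assms by (auto simp: dual_def)

lemma dual_diff:
  assumes "\<alpha> \<in> dual" "x \<in> h" "y \<in> h"
  shows "\<alpha> (x - y) = \<alpha> x - \<alpha> y"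
  using dualD(1)[OF assms(1), of x "(-1) *s y"] dualD(2)[OF assms(1), of y "-1"] assms h_closed
  by simp

lemma dual_zero: "0 \<in> dual"
  by (auto simp: dual_def)

lemma dual_add: "\<alpha> \<in> dual \<Longrightarrow> \<beta> \<in> dual \<Longrightarrow> \<alpha> + \<beta> \<in> dual"
  by (auto simp: dual_def algebra_simps)

lemma dual_cscale: "\<alpha> \<in> dual \<Longrightarrow> cscale a \<alpha> \<in> dual"
  by (auto simp: dual_def algebra_simps cscale_def)

lemma dual_uminus: "\<alpha> \<in> dual \<Longrightarrow> - \<alpha> \<in> dual"
  by (auto simp: dual_def algebra_simps)

lemma dual_minus: "\<alpha> \<in> dual \<Longrightarrow> \<beta> \<in> dual \<Longrightarrow> \<alpha> - \<beta> \<in> dual"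
  using dual_add[of \<alpha> "- \<beta>"] dual_uminus by simp

lemma dual_distinguish:
  assumes "\<alpha> \<in> dual" "\<beta> \<in> dual" "\<alpha> \<noteq> \<beta>"
  obtains y where "y \<in> h" "\<alpha> y \<noteq> \<beta> y"
  using assms dualD(3) by (metis ext)

lemma root_space_subspace: "subspace (root_space \<alpha>)"
  by (auto simp: subspace_def root_space_def bracket_add_right bracket_scale_right
      scale_right_distrib mult.commute)

lemmas root_space_closed = subspace_add[OF root_space_subspace] subspace_scale[OF root_space_subspace]
  subspace_0[OF root_space_subspace] subspace_neg[OF root_space_subspace]
  subspace_diff[OF root_space_subspace]

lemma root_spaceD: "x \<in> root_space \<alpha> \<Longrightarrow> y \<in> h \<Longrightarrow> \<^bold>[y, x\<^bold>] = \<alpha> y *s x"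
  by (simp add: root_space_def)

lemma root_space_bracket:
  assumes "x \<in> root_space \<alpha>" "y \<in> root_space \<beta>"
  shows "\<^bold>[x, y\<^bold>] \<in> root_space (\<alpha> + \<beta>)"
  using assms
  by (auto simp: root_space_def bracket_derivation bracket_scale_left bracket_scale_right
      scale_left_distrib)

lemma nonroot_zero: "\<alpha> \<in> dual \<Longrightarrow> \<alpha> \<notin> roots \<Longrightarrow> x \<in> root_space \<alpha> \<Longrightarrow> x = 0"
  by (auto simp: roots_def)

lemma root_dual: "\<alpha> \<in> roots \<Longrightarrow> \<alpha> \<in> dual"
  by (auto simp: roots_def)

lemma rootI: "\<alpha> \<in> dual \<Longrightarrow> x \<in> root_space \<alpha> \<Longrightarrow> x \<noteq> 0 \<Longrightarrow> \<alpha> \<in> roots"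
  by (auto simp: roots_def)

lemma rootE:
  assumes "\<alpha> \<in> roots"
  obtains x where "x \<in> root_space \<alpha>" "x \<noteq> 0"
  using assms root_space_closed(3) by (auto simp: roots_def)

lemma form_root_spaces:
  assumes "\<alpha> \<in> dual" "\<beta> \<in> dual" "x \<in> root_space \<alpha>" "y \<in> root_space \<beta>" "\<alpha> + \<beta> \<noteq> 0"
  shows "form x y = 0"
proof -
  obtain z where z: "z \<in> h" "(\<alpha> + \<beta>) z \<noteq> 0"
    using dual_distinguish[OF dual_add[OF assms(1,2)] dual_zero assms(5)] by auto
  have "\<alpha> z * form x y = - (\<beta> z * form x y)"
    using form_skew[of z x y] root_spaceD[OF assms(3) z(1)] root_spaceD[OF assms(4) z(1)]
    by (simp add: form_scale form_scale_right)
  then have "(\<alpha> + \<beta>) z * form x y = 0"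
    by (simp add: algebra_simps)
  with z show ?thesis by simp
qed

text \<open>Without such a partner \<open>x\<close> would be orthogonal to all root spaces, hence to
  their span, which is the whole algebra.\<close>

lemma form_pairing:
  assumes "\<alpha> \<in> dual" "x \<in> root_space \<alpha>" "x \<noteq> 0"
  obtains y where "y \<in> root_space (- \<alpha>)" "form x y \<noteq> 0"
proof -
  have "\<exists>\<beta>\<in>dual. \<exists>y\<in>root_space \<beta>. form x y \<noteq> 0"
  proof (rule ccontr)
    assume "\<not> ?thesis"
    then have "(\<Union>\<alpha>\<in>dual. root_space \<alpha>) \<subseteq> {y. form x y = 0}"
      by auto
    moreover have "subspace {y. form x y = 0}"
      by (auto simp: subspace_def form_add_right form_scale_right)
    ultimately have "span (\<Union>\<alpha>\<in>dual. root_space \<alpha>) \<subseteq> {y. form x y = 0}"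
      by (rule span_minimal)
    then show False
      using form_nondegenerate[of x] assms(3) root_decomposition by auto
  qed
  then obtain \<beta> y where \<beta>: "\<beta> \<in> dual" "y \<in> root_space \<beta>" "form x y \<noteq> 0" by blast
  then have "\<alpha> + \<beta> = 0"
    using form_root_spaces assms by blast
  then have "\<beta> = - \<alpha>"
    by (simp add: eq_neg_iff_add_eq_0 add.commute)
  with \<beta> that show ?thesis by simp
qed

lemma form_nondegenerate_h:
  assumes "x \<in> h" "\<And>y. y \<in> h \<Longrightarrow> form x y = 0"
  shows "x = 0"
  using form_pairing[of 0 x] assms dual_zero root_space_zero by (metis neg_equal_0_iff_equal)

lemma root_uminus: "\<alpha> \<in> roots \<Longrightarrow> - \<alpha> \<in> roots"
  by (metis dual_uminus form_pairing form_zero(2) rootE rootI root_dual)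

lemma dual_vec_eqI:
  assumes "t \<in> h" "\<And>y. y \<in> h \<Longrightarrow> \<alpha> y = form y t"
  shows "dual_vec \<alpha> = t"
  unfolding dual_vec_def
proof (rule the_equality)
  fix s assume s: "s \<in> h \<and> (\<forall>y\<in>h. \<alpha> y = form y s)"
  have "s - t = 0"
    by (rule form_nondegenerate_h) (use s assms in \<open>auto simp: form_diff h_closed form_sym\<close>)
  then show "s = t" by simp
qed (use assms in auto)

lemma dual_vec:
  assumes "\<alpha> \<in> representable"
  shows "dual_vec \<alpha> \<in> h" "y \<in> h \<Longrightarrow> form y (dual_vec \<alpha>) = \<alpha> y"
  using assms dual_vec_eqI[of _ \<alpha>] unfolding representable_def by auto

lemma representable_dual: "\<alpha> \<in> representable \<Longrightarrow> \<alpha> \<in> dual"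
  by (simp add: representable_def)

lemma representable_add:
  assumes "\<alpha> \<in> representable" "\<beta> \<in> representable"
  shows "\<alpha> + \<beta> \<in> representable" "dual_vec (\<alpha> + \<beta>) = dual_vec \<alpha> + dual_vec \<beta>"
proof -
  have *: "dual_vec \<alpha> + dual_vec \<beta> \<in> h" "\<And>y. y \<in> h \<Longrightarrow> (\<alpha> + \<beta>) y = form y (dual_vec \<alpha> + dual_vec \<beta>)"
    using dual_vec assms by (auto simp: h_closed form_add_right)
  then show "\<alpha> + \<beta> \<in> representable" "dual_vec (\<alpha> + \<beta>) = dual_vec \<alpha> + dual_vec \<beta>"
    using assms dual_add dual_vec_eqI[OF *] unfolding representable_def by blast+
qed

lemma representable_cscale:
  assumes "\<alpha> \<in> representable"
  shows "cscale a \<alpha> \<in> representable" "dual_vec (cscale a \<alpha>) = a *s dual_vec \<alpha>"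
proof -
  have *: "a *s dual_vec \<alpha> \<in> h" "\<And>y. y \<in> h \<Longrightarrow> (cscale a \<alpha>) y = form y (a *s dual_vec \<alpha>)"
    using dual_vec assms by (auto simp: h_closed form_scale_right cscale_def)
  then show "cscale a \<alpha> \<in> representable" "dual_vec (cscale a \<alpha>) = a *s dual_vec \<alpha>"
    using assms dual_cscale dual_vec_eqI[OF *] unfolding representable_def by blast+
qed

lemma representable_zero: "0 \<in> representable" "dual_vec 0 = 0"
  using dual_zero dual_vec_eqI[of 0 0] h_closed(3) unfolding representable_def
  by (auto intro!: bexI[of _ 0])

lemma representable_subspace: "funC.subspace representable"
  by (simp add: funC.subspace_def representable_zero representable_add representable_cscale)

lemma representable_minus:
  assumes "\<alpha> \<in> representable"
  shows "- \<alpha> \<in> representable" "dual_vec (- \<alpha>) = - dual_vec \<alpha>"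
  using representable_cscale[OF assms, of "-1"] by (simp_all add: cscale_def fun_Compl_def)

lemma representable_diff:
  assumes "\<alpha> \<in> representable" "\<beta> \<in> representable"
  shows "\<alpha> - \<beta> \<in> representable" "dual_vec (\<alpha> - \<beta>) = dual_vec \<alpha> - dual_vec \<beta>"
  using representable_add[OF assms(1) representable_minus(1)[OF assms(2)]]
    representable_minus(2)[OF assms(2)] by simp_all

lemma representable_sum:
  assumes "\<And>i. i \<in> A \<Longrightarrow> g i \<in> representable"
  shows "(\<Sum>i\<in>A. g i) \<in> representable \<and> dual_vec (\<Sum>i\<in>A. g i) = (\<Sum>i\<in>A. dual_vec (g i))"
  using assms
  by (induction A rule: infinite_finite_induct) (auto simp: representable_zero representable_add)

lemma bracket_opposite_form:
  assumes "x \<in> root_space \<alpha>" "y \<in> root_space (- \<alpha>)"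
  shows "\<^bold>[x, y\<^bold>] \<in> h" "z \<in> h \<Longrightarrow> form z \<^bold>[x, y\<^bold>] = \<alpha> z * form x y"
proof -
  show "\<^bold>[x, y\<^bold>] \<in> h"
    using root_space_bracket[OF assms] root_space_zero by simp
  show "form z \<^bold>[x, y\<^bold>] = \<alpha> z * form x y" if "z \<in> h"
    using form_invariant[of z x y] root_spaceD[OF assms(1) that] by (simp add: form_scale)
qed

text \<open>The representing vector is explicit: the bracket of two paired vectors of opposite root
  spaces, divided by their pairing.\<close>

lemma root_representable:
  assumes "\<alpha> \<in> roots"
  shows "\<alpha> \<in> representable"
proof -
  obtain x where x: "x \<in> root_space \<alpha>" "x \<noteq> 0"
    using rootE[OF assms] .
  obtain y where y: "y \<in> root_space (- \<alpha>)" "form x y \<noteq> 0"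
    using form_pairing[OF root_dual[OF assms] x] .
  have "(1 / form x y) *s \<^bold>[x, y\<^bold>] \<in> h" "\<forall>z\<in>h. \<alpha> z = form z ((1 / form x y) *s \<^bold>[x, y\<^bold>])"
    using bracket_opposite_form[OF x(1) y(1)] y(2) by (auto simp: h_closed form_scale_right)
  with root_dual[OF assms] show ?thesis
    unfolding representable_def by blast
qed

lemma bracket_opposite:
  assumes "\<alpha> \<in> representable" "x \<in> root_space \<alpha>" "y \<in> root_space (- \<alpha>)"
  shows "\<^bold>[x, y\<^bold>] = form x y *s dual_vec \<alpha>"
proof -
  have "\<^bold>[x, y\<^bold>] - form x y *s dual_vec \<alpha> = 0"
  proof (rule form_nondegenerate_h)
    show "\<^bold>[x, y\<^bold>] - form x y *s dual_vec \<alpha> \<in> h"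
      using bracket_opposite_form(1)[OF assms(2,3)] dual_vec(1)[OF assms(1)] by (simp add: h_closed)
    fix z assume "z \<in> h"
    then show "form (\<^bold>[x, y\<^bold>] - form x y *s dual_vec \<alpha>) z = 0"
      using bracket_opposite_form(2)[OF assms(2,3)] dual_vec(2)[OF assms(1)]
      by (simp add: form_sym[of _ z] form_diff form_scale_right)
  qed
  then show ?thesis by simp
qed

lemma dform_apply:
  assumes "\<alpha> \<in> representable" "\<beta> \<in> representable"
  shows "dform \<alpha> \<beta> = \<alpha> (dual_vec \<beta>)"
  unfolding dform_def using dual_vec[OF assms(1)] dual_vec(1)[OF assms(2)] by (metis form_sym)

lemma dform_sym: "dform \<alpha> \<beta> = dform \<beta> \<alpha>"
  by (simp add: dform_def form_sym)

lemma dform_add: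
  assumes "\<alpha> \<in> representable" "\<beta> \<in> representable" "\<gamma> \<in> representable"
  shows "dform (\<alpha> + \<beta>) \<gamma> = dform \<alpha> \<gamma> + dform \<beta> \<gamma>" "dform \<gamma> (\<alpha> + \<beta>) = dform \<gamma> \<alpha> + dform \<gamma> \<beta>"
  using assms by (simp_all add: dform_def representable_add form_add form_add_right)

lemma dform_diff:
  assumes "\<alpha> \<in> representable" "\<beta> \<in> representable" "\<gamma> \<in> representable"
  shows "dform (\<alpha> - \<beta>) \<gamma> = dform \<alpha> \<gamma> - dform \<beta> \<gamma>" "dform \<gamma> (\<alpha> - \<beta>) = dform \<gamma> \<alpha> - dform \<gamma> \<beta>"
  using assms by (simp_all add: dform_def representable_diff form_diff)

lemma dform_minus:
  assumes "\<alpha> \<in> representable" "\<gamma> \<in> representable"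
  shows "dform (- \<alpha>) \<gamma> = - dform \<alpha> \<gamma>" "dform \<gamma> (- \<alpha>) = - dform \<gamma> \<alpha>"
  using assms by (simp_all add: dform_def representable_minus form_minus)

lemma dform_cscale:
  assumes "\<alpha> \<in> representable" "\<gamma> \<in> representable"
  shows "dform (cscale a \<alpha>) \<gamma> = a * dform \<alpha> \<gamma>" "dform \<gamma> (cscale a \<alpha>) = a * dform \<gamma> \<alpha>"
  using assms by (simp_all add: dform_def representable_cscale form_scale form_scale_right)

lemma dform_sum:
  assumes "\<And>i. i \<in> A \<Longrightarrow> g i \<in> representable"
  shows "dform (\<Sum>i\<in>A. g i) \<gamma> = (\<Sum>i\<in>A. dform (g i) \<gamma>)"
proof -
  have "dual_vec (\<Sum>i\<in>A. g i) = (\<Sum>i\<in>A. dual_vec (g i))"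
    using representable_sum[of A g] assms by blast
  then show ?thesis by (simp add: dform_def form_sum)
qed

section \<open>The grading by weights\<close>

lemma root_spaces_independent:
  assumes "finite F" "F \<subseteq> dual" "\<And>\<alpha>. \<alpha> \<in> F \<Longrightarrow> z \<alpha> \<in> root_space \<alpha>" "(\<Sum>\<alpha>\<in>F. z \<alpha>) = 0" "\<alpha> \<in> F"
  shows "z \<alpha> = 0"
  using assms
proof (induction F arbitrary: z \<alpha> rule: finite_induct)
  case (insert a F)
  have z0: "z b = 0" if b: "b \<in> F" for b
  proof -
    have "b \<noteq> a" using b insert.hyps by auto
    then obtain y where y: "y \<in> h" "b y \<noteq> a y"
      using dual_distinguish[of b a] b insert.prems(1) by blast
    \<comment> \<open>Applying \<open>ad y - a y\<close> kills the summand of degree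
      \<open>a\<close> and rescales the one of degree \<open>b\<close> by the non-zero number
      \<open>b y - a y\<close>.\<close>
    have "0 = \<^bold>[y, \<Sum>\<alpha>\<in>insert a F. z \<alpha>\<^bold>] - a y *s (\<Sum>\<alpha>\<in>insert a F. z \<alpha>)"
      by (simp only: insert.prems(3)) simp
    also have "\<dots> = (\<Sum>\<alpha>\<in>insert a F. (\<alpha> y - a y) *s z \<alpha>)"
      by (simp only: bracket_sum_right scale_sum_right sum_subtractf[symmetric] scale_left_diff_distrib)
        (intro sum.cong arg_cong2[of _ _ _ _ "(-)"] root_spaceD[OF insert.prems(2) y(1)] refl)
    also have "\<dots> = (\<Sum>\<alpha>\<in>F. (\<alpha> y - a y) *s z \<alpha>)"
      using insert.hyps by simp
    finally have "(\<Sum>\<alpha>\<in>F. (\<alpha> y - a y) *s z \<alpha>) = 0" ..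
    then have "(b y - a y) *s z b = 0"
      using insert.IH[of "\<lambda>\<alpha>. (\<alpha> y - a y) *s z \<alpha>" b] insert.prems b
      by (auto intro: root_space_closed)
    with y show ?thesis by simp
  qed
  then have "z a = 0"
    using insert by simp
  with z0 insert.prems show ?case by auto
qed simp

lemma span_graded:
  assumes "\<And>\<alpha>. \<alpha> \<in> dual \<Longrightarrow> T \<alpha> \<subseteq> root_space \<alpha>"
    and "z \<in> span (\<Union>\<alpha>\<in>dual. T \<alpha>)" "z \<in> root_space \<delta>" "\<delta> \<in> dual"
  shows "z \<in> span (T \<delta>)"
proof -
  obtain t r where t: "finite t" "t \<subseteq> (\<Union>\<alpha>\<in>dual. T \<alpha>)" and z: "z = (\<Sum>a\<in>t. r a *s a)"
    using assms(2) unfolding span_explicit by blast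
  from t have "\<forall>a\<in>t. \<exists>\<alpha>. \<alpha> \<in> dual \<and> a \<in> T \<alpha>" by blast
  \<comment> \<open>One degree is fixed for each generator, so that the sum splits by degree even
    where the sets \<open>T \<alpha>\<close> overlap.\<close>
  then obtain w where w: "\<And>a. a \<in> t \<Longrightarrow> w a \<in> dual \<and> a \<in> T (w a)" by metis
  define zz where "zz \<alpha> = (\<Sum>a\<in>{a \<in> t. w a = \<alpha>}. r a *s a)" for \<alpha>
  have zzT: "zz \<alpha> \<in> span (T \<alpha>)" for \<alpha>
    unfolding zz_def using w by (intro span_sum span_scale span_base) auto
  have "span (T \<alpha>) \<subseteq> root_space \<alpha>" if "\<alpha> \<in> dual" for \<alpha>
    using assms(1)[OF that] root_space_subspace by (rule span_minimal)
  with zzT have zzr: "zz \<alpha> \<in> root_space \<alpha>" if "\<alpha> \<in> dual" for \<alpha>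
    using that by blast
  have zs: "z = (\<Sum>\<alpha>\<in>w ` t. zz \<alpha>)"
    unfolding z zz_def by (rule sum.image_gen[OF t(1)])
  have zz0: "zz \<alpha> = 0" if "\<alpha> \<notin> w ` t" for \<alpha>
    using that unfolding zz_def by (intro sum.neutral) auto
  \<comment> \<open>\<open>\<delta>\<close> need not be among the chosen degrees; its component is
    then 0.\<close>
  let ?F = "insert \<delta> (w ` t)"
  have "(\<Sum>\<alpha>\<in>?F. zz \<alpha>) = z"
    unfolding zs using zz0 t(1) by (intro sum.mono_neutral_right) auto
  then have "(\<Sum>\<alpha>\<in>?F. zz \<alpha> - (if \<alpha> = \<delta> then z else 0)) = 0"
    using t(1) by (simp only: sum_subtractf sum.delta' finite_insert finite_imageI) simp
  moreover have "zz \<alpha> - (if \<alpha> = \<delta> then z else 0) \<in> root_space \<alpha>" if "\<alpha> \<in> ?F" for \<alpha>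
    using that w assms(3,4) zzr by (auto intro!: root_space_closed)
  moreover have "finite ?F" "?F \<subseteq> dual"
    using t(1) w assms(4) by auto
  ultimately have "zz \<delta> - (if \<delta> = \<delta> then z else 0) = 0"
    by (intro root_spaces_independent[of ?F "\<lambda>\<alpha>. zz \<alpha> - (if \<alpha> = \<delta> then z else 0)"]) auto
  with zzT[of \<delta>] show ?thesis by simp
qed

text \<open>By \<open>span_graded\<close>, a relation expressing one generator through the others
  can be cut down to its own degree.\<close>

lemma independent_graded:
  assumes "\<And>\<alpha>. \<alpha> \<in> dual \<Longrightarrow> T \<alpha> \<subseteq> root_space \<alpha> \<and> independent (T \<alpha>)"
  shows "independent (\<Union>\<alpha>\<in>dual. T \<alpha>)"
proof
  assume "dependent (\<Union>\<alpha>\<in>dual. T \<alpha>)"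
  then obtain a where a: "a \<in> (\<Union>\<alpha>\<in>dual. T \<alpha>)" "a \<in> span ((\<Union>\<alpha>\<in>dual. T \<alpha>) - {a})"
    unfolding dependent_def by blast
  then obtain \<alpha> where \<alpha>: "\<alpha> \<in> dual" "a \<in> T \<alpha>" by blast
  have "(\<Union>\<alpha>\<in>dual. T \<alpha>) - {a} = (\<Union>\<alpha>\<in>dual. T \<alpha> - {a})" by blast
  then have "a \<in> span (T \<alpha> - {a})"
    using span_graded[of "\<lambda>\<alpha>. T \<alpha> - {a}" a \<alpha>] a \<alpha> assms by force
  with \<alpha> assms show False
    unfolding dependent_def by blast
qed

lemma dual_vec_inj: "inj_on dual_vec representable"
proof (rule inj_onI)
  fix \<alpha> \<beta> assume a: "\<alpha> \<in> representable" "\<beta> \<in> representable" "dual_vec \<alpha> = dual_vec \<beta>"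
  have "\<alpha> y = \<beta> y" for y
    using dual_vec(2)[OF a(1), of y] dual_vec(2)[OF a(2), of y] a(3)
      dualD(3)[OF representable_dual[OF a(1)], of y] dualD(3)[OF representable_dual[OF a(2)], of y]
    by (cases "y \<in> h") auto
  then show "\<alpha> = \<beta>" by (simp add: fun_eq_iff)
qed

lemma dual_vec_independent:
  assumes "funC.independent S" "S \<subseteq> representable"
  shows "independent (dual_vec ` S)"
proof
  \<comment> \<open>A linear map on all of \<open>g\<close> that inverts \<open>dual_vec\<close> on
    representable functionals; it carries a relation among dual vectors back to the
    functionals.\<close>
  define \<phi> :: "'g \<Rightarrow> 'g functional" where "\<phi> t = (\<lambda>y. if y \<in> h then form y t else 0)" for t
  have \<phi>: "\<phi> (dual_vec \<alpha>) = \<alpha>" if "\<alpha> \<in> representable" for \<alpha>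
    using dual_vec(2)[OF that] dualD(3)[OF representable_dual[OF that]] by (auto simp: \<phi>_def fun_eq_iff)
  assume "dependent (dual_vec ` S)"
  then obtain s where s: "s \<in> S" "dual_vec s \<in> span (dual_vec ` S - {dual_vec s})"
    unfolding dependent_def by blast
  have "\<phi> (dual_vec x) \<in> funC.span (S - {s})" if "x \<in> S" "dual_vec x \<noteq> dual_vec s" for x
  proof -
    have "\<phi> (dual_vec x) = x"
      using \<phi> assms(2) that(1) by blast
    moreover have "x \<in> S - {s}"
      using that by blast
    ultimately show ?thesis
      by (simp only: funC.span_base)
  qed
  then have "dual_vec ` S - {dual_vec s} \<subseteq> {t. \<phi> t \<in> funC.span (S - {s})}"
    by blast
  moreover have "subspace {t. \<phi> t \<in> funC.span (S - {s})}"
  proof -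
    have "\<phi> 0 = 0" "\<phi> (x + y) = \<phi> x + \<phi> y" "\<phi> (c *s x) = cscale c (\<phi> x)" for x y c
      by (auto simp: \<phi>_def fun_eq_iff form_add_right form_scale_right cscale_def)
    then show ?thesis
      by (auto simp: subspace_def intro: funC.span_zero funC.span_add funC.span_scale)
  qed
  ultimately have "span (dual_vec ` S - {dual_vec s}) \<subseteq> {t. \<phi> t \<in> funC.span (S - {s})}"
    by (rule span_minimal)
  moreover have "\<phi> (dual_vec s) = s"
    using \<phi> s(1) assms(2) by blast
  ultimately have "s \<in> funC.span (S - {s})"
    using s(2) by force
  with assms(1) s(1) show False
    unfolding funC.dependent_def by blast
qed

section \<open>The real span of the roots and its radical\<close>

lemma V_representable: "v \<in> V \<Longrightarrow> v \<in> representable"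
proof -
  have "funR.subspace representable"
    using representable_subspace by (auto simp: funR.subspace_def funC.subspace_def rscale_def)
  then have "V \<subseteq> representable"
    unfolding V_def using root_representable by (intro funR.span_minimal) auto
  then show "v \<in> V \<Longrightarrow> v \<in> representable" by blast
qed

lemma root_V: "\<alpha> \<in> roots \<Longrightarrow> \<alpha> \<in> V"
  by (simp add: V_def funR.span_base)

lemmas V_closed = funR.subspace_add[OF funR.subspace_span[of roots, folded V_def]]
  funR.subspace_scale[OF funR.subspace_span[of roots, folded V_def]]
  funR.subspace_0[OF funR.subspace_span[of roots, folded V_def]]
  funR.subspace_neg[OF funR.subspace_span[of roots, folded V_def]]
  funR.subspace_diff[OF funR.subspace_span[of roots, folded V_def]]
  funR.subspace_sum[OF funR.subspace_span[of roots, folded V_def]]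

lemma dform_rscale:
  assumes "\<alpha> \<in> representable" "\<gamma> \<in> representable"
  shows "dform (rscale a \<alpha>) \<gamma> = of_real a * dform \<alpha> \<gamma>" "dform \<gamma> (rscale a \<alpha>) = of_real a * dform \<gamma> \<alpha>"
  using dform_cscale[OF assms] by (simp_all add: rscale_def)

lemma dform_zero [simp]: "dform 0 v = 0" "dform v 0 = 0"
  by (simp_all add: dform_def representable_zero)

lemma V0_subspace: "funR.subspace V0"
  unfolding funR.subspace_def V0_def
  by (auto simp: V_closed dform_add dform_rscale V_representable)

lemmas V0_closed = funR.subspace_add[OF V0_subspace] funR.subspace_scale[OF V0_subspace]
  funR.subspace_0[OF V0_subspace] funR.subspace_neg[OF V0_subspace]
  funR.subspace_diff[OF V0_subspace] funR.subspace_sum[OF V0_subspace]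

lemma V0_V: "v \<in> V0 \<Longrightarrow> v \<in> V"
  by (simp add: V0_def)

lemma dform_V0: "v \<in> V0 \<Longrightarrow> w \<in> V \<Longrightarrow> dform v w = 0" "v \<in> V0 \<Longrightarrow> w \<in> V \<Longrightarrow> dform w v = 0"
  by (auto simp: V0_def dform_sym)

lemma coset_eq_iff: "coset v = coset w \<longleftrightarrow> v - w \<in> V0"
proof
  assume "coset v = coset w"
  then have "v \<in> coset w"
    using V0_closed(3) unfolding coset_def by force
  then show "v - w \<in> V0"
    unfolding coset_def by auto
next
  assume vw: "v - w \<in> V0"
  have "v + \<sigma> = w + ((v - w) + \<sigma>)" "w + \<sigma> = v + (\<sigma> - (v - w))" for \<sigma>
    by simp_all
  with vw show "coset v = coset w"
    unfolding coset_def using V0_closed(1,5) by blast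
qed

end

section \<open>Chevalley vectors, reflections and structure constants\<close>

context eala_data
begin

text \<open>For non-isotropic roots of a reduced system this is proportionality modulo
  \<open>V0\<close>; see \<open>parallel_scale\<close>.\<close>

definition parallel :: "'g functional \<Rightarrow> 'g functional \<Rightarrow> bool" where
  "parallel \<alpha> \<beta> \<longleftrightarrow> \<alpha> - \<beta> \<in> V0 \<or> \<alpha> + \<beta> \<in> V0"

definition re_form :: "'g functional \<Rightarrow> 'g functional \<Rightarrow> real" where
  "re_form v w = Re (dform v w)"

text \<open>The Cartan number (\<beta>, \<alpha>^v) as a real, so that order arguments apply;
  \<open>dform_coroot\<close> links it to \<open>coroot\<close>.\<close>

definition cartan :: "'g functional \<Rightarrow> 'g functional \<Rightarrow> real" where
  "cartan \<beta> \<alpha> = 2 * re_form \<beta> \<alpha> / re_form \<alpha> \<alpha>"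

definition coroot_vec :: "'g functional \<Rightarrow> 'g" where
  "coroot_vec \<alpha> = dual_vec (coroot \<alpha>)"

end

locale chevalley_eala = eala scale bracket form h
  for scale :: "complex \<Rightarrow> 'g::ab_group_add \<Rightarrow> 'g" (infixr \<open>*s\<close> 75)
    and bracket :: "'g \<Rightarrow> 'g \<Rightarrow> 'g" (\<open>\<^bold>[_, _\<^bold>]\<close>)
    and form :: "'g \<Rightarrow> 'g \<Rightarrow> complex"
    and h :: "'g set" +
  fixes \<tau> :: "'g \<Rightarrow> 'g"
  assumes normalized: normalized
    and reduced: reduced
    and chevalley: "chevalley_automorphism \<tau>"
begin

section \<open>Consequences of semidefiniteness and reducedness\<close>

abbreviation Rx :: "'g functional set" where "Rx \<equiv> nonisotropic_roots"

lemma Rx_root: "\<alpha> \<in> Rx \<Longrightarrow> \<alpha> \<in> roots"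
  by (simp add: nonisotropic_roots_def)

lemma Rx_V: "\<alpha> \<in> Rx \<Longrightarrow> \<alpha> \<in> V"
  by (simp add: Rx_root root_V)

lemma Rx_dual: "\<alpha> \<in> Rx \<Longrightarrow> \<alpha> \<in> dual"
  by (simp add: Rx_root root_dual)

lemma Rx_representable: "\<alpha> \<in> Rx \<Longrightarrow> \<alpha> \<in> representable"
  by (simp add: Rx_root root_representable)

lemma V_dual: "v \<in> V \<Longrightarrow> v \<in> dual"
  by (simp add: V_representable representable_dual)

lemma dform_re_form: "v \<in> V \<Longrightarrow> w \<in> V \<Longrightarrow> dform v w = of_real (re_form v w)"
  using normalized unfolding normalized_def re_form_def by (simp add: complex_is_Real_iff complex_eq_iff)

lemma re_form_sym: "re_form v w = re_form w v"
  by (simp add: re_form_def dform_sym)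

lemma re_form_zero [simp]: "re_form 0 w = 0" "re_form v 0 = 0"
  by (simp_all add: re_form_def)

lemma re_form_add:
  "u \<in> V \<Longrightarrow> v \<in> V \<Longrightarrow> w \<in> V \<Longrightarrow> re_form (u + v) w = re_form u w + re_form v w"
  "u \<in> V \<Longrightarrow> v \<in> V \<Longrightarrow> w \<in> V \<Longrightarrow> re_form w (u + v) = re_form w u + re_form w v"
  by (simp_all add: re_form_def dform_add V_representable)

lemma re_form_diff:
  "u \<in> V \<Longrightarrow> v \<in> V \<Longrightarrow> w \<in> V \<Longrightarrow> re_form (u - v) w = re_form u w - re_form v w"
  "u \<in> V \<Longrightarrow> v \<in> V \<Longrightarrow> w \<in> V \<Longrightarrow> re_form w (u - v) = re_form w u - re_form w v"
  by (simp_all add: re_form_def dform_diff V_representable)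

lemma re_form_minus:
  "u \<in> V \<Longrightarrow> w \<in> V \<Longrightarrow> re_form (- u) w = - re_form u w"
  "u \<in> V \<Longrightarrow> w \<in> V \<Longrightarrow> re_form w (- u) = - re_form w u"
  by (simp_all add: re_form_def dform_minus V_representable)

lemma re_form_rscale:
  "u \<in> V \<Longrightarrow> w \<in> V \<Longrightarrow> re_form (rscale r u) w = r * re_form u w"
  "u \<in> V \<Longrightarrow> w \<in> V \<Longrightarrow> re_form w (rscale r u) = r * re_form w u"
  by (simp_all add: re_form_def dform_rscale V_representable)

lemma re_form_sum:
  "(\<And>i. i \<in> A \<Longrightarrow> g i \<in> V) \<Longrightarrow> re_form (\<Sum>i\<in>A. g i) w = (\<Sum>i\<in>A. re_form (g i) w)"
  by (simp add: re_form_def dform_sum V_representable)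

lemmas re_form_linear = re_form_add re_form_diff re_form_minus re_form_rscale V_closed

lemma re_form_nonneg: "v \<in> V \<Longrightarrow> 0 \<le> re_form v v"
  using normalized unfolding normalized_def re_form_def by simp

lemma re_form_isotropic:
  assumes "v \<in> V" "w \<in> V" "re_form v v = 0"
  shows "re_form v w = 0"
proof (rule ccontr)
  assume n: "re_form v w \<noteq> 0"
  \<comment> \<open>\<open>s\<close> is chosen so that the quadratic form takes the value -1 at
    \<open>w - s v\<close>, against semidefiniteness.\<close>
  define s where "s = (re_form w w + 1) / (2 * re_form v w)"
  have "re_form (w - rscale s v) (w - rscale s v) = re_form w w - 2 * s * re_form v w"
    using assms by (simp add: re_form_linear re_form_sym[of w v] algebra_simps)
  also have "\<dots> = -1"
    using n by (simp add: s_def field_simps)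
  finally show False
    using re_form_nonneg[of "w - rscale s v"] assms by (simp add: V_closed)
qed

lemma V0_iff: "v \<in> V0 \<longleftrightarrow> v \<in> V \<and> re_form v v = 0"
proof
  assume "v \<in> V \<and> re_form v v = 0"
  then show "v \<in> V0"
    using re_form_isotropic by (simp add: V0_def dform_re_form)
qed (auto simp: V0_def re_form_def)

lemma re_form_V0: "v \<in> V0 \<Longrightarrow> w \<in> V \<Longrightarrow> re_form v w = 0" "v \<in> V0 \<Longrightarrow> w \<in> V \<Longrightarrow> re_form w v = 0"
  by (auto simp: re_form_def dform_V0)

lemma Rx_iff: "\<alpha> \<in> Rx \<longleftrightarrow> \<alpha> \<in> roots \<and> \<alpha> \<notin> V0"
  by (auto simp: nonisotropic_roots_def isotropic_roots_def V0_iff root_V dform_re_form)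

lemma isotropic_iff: "\<delta> \<in> isotropic_roots \<longleftrightarrow> \<delta> \<in> roots \<and> \<delta> \<in> V0"
  by (auto simp: isotropic_roots_def V0_iff root_V dform_re_form)

lemma re_form_pos: "\<alpha> \<in> Rx \<Longrightarrow> 0 < re_form \<alpha> \<alpha>"
  using re_form_nonneg[of \<alpha>] by (auto simp: Rx_iff V0_iff root_V less_le)

lemma re_form_neq0: "\<alpha> \<in> Rx \<Longrightarrow> re_form \<alpha> \<alpha> \<noteq> 0"
  using re_form_pos by fastforce

lemma Rx_nonzero: "\<alpha> \<in> Rx \<Longrightarrow> \<alpha> \<noteq> 0"
  using V0_closed(3) by (auto simp: Rx_iff)

lemma V0_uminus_iff: "- v \<in> V0 \<longleftrightarrow> v \<in> V0"
  using V0_closed(4) by force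

lemma Rx_uminus: "\<alpha> \<in> Rx \<Longrightarrow> - \<alpha> \<in> Rx"
  by (simp add: Rx_iff root_uminus V0_uminus_iff)

text \<open>Carries \<open>reduced\<close> from cosets to representatives: any real proportionality
  modulo \<open>V0\<close> between non-isotropic roots has ratio 1 or -1.\<close>

lemma parallel_scale:
  assumes "\<alpha> \<in> Rx" "\<beta> \<in> Rx" "\<beta> - rscale r \<alpha> \<in> V0"
  shows "r = 1 \<or> r = -1" "parallel \<beta> \<alpha>"
proof -
  have "coset \<alpha> \<noteq> coset 0" "coset \<beta> \<noteq> coset 0"
    using assms by (auto simp: coset_eq_iff Rx_iff)
  moreover have "coset (rscale r \<alpha>) = coset \<beta>"
    using assms(3) coset_eq_iff by metis
  moreover have "coset \<beta> \<in> roots_bar"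
    using assms Rx_root by (simp add: roots_bar_def)
  ultimately show r: "r = 1 \<or> r = -1"
    using reduced[unfolded reduced_def, rule_format, OF Rx_root[OF assms(1)], of r] by simp
  show "parallel \<beta> \<alpha>"
    using r assms(3) unfolding parallel_def by (auto simp: rscale_def cscale_def fun_eq_iff fun_diff_def plus_fun_def)
qed

lemma parallel_sym: "parallel \<alpha> \<beta> \<longleftrightarrow> parallel \<beta> \<alpha>"
proof -
  have 1: "\<beta> - \<alpha> = - (\<alpha> - \<beta>)" and 2: "\<beta> + \<alpha> = \<alpha> + \<beta>"
    by simp_all
  show ?thesis
    unfolding parallel_def 1 2 V0_uminus_iff ..
qed

text \<open>Strict Cauchy-Schwarz modulo \<open>V0\<close>: the part of \<beta> orthogonal to
  \<alpha> lies outside \<open>V0\<close>, since otherwise \<beta> would be parallel to \<alpha>, so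
  its length is positive.\<close>

lemma cartan_parallel_strict:
  assumes "\<alpha> \<in> Rx" "\<beta> \<in> Rx" "\<not> parallel \<beta> \<alpha>"
  shows "cartan \<beta> \<alpha> * cartan \<alpha> \<beta> < 4"
proof -
  define a b m where "a = re_form \<alpha> \<alpha>" and "b = re_form \<beta> \<beta>" and "m = re_form \<beta> \<alpha>"
  have pos: "a > 0" "b > 0"
    using re_form_pos assms by (auto simp: a_def b_def)
  define v where "v = \<beta> - rscale (m / a) \<alpha>"
  have vV: "v \<in> V"
    using assms Rx_V by (simp add: v_def V_closed)
  have "v \<notin> V0"
    using parallel_scale(2)[OF assms(1,2)] assms(3) by (auto simp: v_def)
  then have "re_form v v > 0"
    using re_form_nonneg[OF vV] vV by (auto simp: V0_iff less_le)
  also have "re_form v v = b - m\<^sup>2 / a"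
    using assms Rx_V pos
    by (simp add: v_def re_form_linear re_form_sym[of \<alpha> \<beta>] flip: a_def b_def m_def)
      (simp add: field_simps power2_eq_square)
  finally have "m\<^sup>2 < a * b"
    using pos by (simp add: field_simps)
  moreover have "cartan \<beta> \<alpha> * cartan \<alpha> \<beta> = 4 * (m\<^sup>2 / (a * b))"
    using pos by (simp add: cartan_def re_form_sym[of \<alpha> \<beta>] power2_eq_square flip: a_def b_def m_def)
  moreover have "0 < a * b"
    using pos by simp
  ultimately have "m\<^sup>2 / (a * b) < 1" "cartan \<beta> \<alpha> * cartan \<alpha> \<beta> = 4 * (m\<^sup>2 / (a * b))"
    by (simp_all only: pos_divide_less_eq mult_1)
  then show ?thesis by linarith
qed

section \<open>Coroots and one-dimensional root spaces\<close>

lemma coroot_representable: "\<alpha> \<in> representable \<Longrightarrow> coroot \<alpha> \<in> representable"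
  by (simp add: coroot_def representable_cscale)

lemma coroot_vec_eq: "\<alpha> \<in> representable \<Longrightarrow> coroot_vec \<alpha> = (2 / dform \<alpha> \<alpha>) *s dual_vec \<alpha>"
  by (simp add: coroot_vec_def coroot_def representable_cscale)

lemma coroot_vec_h: "\<alpha> \<in> representable \<Longrightarrow> coroot_vec \<alpha> \<in> h"
  by (simp add: coroot_vec_eq dual_vec h_closed)

lemma eval_coroot_vec:
  "\<beta> \<in> representable \<Longrightarrow> \<alpha> \<in> representable \<Longrightarrow> \<beta> (coroot_vec \<alpha>) = dform \<beta> (coroot \<alpha>)"
  by (simp add: coroot_vec_def dform_apply coroot_representable)

lemma dform_coroot: "\<beta> \<in> V \<Longrightarrow> \<alpha> \<in> V \<Longrightarrow> dform \<beta> (coroot \<alpha>) = of_real (cartan \<beta> \<alpha>)"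
  by (simp add: coroot_def dform_cscale V_representable dform_re_form cartan_def)

lemma bracket_coroot_vec:
  assumes "\<beta> \<in> V" "\<alpha> \<in> V" "x \<in> root_space \<beta>"
  shows "\<^bold>[coroot_vec \<alpha>, x\<^bold>] = of_real (cartan \<beta> \<alpha>) *s x"
  using assms root_spaceD[OF assms(3) coroot_vec_h] eval_coroot_vec dform_coroot
  by (simp add: V_representable)

lemma cartan_self: "\<alpha> \<in> Rx \<Longrightarrow> cartan \<alpha> \<alpha> = 2"
  by (simp add: cartan_def re_form_neq0)

lemma coroot_vec_nonzero: "\<alpha> \<in> Rx \<Longrightarrow> coroot_vec \<alpha> \<noteq> 0"
proof
  assume a: "\<alpha> \<in> Rx" "coroot_vec \<alpha> = 0"
  then have "of_real (cartan \<alpha> \<alpha>) = \<alpha> 0"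
    using eval_coroot_vec[of \<alpha> \<alpha>] dform_coroot[of \<alpha> \<alpha>] Rx_V Rx_representable by metis
  also have "\<alpha> 0 = 0"
    using dualD(2)[OF Rx_dual[OF a(1)], of 0 0] h_closed by simp
  finally show False
    using cartan_self[OF a(1)] by simp
qed

lemma Rx_ad_nilpotent: "\<alpha> \<in> Rx \<Longrightarrow> x \<in> root_space \<alpha> \<Longrightarrow> ad_nilpotent_on x"
  using ad_nilpotent by (auto simp: ad_nilpotent_on_def)

lemma cartan_uminus: "\<beta> \<in> V \<Longrightarrow> \<alpha> \<in> V \<Longrightarrow> cartan (- \<beta>) \<alpha> = - cartan \<beta> \<alpha>" "\<beta> \<in> V \<Longrightarrow> \<alpha> \<in> V \<Longrightarrow> cartan \<beta> (- \<alpha>) = - cartan \<beta> \<alpha>"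
  by (simp_all add: cartan_def re_form_linear)

lemma cartan_add: "\<beta> \<in> V \<Longrightarrow> \<gamma> \<in> V \<Longrightarrow> \<alpha> \<in> V \<Longrightarrow> cartan (\<beta> + \<gamma>) \<alpha> = cartan \<beta> \<alpha> + cartan \<gamma> \<alpha>"
  by (simp add: cartan_def re_form_linear add_divide_distrib distrib_left)

lemma cartan_rscale: "\<beta> \<in> V \<Longrightarrow> \<alpha> \<in> V \<Longrightarrow> cartan (rscale r \<beta>) \<alpha> = r * cartan \<beta> \<alpha>"
  by (simp add: cartan_def re_form_linear)

lemma root_sl2_triple:
  assumes "\<alpha> \<in> Rx" "e \<in> root_space \<alpha>" "f \<in> root_space (- \<alpha>)" "form e f = 2 / dform \<alpha> \<alpha>"
  shows "sl2_triple e (coroot_vec \<alpha>) f"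
  using bracket_opposite[OF Rx_representable[OF assms(1)] assms(2,3)] assms
    bracket_coroot_vec[of \<alpha> \<alpha> e] bracket_coroot_vec[of "- \<alpha>" \<alpha> f]
  by (simp add: sl2_triple_def coroot_vec_eq Rx_representable Rx_V V_closed cartan_self cartan_uminus)

lemma root_space_one_dim:
  assumes "\<alpha> \<in> Rx" "x \<in> root_space \<alpha>" "x \<noteq> 0" "y \<in> root_space \<alpha>"
  obtains c where "y = c *s x"
proof -
  obtain g where g: "g \<in> root_space (- \<alpha>)" "form x g \<noteq> 0"
    using form_pairing[OF Rx_dual[OF assms(1)] assms(2,3)] .
  define f where "f = (2 / dform \<alpha> \<alpha> / form x g) *s g"
  have f: "f \<in> root_space (- \<alpha>)" "form x f = 2 / dform \<alpha> \<alpha>"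
    using g by (auto simp: f_def root_space_closed form_scale_right)
  have da: "dform \<alpha> \<alpha> \<noteq> 0"
    using assms(1) by (simp add: dform_re_form Rx_V re_form_neq0)
  have t: "sl2_triple f (- coroot_vec \<alpha>) x"
    using root_sl2_triple[OF assms(1,2) f] by (rule sl2_triple_swap)
  \<comment> \<open>With this \<open>c\<close> the vector \<open>y - c x\<close> is orthogonal to
    \<open>f\<close>, hence commutes with it. For the swapped triple it is a highest weight vector
    of weight -2, which must vanish.\<close>
  define c where "c = form y f / form x f"
  let ?z = "y - c *s x"
  have zr: "?z \<in> root_space \<alpha>"
    using assms by (simp add: root_space_closed)
  have "form ?z f = 0"
    using f da by (simp add: form_diff form_scale c_def)
  then have "\<^bold>[f, ?z\<^bold>] = 0"
    using bracket_opposite[OF Rx_representable[OF assms(1)] zr f(1)] bracket_antisym[of f ?z] by simp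
  moreover have "\<^bold>[- coroot_vec \<alpha>, ?z\<^bold>] = (-2) *s ?z"
    using bracket_coroot_vec[of \<alpha> \<alpha> ?z] zr assms(1) by (simp only: bracket_minus_left) (simp add: Rx_V cartan_self)
  moreover obtain N where "(bracket x ^^ N) ?z = 0"
    using ad_nilpotent[OF assms(1,2)] by blast
  ultimately have "?z = 0"
    using sl2_injective_negative[OF t] by fastforce
  then have "y = c *s x" by simp
  then show ?thesis by (rule that)
qed

section \<open>Root vectors adapted to the Chevalley automorphism\<close>

lemma \<tau>_add: "\<tau> (x + y) = \<tau> x + \<tau> y"
  and \<tau>_scale: "\<tau> (c *s x) = c *s \<tau> x"
  and \<tau>_bracket: "\<tau> \<^bold>[x, y\<^bold>] = \<^bold>[\<tau> x, \<tau> y\<^bold>]"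
  and \<tau>_bij: "bij \<tau>"
  and \<tau>_h: "y \<in> h \<Longrightarrow> \<tau> y = - y"
  using chevalley
  by (auto simp: chevalley_automorphism_def lie_automorphism_def Vector_Spaces.linear_iff)

lemma \<tau>_minus: "\<tau> (- x) = - \<tau> x"
  using \<tau>_scale[of "-1" x] by simp

lemma \<tau>_eq_0: "\<tau> x = 0 \<longleftrightarrow> x = 0"
  using \<tau>_scale[of 0 0] bij_is_inj[OF \<tau>_bij] by (auto dest: injD[where y = 0])

lemma \<tau>_root_space: "x \<in> root_space \<alpha> \<Longrightarrow> \<tau> x \<in> root_space (- \<alpha>)"
proof -
  assume x: "x \<in> root_space \<alpha>"
  have "\<^bold>[y, \<tau> x\<^bold>] = - \<alpha> y *s \<tau> x" if "y \<in> h" for y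
    using \<tau>_bracket[of y x] \<tau>_h[OF that] root_spaceD[OF x that]
    by (simp add: \<tau>_scale bracket_minus_left minus_equation_iff[of _ "\<^bold>[y, \<tau> x\<^bold>]"])
  then show ?thesis by (simp add: root_space_def)
qed

text \<open>On the line of \<alpha> the square of \<open>\<tau>\<close> is a scalar
  \<open>c\<close>. The bracket of \<open>x\<close> and \<open>\<tau> x\<close> is a non-zero vector
  of \<open>h\<close>, where \<open>\<tau>\<close> is -1; applying \<open>\<tau>\<close> to it gives
  \<open>c = 1\<close>.\<close>

lemma \<tau>_twice:
  assumes "\<alpha> \<in> Rx" "x \<in> root_space \<alpha>"
  shows "\<tau> (\<tau> x) = x" "x \<noteq> 0 \<Longrightarrow> form x (\<tau> x) \<noteq> 0"
proof -
  have nz: "form x (\<tau> x) \<noteq> 0" if "x \<noteq> 0"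
  proof -
    obtain g where g: "g \<in> root_space (- \<alpha>)" "form x g \<noteq> 0"
      using form_pairing[OF Rx_dual[OF assms(1)] assms(2) \<open>x \<noteq> 0\<close>] .
    obtain c where "g = c *s \<tau> x"
      using root_space_one_dim[OF Rx_uminus[OF assms(1)] \<tau>_root_space[OF assms(2)] _ g(1)]
        \<tau>_eq_0 \<open>x \<noteq> 0\<close> by blast
    with g(2) show ?thesis by (auto simp: form_scale_right)
  qed
  then show "x \<noteq> 0 \<Longrightarrow> form x (\<tau> x) \<noteq> 0" .
  show "\<tau> (\<tau> x) = x"
  proof (cases "x = 0")
    case False
    have "\<tau> (\<tau> x) \<in> root_space \<alpha>"
      using \<tau>_root_space[OF \<tau>_root_space[OF assms(2)]] by simp
    then obtain c where c: "\<tau> (\<tau> x) = c *s x"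
      using root_space_one_dim[OF assms False] by blast
    let ?b = "\<^bold>[x, \<tau> x\<^bold>]"
    have b: "?b = form x (\<tau> x) *s dual_vec \<alpha>"
      using bracket_opposite[OF Rx_representable[OF assms(1)] assms(2) \<tau>_root_space[OF assms(2)]] .
    have "dual_vec \<alpha> \<noteq> 0"
      using coroot_vec_nonzero[OF assms(1)] by (auto simp: coroot_vec_eq Rx_representable assms)
    with b nz[OF False] have b0: "?b \<noteq> 0" by simp
    have "?b \<in> h"
      unfolding b using assms(1) by (simp add: h_closed dual_vec Rx_representable)
    then have "- ?b = \<tau> ?b"
      using \<tau>_h by simp
    also have "\<dots> = c *s \<^bold>[\<tau> x, x\<^bold>]"
      by (simp add: \<tau>_bracket c bracket_scale_right)
    also have "\<dots> = - (c *s ?b)"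
      using bracket_antisym[of "\<tau> x" x] by simp
    finally have "(c - 1) *s ?b = 0"
      by (simp add: scale_left_diff_distrib)
    with b0 c show ?thesis by simp
  qed (use \<tau>_eq_0 in simp)
qed

definition pre_chevalley_vector :: "'g functional \<Rightarrow> 'g" where
  "pre_chevalley_vector \<alpha> = (SOME e. e \<in> root_space \<alpha> \<and> form e (- \<tau> e) = 2 / dform \<alpha> \<alpha>)"

text \<open>One root of each pair is selected so that \<open>x (- \<alpha>) = - \<tau> (x \<alpha>)\<close> can hold for all roots.\<close>

definition xv :: "'g functional \<Rightarrow> 'g" where
  "xv \<alpha> = (if (SOME \<beta>. \<beta> \<in> {\<alpha>, - \<alpha>}) = \<alpha> then pre_chevalley_vector \<alpha>
           else - \<tau> (pre_chevalley_vector (- \<alpha>)))"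

lemma pre_chevalley_vector:
  assumes "\<alpha> \<in> Rx"
  shows "pre_chevalley_vector \<alpha> \<in> root_space \<alpha> \<and>
    form (pre_chevalley_vector \<alpha>) (- \<tau> (pre_chevalley_vector \<alpha>)) = 2 / dform \<alpha> \<alpha>"
proof -
  obtain e where e: "e \<in> root_space \<alpha>" "e \<noteq> 0"
    using rootE[OF Rx_root[OF assms]] .
  \<comment> \<open>Rescaling \<open>e\<close> by \<open>s\<close> multiplies the pairing by the
    square of \<open>s\<close>, so a complex square root achieves the normalization.\<close>
  define s where "s = csqrt (2 / dform \<alpha> \<alpha> / (- form e (\<tau> e)))"
  have "form (s *s e) (- \<tau> (s *s e)) = s\<^sup>2 * (- form e (\<tau> e))"
    by (simp add: \<tau>_scale form_scale form_scale_right form_minus power2_eq_square)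
  also have "\<dots> = 2 / dform \<alpha> \<alpha>"
    using \<tau>_twice(2)[OF assms e] by (simp add: s_def)
  finally have "\<exists>e. e \<in> root_space \<alpha> \<and> form e (- \<tau> e) = 2 / dform \<alpha> \<alpha>"
    using e root_space_closed(2) by blast
  then show ?thesis
    unfolding pre_chevalley_vector_def by (rule someI_ex)
qed

lemma neq_uminus: "\<alpha> \<in> Rx \<Longrightarrow> \<alpha> \<noteq> - \<alpha>"
proof
  assume a: "\<alpha> \<in> Rx" "\<alpha> = - \<alpha>"
  have "\<alpha> y = 0" for y
    using fun_cong[OF a(2), of y] by simp
  then have "\<alpha> = 0" by (simp add: fun_eq_iff)
  with Rx_nonzero[OF a(1)] show False by simp
qed

lemma xv_uminus:
  assumes "\<alpha> \<in> Rx"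
  shows "xv (- \<alpha>) = - \<tau> (xv \<alpha>)"
proof -
  define r where "r = (SOME \<beta>. \<beta> \<in> {\<alpha>, - \<alpha>})"
  have r: "r = \<alpha> \<or> r = - \<alpha>"
    using someI[of "\<lambda>\<beta>. \<beta> \<in> {\<alpha>, - \<alpha>}" \<alpha>] by (simp add: r_def)
  \<comment> \<open>The choice depends only on the set formed by \<alpha> and - \<alpha>, so both
    roots select the same representative.\<close>
  have r2: "(SOME \<beta>. \<beta> \<in> {- \<alpha>, - (- \<alpha>)}) = r"
    unfolding r_def by (simp add: insert_commute disj_commute)
  note n = neq_uminus[OF assms]
  show ?thesis
  proof (cases "r = \<alpha>")
    case True
    then show ?thesis
      using n by (simp only: xv_def r2 r_def[symmetric]) auto
  next
    case False
    with r have "r = - \<alpha>" by simp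
    then show ?thesis
      using n pre_chevalley_vector[OF Rx_uminus[OF assms]] \<tau>_twice(1)[OF Rx_uminus[OF assms]]
      by (simp only: xv_def r2 r_def[symmetric]) (auto simp: \<tau>_minus)
  qed
qed

lemma \<tau>_xv: "\<alpha> \<in> Rx \<Longrightarrow> \<tau> (xv \<alpha>) = - xv (- \<alpha>)"
  using xv_uminus[of \<alpha>] by simp

lemma xv_root_space: "\<alpha> \<in> Rx \<Longrightarrow> xv \<alpha> \<in> root_space \<alpha>"
  using pre_chevalley_vector[of \<alpha>] pre_chevalley_vector[OF Rx_uminus, of \<alpha>]
    \<tau>_root_space[of "pre_chevalley_vector (- \<alpha>)" "- \<alpha>"]
  by (auto simp: xv_def root_space_closed)

lemma form_xv:
  assumes "\<alpha> \<in> Rx"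
  shows "form (xv \<alpha>) (xv (- \<alpha>)) = 2 / dform \<alpha> \<alpha>"
proof -
  define p where "p = pre_chevalley_vector (- \<alpha>)"
  have p: "\<tau> (\<tau> p) = p" "form p (- \<tau> p) = 2 / dform (- \<alpha>) (- \<alpha>)"
    using pre_chevalley_vector[OF Rx_uminus[OF assms]] \<tau>_twice(1)[OF Rx_uminus[OF assms]]
    by (auto simp: p_def)
  have "form (- \<tau> p) (- \<tau> (- \<tau> p)) = form (- \<tau> p) p"
    by (simp add: \<tau>_minus p)
  also have "\<dots> = 2 / dform \<alpha> \<alpha>"
    using p(2) assms unfolding form_sym[of "- \<tau> p" p]
    by (simp add: dform_minus Rx_representable representable_minus)
  finally have "form (xv \<alpha>) (- \<tau> (xv \<alpha>)) = 2 / dform \<alpha> \<alpha>"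
    using pre_chevalley_vector[OF assms] by (simp add: xv_def flip: p_def)
  then show ?thesis
    by (simp add: xv_uminus[OF assms])
qed

lemma xv_nonzero: "\<alpha> \<in> Rx \<Longrightarrow> xv \<alpha> \<noteq> 0"
  using form_xv[of \<alpha>] by (auto simp: dform_re_form Rx_V re_form_neq0)

lemma xv_triple: "\<alpha> \<in> Rx \<Longrightarrow> sl2_triple (xv \<alpha>) (coroot_vec \<alpha>) (xv (- \<alpha>))"
  by (intro root_sl2_triple xv_root_space form_xv Rx_uminus)

lemma xv_opposite: "\<alpha> \<in> Rx \<Longrightarrow> \<^bold>[xv \<alpha>, xv (- \<alpha>)\<^bold>] = coroot_vec \<alpha>"
  using xv_triple by (simp add: sl2_triple_def)

lemma xv_ad_nilpotent: "\<alpha> \<in> Rx \<Longrightarrow> ad_nilpotent_on (xv \<alpha>)"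
  using Rx_ad_nilpotent xv_root_space by blast

lemma xv_multiple:
  assumes "\<alpha> \<in> Rx" "y \<in> root_space \<alpha>"
  obtains c where "y = c *s xv \<alpha>"
  using root_space_one_dim[OF assms(1) xv_root_space[OF assms(1)] xv_nonzero[OF assms(1)] assms(2)] .

section \<open>Cartan integers and reflections of functionals\<close>

lemma eval_coroot_vec_V: "\<beta> \<in> V \<Longrightarrow> \<alpha> \<in> V \<Longrightarrow> \<beta> (coroot_vec \<alpha>) = of_real (cartan \<beta> \<alpha>)"
  by (simp add: eval_coroot_vec V_representable dform_coroot)

text \<open>Raising \<open>x\<close> by \<open>q\<close> steps to the top of its string adds
  \<open>2 * q\<close> to the weight, and the weight at the top is a natural number.\<close>

lemma cartan_int:
  assumes "\<beta> \<in> roots" "\<alpha> \<in> Rx"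
  obtains k :: int where "cartan \<beta> \<alpha> = of_int k"
proof -
  obtain x where x: "x \<in> root_space \<beta>" "x \<noteq> 0"
    using rootE[OF assms(1)] .
  let ?e = "xv \<alpha>" and ?c = "complex_of_real (cartan \<beta> \<alpha>)"
  obtain N where N: "(bracket ?e ^^ N) x = 0"
    using xv_ad_nilpotent[OF assms(2)] by (auto simp: ad_nilpotent_on_def)
  define p where "p = (LEAST n. (bracket ?e ^^ n) x = 0)"
  have p: "(bracket ?e ^^ p) x = 0"
    unfolding p_def by (rule LeastI) (rule N)
  have "p \<noteq> 0"
    using p x by (cases p) auto
  then obtain q where q: "p = Suc q" by (cases p) auto
  let ?v = "(bracket ?e ^^ q) x"
  have v0: "?v \<noteq> 0"
    using not_less_Least[of q "\<lambda>n. (bracket ?e ^^ n) x = 0"] q by (auto simp: p_def[symmetric])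
  have ev: "\<^bold>[?e, ?v\<^bold>] = 0"
    using p q by simp
  note t = xv_triple[OF assms(2)]
  have "\<^bold>[- coroot_vec \<alpha>, x\<^bold>] = (- ?c) *s x"
    using bracket_coroot_vec[OF root_V Rx_V, of \<beta> \<alpha> x] assms x by (simp add: bracket_minus_left)
  from sl2_weight[OF sl2_triple_swap[OF t] this, of q]
  have "\<^bold>[coroot_vec \<alpha>, ?v\<^bold>] = - ((- ?c - 2 * of_nat q) *s ?v)"
    by (metis bracket_minus_left minus_minus)
  also have "\<dots> = (?c + 2 * of_nat q) *s ?v"
    by (simp only: scale_minus_left[symmetric]) simp
  finally have w: "\<^bold>[coroot_vec \<alpha>, ?v\<^bold>] = (?c + 2 * of_nat q) *s ?v" .
  obtain M where "(bracket (xv (- \<alpha>)) ^^ M) ?v = 0"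
    using xv_ad_nilpotent[OF Rx_uminus[OF assms(2)]] by (auto simp: ad_nilpotent_on_def)
  from sl2_highest_weight[OF t w ev v0 this] obtain m where "?c + 2 * of_nat q = of_nat m"
    by blast
  then have "?c = of_real (of_int (int m - 2 * int q))"
    by (simp add: algebra_simps)
  then have "cartan \<beta> \<alpha> = of_int (int m - 2 * int q)"
    by (simp only: of_real_eq_iff)
  then show ?thesis by (rule that)
qed

text \<open>In the swapped triple \<open>x\<close> has negative weight, so
  \<open>xv (- \<alpha>)\<close> cannot kill it.\<close>

lemma root_string_step_down:
  assumes "\<beta> \<in> roots" "\<alpha> \<in> Rx" "cartan \<beta> \<alpha> > 0"
  shows "\<beta> - \<alpha> \<in> roots"
proof -
  obtain x where x: "x \<in> root_space \<beta>" "x \<noteq> 0"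
    using rootE[OF assms(1)] .
  obtain N where N: "(bracket (xv \<alpha>) ^^ N) x = 0"
    using xv_ad_nilpotent[OF assms(2)] by (auto simp: ad_nilpotent_on_def)
  have "\<^bold>[- coroot_vec \<alpha>, x\<^bold>] = (- of_real (cartan \<beta> \<alpha>)) *s x"
    using bracket_coroot_vec[OF root_V Rx_V, of \<beta> \<alpha> x] assms x by (simp add: bracket_minus_left)
  then have "\<^bold>[xv (- \<alpha>), x\<^bold>] \<noteq> 0"
    using sl2_injective_negative[OF sl2_triple_swap[OF xv_triple[OF assms(2)]] _ _ N,
        of "- of_real (cartan \<beta> \<alpha>)"] x assms(3) by auto
  moreover have "\<^bold>[xv (- \<alpha>), x\<^bold>] \<in> root_space (\<beta> - \<alpha>)"
    using root_space_bracket[OF xv_root_space[OF Rx_uminus[OF assms(2)]] x(1)] by simp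
  ultimately show ?thesis
    using rootI[of "\<beta> - \<alpha>"] dual_minus[OF root_dual[OF assms(1)] Rx_dual[OF assms(2)]] by blast
qed

lemma reflection_eq: "\<beta> \<in> V \<Longrightarrow> \<alpha> \<in> V \<Longrightarrow> reflection \<alpha> \<beta> = \<beta> - rscale (cartan \<beta> \<alpha>) \<alpha>"
  by (simp add: reflection_def dform_coroot rscale_def)

lemma reflection_V: "\<beta> \<in> V \<Longrightarrow> \<alpha> \<in> V \<Longrightarrow> reflection \<alpha> \<beta> \<in> V"
  by (simp add: reflection_eq V_closed)

lemma re_form_reflection_self:
  assumes "\<beta> \<in> V" "\<alpha> \<in> Rx"
  shows "re_form (reflection \<alpha> \<beta>) (reflection \<alpha> \<beta>) = re_form \<beta> \<beta>"
  using assms re_form_neq0[OF assms(2)] Rx_V[OF assms(2)]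
  by (simp add: reflection_eq re_form_linear cartan_def re_form_sym[of \<alpha> \<beta>])

lemma cartan_reflection:
  assumes "\<beta> \<in> V" "\<alpha> \<in> Rx"
  shows "cartan (reflection \<alpha> \<beta>) \<alpha> = - cartan \<beta> \<alpha>"
  using assms re_form_neq0[OF assms(2)] Rx_V[OF assms(2)]
  by (simp add: reflection_eq re_form_linear cartan_def)

lemma reflection_involution:
  assumes "\<beta> \<in> V" "\<alpha> \<in> Rx"
  shows "reflection \<alpha> (reflection \<alpha> \<beta>) = \<beta>"
  using reflection_eq[OF reflection_V[OF assms(1) Rx_V[OF assms(2)]] Rx_V[OF assms(2)]]
    cartan_reflection[OF assms] reflection_eq[OF assms(1) Rx_V[OF assms(2)]]
  by (simp add: funR.scale_minus_left)

lemma cartan_V0: "\<delta> \<in> V0 \<Longrightarrow> \<alpha> \<in> V \<Longrightarrow> cartan \<delta> \<alpha> = 0"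
  by (simp add: cartan_def re_form_V0)

lemma reflection_add_V0:
  "\<beta> \<in> V \<Longrightarrow> \<alpha> \<in> V \<Longrightarrow> \<delta> \<in> V0 \<Longrightarrow> reflection \<alpha> (\<beta> + \<delta>) = reflection \<alpha> \<beta> + \<delta>"
  by (simp add: reflection_eq V_closed V0_V cartan_add cartan_V0)

lemma reflection_uminus: "\<beta> \<in> V \<Longrightarrow> \<alpha> \<in> V \<Longrightarrow> reflection \<alpha> (- \<beta>) = - reflection \<alpha> \<beta>"
  by (simp add: reflection_eq V_closed cartan_uminus funR.scale_minus_left)

lemma coroot_vec_reflection:
  assumes "\<beta> \<in> Rx" "\<alpha> \<in> Rx"
  shows "coroot_vec (reflection \<alpha> \<beta>) = coroot_vec \<beta> - \<alpha> (coroot_vec \<beta>) *s coroot_vec \<alpha>"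
proof -
  note V = Rx_V[OF assms(1)] Rx_V[OF assms(2)]
  note W = reflection_V[OF V]
  have "dform (reflection \<alpha> \<beta>) (reflection \<alpha> \<beta>) = dform \<beta> \<beta>"
    using re_form_reflection_self[OF V(1) assms(2)] W V by (simp add: dform_re_form)
  then have "coroot_vec (reflection \<alpha> \<beta>) = (2 / dform \<beta> \<beta>) *s (dual_vec \<beta> - of_real (cartan \<beta> \<alpha>) *s dual_vec \<alpha>)"
    using V by (simp add: coroot_vec_eq V_representable W)
      (simp add: reflection_eq V_representable V_closed representable_diff representable_cscale rscale_def)
  also have "\<dots> = coroot_vec \<beta> - \<alpha> (coroot_vec \<beta>) *s coroot_vec \<alpha>"
    using V by (simp add: coroot_vec_eq V_representable eval_coroot_vec_V cartan_def dform_re_form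
        scale_right_diff_distrib re_form_sym[of \<alpha> \<beta>] flip: coroot_vec_eq) (simp add: coroot_vec_eq V_representable dform_re_form mult.commute)
  finally show ?thesis .
qed

section \<open>Automorphisms lifting the reflections\<close>

definition refl_aut :: "'g functional \<Rightarrow> 'g \<Rightarrow> 'g" where
  "refl_aut \<gamma> z = sl2_reflection (xv \<gamma>) (xv (- \<gamma>)) z"

lemma refl_aut_hom:
  assumes "\<gamma> \<in> Rx"
  shows "refl_aut \<gamma> (x + y) = refl_aut \<gamma> x + refl_aut \<gamma> y"
    and "refl_aut \<gamma> (c *s x) = c *s refl_aut \<gamma> x"
    and "refl_aut \<gamma> \<^bold>[x, y\<^bold>] = \<^bold>[refl_aut \<gamma> x, refl_aut \<gamma> y\<^bold>]"
  using assms xv_ad_nilpotent[OF assms] xv_ad_nilpotent[OF Rx_uminus[OF assms]]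
  by (simp_all add: refl_aut_def sl2_reflection_add sl2_reflection_scale sl2_reflection_bracket)

lemma refl_aut_h:
  assumes "\<gamma> \<in> Rx" "y \<in> h"
  shows "refl_aut \<gamma> y = y - \<gamma> y *s coroot_vec \<gamma>"
  unfolding refl_aut_def
  using assms xv_ad_nilpotent[OF assms(1)] xv_ad_nilpotent[OF Rx_uminus[OF assms(1)]]
    root_spaceD[OF xv_root_space[OF assms(1)] assms(2)]
    root_spaceD[OF xv_root_space[OF Rx_uminus[OF assms(1)]] assms(2)]
    h_abelian[OF assms(2) coroot_vec_h[OF Rx_representable[OF assms(1)]]]
  by (intro sl2_reflection_cartan xv_triple) auto

lemma refl_aut_root_space:
  assumes "\<gamma> \<in> Rx" "\<beta> \<in> V" "x \<in> root_space \<beta>"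
  shows "refl_aut \<gamma> x \<in> root_space (reflection \<gamma> \<beta>)"
proof -
  have "\<^bold>[y, refl_aut \<gamma> x\<^bold>] = reflection \<gamma> \<beta> y *s refl_aut \<gamma> x" if y: "y \<in> h" for y
  proof -
    let ?h = "coroot_vec \<gamma>"
    have hh: "?h \<in> h"
      using assms(1) by (simp add: coroot_vec_h Rx_representable)
    \<comment> \<open>The reflected Cartan element, chosen so that \<open>refl_aut\<close> maps it
      to \<open>y\<close>; this moves the outer \<open>y\<close> inside the bracket.\<close>
    let ?y = "y - \<gamma> y *s ?h"
    have yh: "?y \<in> h"
      using y hh by (simp add: h_closed)
    have "\<gamma> ?y = - \<gamma> y"
      using dual_diff[OF Rx_dual[OF assms(1)] y, of "\<gamma> y *s ?h"] dualD(2)[OF Rx_dual[OF assms(1)] hh] hh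
        eval_coroot_vec_V[OF Rx_V Rx_V, OF assms(1) assms(1)] assms(1)
      by (simp add: h_closed cartan_self)
    then have "refl_aut \<gamma> ?y = y"
      using refl_aut_h[OF assms(1) yh] by simp
    then have "\<^bold>[y, refl_aut \<gamma> x\<^bold>] = refl_aut \<gamma> \<^bold>[?y, x\<^bold>]"
      by (simp only: refl_aut_hom[OF assms(1)])
    also have "\<dots> = \<beta> ?y *s refl_aut \<gamma> x"
      using root_spaceD[OF assms(3) yh] by (simp only: refl_aut_hom[OF assms(1)])
    also have "\<beta> ?y = \<beta> y - \<gamma> y * of_real (cartan \<beta> \<gamma>)"
      using dual_diff[OF V_dual[OF assms(2)] y, of "\<gamma> y *s ?h"] dualD(2)[OF V_dual[OF assms(2)] hh] hh
        eval_coroot_vec_V[OF assms(2) Rx_V[OF assms(1)]]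
      by (simp add: h_closed)
    also have "\<dots> = reflection \<gamma> \<beta> y"
      using assms Rx_V by (simp add: reflection_eq rscale_apply)
    finally show ?thesis .
  qed
  then show ?thesis by (simp add: root_space_def)
qed

text \<open>If the image vanished, so would the image of the coroot vector of \<beta>. But on
  \<open>h\<close> the map is a reflection, which has no kernel.\<close>

lemma refl_aut_xv_nonzero:
  assumes "\<gamma> \<in> Rx" "\<beta> \<in> Rx"
  shows "refl_aut \<gamma> (xv \<beta>) \<noteq> 0"
proof
  assume z: "refl_aut \<gamma> (xv \<beta>) = 0"
  let ?b = "coroot_vec \<beta>" and ?h = "coroot_vec \<gamma>"
  have hh: "?h \<in> h" "?b \<in> h"
    using assms by (simp_all add: coroot_vec_h Rx_representable)
  have "refl_aut \<gamma> ?b = \<^bold>[refl_aut \<gamma> (xv \<beta>), refl_aut \<gamma> (xv (- \<beta>))\<^bold>]"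
    using xv_opposite[OF assms(2)] refl_aut_hom(3)[OF assms(1)] by metis
  then have e: "?b = \<gamma> ?b *s ?h"
    using z refl_aut_h[OF assms(1) hh(2)] by simp
  then have "\<gamma> ?b = \<gamma> ?b * \<gamma> ?h"
    using dualD(2)[OF Rx_dual[OF assms(1)] hh(1), of "\<gamma> ?b"] by simp
  also have "\<gamma> ?h = 2"
    using eval_coroot_vec_V[OF Rx_V Rx_V, OF assms(1) assms(1)] assms(1) by (simp add: cartan_self)
  finally have "\<gamma> ?b = 0" by simp
  with e coroot_vec_nonzero[OF assms(2)] show False by simp
qed

lemma reflection_Rx:
  assumes "\<gamma> \<in> Rx" "\<beta> \<in> Rx"
  shows "reflection \<gamma> \<beta> \<in> Rx"
proof -
  have V: "reflection \<gamma> \<beta> \<in> V"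
    using assms Rx_V by (simp add: reflection_V)
  have "reflection \<gamma> \<beta> \<in> roots"
    using rootI[OF V_dual[OF V] refl_aut_root_space[OF assms(1) Rx_V xv_root_space] refl_aut_xv_nonzero] assms
    by blast
  moreover have "reflection \<gamma> \<beta> \<notin> V0"
    using re_form_reflection_self[OF Rx_V assms(1), OF assms(2)] re_form_neq0[OF assms(2)] by (simp add: V0_iff)
  ultimately show ?thesis by (simp add: Rx_iff)
qed

text \<open>Let \<open>c\<close> and \<open>c'\<close> be the scalars on the lines of \<beta> and -
  \<beta>. Mapping the coroot vector gives \<open>c * c' = 1\<close>. Conjugation by
  \<open>\<tau>\<close> turns \<open>?\<theta>\<close> into \<open>?\<theta>'\<close>, and the two
  agree on the image of \<open>?\<theta>\<close>; this gives \<open>c = c'\<close>.\<close>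

lemma refl_aut_xv:
  assumes "\<gamma> \<in> Rx" "\<beta> \<in> Rx"
  obtains s :: int where "s = 1 \<or> s = -1"
    "refl_aut \<gamma> (xv \<beta>) = of_int s *s xv (reflection \<gamma> \<beta>)"
proof -
  let ?w = "reflection \<gamma>"
  let ?\<theta> = "refl_aut \<gamma>" and ?\<theta>' = "sl2_reflection (- xv (- \<gamma>)) (- xv \<gamma>)"
  have n: "ad_nilpotent_on (xv \<gamma>)" "ad_nilpotent_on (xv (- \<gamma>))"
    using assms(1) by (simp_all add: xv_ad_nilpotent Rx_uminus)
  have hom': "?\<theta>' (c *s x) = c *s ?\<theta>' x" for c x
    using n by (simp add: sl2_reflection_scale ad_nilpotent_on_minus)
  note wRx = reflection_Rx[OF assms]
  have wm: "?w (- \<beta>) = - ?w \<beta>" "?w (- ?w \<beta>) = - \<beta>"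
    using assms Rx_V[OF assms(1)] Rx_V[OF assms(2)] Rx_V[OF wRx]
    by (simp_all add: reflection_uminus reflection_involution)
  obtain c where c: "?\<theta> (xv \<beta>) = c *s xv (?w \<beta>)"
    using xv_multiple[OF wRx refl_aut_root_space[OF assms(1) Rx_V xv_root_space]] assms by blast
  obtain c' where c': "?\<theta> (xv (- \<beta>)) = c' *s xv (- ?w \<beta>)"
    using xv_multiple[OF Rx_uminus[OF wRx]]
      refl_aut_root_space[OF assms(1) Rx_V xv_root_space, of "- \<beta>"] assms Rx_uminus wm(1) by metis
  obtain d where d: "?\<theta> (xv (- ?w \<beta>)) = d *s xv (- \<beta>)"
    using xv_multiple[OF Rx_uminus[OF assms(2)]]
      refl_aut_root_space[OF assms(1) Rx_V xv_root_space, of "- ?w \<beta>"] Rx_uminus wRx wm(2) by metis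
  have d0: "d \<noteq> 0"
    using refl_aut_xv_nonzero[OF assms(1) Rx_uminus[OF wRx]] d by auto
  \<comment> \<open>A non-zero multiple \<open>d\<close> of \<open>xv (- \<beta>)\<close> lies in
    the image of \<open>?\<theta>\<close>, which makes \<open>sl2_reflection_twice\<close>
    applicable.\<close>
  have "d *s ?\<theta> (xv (- \<beta>)) = d *s ?\<theta>' (xv (- \<beta>))"
    using sl2_reflection_twice[OF xv_triple[OF assms(1)] n, of "xv (- ?w \<beta>)"] d
    by (simp add: hom' refl_aut_hom(2)[OF assms(1)] flip: refl_aut_def)
  then have "?\<theta>' (xv (- \<beta>)) = c' *s xv (- ?w \<beta>)"
    unfolding scale_cancel_left using d0 c' by metis
  moreover have "- (c *s xv (- ?w \<beta>)) = - ?\<theta>' (xv (- \<beta>))"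
  proof -
    have "\<tau> (?\<theta> (xv \<beta>)) = ?\<theta>' (\<tau> (xv \<beta>))"
      using sl2_reflection_hom[OF n, of \<tau> "xv \<beta>"] \<tau>_xv[OF assms(1)] \<tau>_xv[OF Rx_uminus[OF assms(1)]]
      by (simp add: refl_aut_def \<tau>_add \<tau>_scale \<tau>_bracket)
    then show ?thesis
      using hom'[of "-1"] by (simp add: c \<tau>_scale \<tau>_xv wRx assms)
  qed
  ultimately have "c' = c"
    using xv_nonzero[OF Rx_uminus[OF wRx]] by simp
  have "c * c' = 1"
  proof -
    have "coroot_vec (?w \<beta>) = ?\<theta> (coroot_vec \<beta>)"
      using assms by (simp add: refl_aut_h coroot_vec_h Rx_representable coroot_vec_reflection)
    also have "\<dots> = \<^bold>[?\<theta> (xv \<beta>), ?\<theta> (xv (- \<beta>))\<^bold>]"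
      using xv_opposite[OF assms(2)] refl_aut_hom(3)[OF assms(1)] by metis
    also have "\<dots> = (c * c') *s coroot_vec (?w \<beta>)"
      using xv_opposite[OF wRx] by (simp add: c c' bracket_scale_left bracket_scale_right mult.commute)
    finally have "(c * c' - 1) *s coroot_vec (?w \<beta>) = 0"
      by (simp add: scale_left_diff_distrib)
    then show ?thesis
      using coroot_vec_nonzero[OF wRx] by simp
  qed
  with \<open>c' = c\<close> have "c = 1 \<or> c = -1"
    by (simp add: square_eq_1_iff)
  then show ?thesis
    using that[of 1] that[of "-1"] c by auto
qed

text \<open>The possible shapes of an \<open>\<alpha>\<close>-string through \<open>\<beta>\<close> leave finitely many cases for the
  Cartan integers \<open>p\<close>, \<open>q\<close> of \<open>\<alpha>\<close>, \<open>\<beta>\<close> and \<open>p + 2\<close>, \<open>r\<close> of \<open>\<alpha>\<close>, \<open>\<alpha> + \<beta>\<close>; here \<open>a = (\<alpha>, \<alpha>)\<close>, \<open>b = (\<beta>, \<beta>)\<close>.\<close>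

lemma string_length_identity:
  fixes a b :: real and p q :: int and u d :: nat
  assumes "a > 0" "b > 0" "of_int p * a = of_int q * b"
    and "p = int d - int u" "1 \<le> u" "d + u \<le> 3" "p * q < 4"
    and "of_int (p + 2) * a = of_int r * (a + b + of_int p * a)" "(p + 2) * r < 4"
  shows "real u * (a + b + of_int p * a) = real (d + 1) * b"
proof -
  have "of_int p * a < 0 \<longleftrightarrow> of_int q * b < 0"
    using assms(3) by simp
  then have q: "p < 0 \<Longrightarrow> q < 0"
    using assms(1,2) by (simp add: mult_less_0_iff)
  consider "u = 1 \<and> d = 0" | "u = 2 \<and> d = 0" | "u = 3 \<and> d = 0" | "u = 1 \<and> d = 1"
    | "u = 2 \<and> d = 1" | "u = 1 \<and> d = 2"
    using assms(5,6) by linarith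
  then show ?thesis
  proof cases
    case 1
    then show ?thesis using assms(4) by simp
  next
    case 2
    then have p: "p = -2" using assms(4) by simp
    with q assms(7) have "q = -1" by simp
    with p 2 assms(3) show ?thesis by simp
  next
    case 3
    then have p: "p = -3" using assms(4) by simp
    with q assms(7) have "q = -1" by simp
    with p 3 assms(3) show ?thesis by simp
  next
    case 4
    then have p: "p = 0" using assms(4) by simp
    have "r < 2" using assms(9) p by simp
    moreover have "r > 0"
    proof (rule ccontr)
      assume "\<not> r > 0"
      then have "of_int r * (a + b) \<le> 0"
        using assms(1,2) by (intro mult_nonpos_nonneg) auto
      then show False using assms(1,8) p by simp
    qed
    ultimately have "r = 1" by simp
    then show ?thesis using p 4 assms(8) by simp
  next
    case 5
    then have "p = -1" using assms(4) by simp
    with 5 show ?thesis by simp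
  next
    case 6
    then have p: "p = 1" using assms(4) by simp
    have "r < 2" using assms(9) p by simp
    moreover have "r > 0"
    proof (rule ccontr)
      assume "\<not> r > 0"
      then have "of_int r * (a + b + a) \<le> 0"
        using assms(1,2) by (intro mult_nonpos_nonneg) auto
      then show False using assms(1,8) p by simp
    qed
    ultimately have "r = 1" by simp
    then show ?thesis using p 6 assms(8) by simp
  qed
qed

section \<open>Root strings\<close>

lemma cartan_pair:
  assumes "\<alpha> \<in> Rx" "\<beta> \<in> Rx" "\<not> parallel \<beta> \<alpha>"
  obtains p q :: int where "cartan \<beta> \<alpha> = of_int p" "cartan \<alpha> \<beta> = of_int q" "p * q < 4"
    "of_int p * re_form \<alpha> \<alpha> = of_int q * re_form \<beta> \<beta>" "\<bar>p\<bar> \<le> 3"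
proof -
  obtain p where p: "cartan \<beta> \<alpha> = of_int p"
    using cartan_int[OF Rx_root[OF assms(2)] assms(1)] .
  obtain q where q: "cartan \<alpha> \<beta> = of_int q"
    using cartan_int[OF Rx_root[OF assms(1)] assms(2)] .
  have "of_int (p * q) < (4::real)"
    using cartan_parallel_strict[OF assms] p q by simp
  then have pq: "p * q < 4" by linarith
  have e: "of_int p * re_form \<alpha> \<alpha> = of_int q * re_form \<beta> \<beta>"
    using p q re_form_neq0 assms by (simp add: cartan_def re_form_sym[of \<alpha> \<beta>] field_simps)
  have pos: "re_form \<alpha> \<alpha> > 0" "re_form \<beta> \<beta> > 0"
    using assms re_form_pos by auto
  \<comment> \<open>Both numbers are (\<beta>, \<alpha>) up to positive factors. Equal signs and a
    product below 4 bound each of them by 3.\<close>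
  have sg: "p > 0 \<longleftrightarrow> q > 0" "p < 0 \<longleftrightarrow> q < 0"
  proof -
    have "0 < of_int p * re_form \<alpha> \<alpha> \<longleftrightarrow> 0 < of_int q * re_form \<beta> \<beta>"
      "of_int p * re_form \<alpha> \<alpha> < 0 \<longleftrightarrow> of_int q * re_form \<beta> \<beta> < 0"
      using e by simp_all
    with pos show "p > 0 \<longleftrightarrow> q > 0" "p < 0 \<longleftrightarrow> q < 0"
      by (simp_all add: zero_less_mult_iff mult_less_0_iff)
  qed
  have "\<bar>p\<bar> \<le> 3"
  proof (rule ccontr)
    assume n: "\<not> \<bar>p\<bar> \<le> 3"
    then have "4 * 1 \<le> \<bar>p\<bar> * \<bar>q\<bar>"
      using sg by (intro mult_mono) auto
    also have "\<bar>p\<bar> * \<bar>q\<bar> = p * q"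
      using sg by (cases "p > 0"; cases "p < 0") auto
    finally show False using pq by simp
  qed
  with p q pq e show ?thesis by (rule that)
qed

text \<open>If some \<beta> + j \<alpha> were in \<open>V0\<close>, then \<beta> would be parallel
  to \<alpha>. Hence no member of the string is isotropic or parallel to \<alpha>.\<close>

lemma string_root:
  assumes "\<alpha> \<in> Rx" "\<beta> \<in> Rx" "\<not> parallel \<beta> \<alpha>" "\<beta> + zscale k \<alpha> \<in> roots"
  shows "\<beta> + zscale k \<alpha> \<in> Rx" "\<not> parallel (\<beta> + zscale k \<alpha>) \<alpha>"
proof -
  have no: "\<beta> + zscale j \<alpha> \<notin> V0" for j
    using parallel_scale(2)[OF assms(1,2), of "- of_int j"] assms(3)
    by (auto simp: zscale_eq_rscale funR.scale_minus_left)
  then show "\<beta> + zscale k \<alpha> \<in> Rx"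
    using assms(4) by (simp add: Rx_iff)
  have "\<beta> + zscale k \<alpha> - \<alpha> = \<beta> + zscale (k - 1) \<alpha>" "\<beta> + zscale k \<alpha> + \<alpha> = \<beta> + zscale (k + 1) \<alpha>"
    by (simp_all add: zscale_def cscale_def fun_eq_iff algebra_simps)
  then show "\<not> parallel (\<beta> + zscale k \<alpha>) \<alpha>"
    unfolding parallel_def using no by metis
qed

lemma cartan_string:
  assumes "\<alpha> \<in> Rx" "\<beta> \<in> V" "cartan \<beta> \<alpha> = of_int p"
  shows "cartan (\<beta> + zscale k \<alpha>) \<alpha> = of_int (p + 2 * k)"
  using assms by (simp add: cartan_add cartan_rscale Rx_V V_closed zscale_eq_rscale cartan_self)

lemma root_string:
  assumes "\<alpha> \<in> Rx" "\<beta> \<in> Rx" "\<not> parallel \<beta> \<alpha>"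
  obtains u d :: nat where "{n. \<beta> + zscale n \<alpha> \<in> roots} = {- int d..int u}"
    "cartan \<beta> \<alpha> = of_int (int d - int u)" "d + u \<le> 3"
proof -
  define S where "S = {n. \<beta> + zscale n \<alpha> \<in> roots}"
  obtain p where p: "cartan \<beta> \<alpha> = of_int p"
    using cartan_int[OF Rx_root[OF assms(2)] assms(1)] .
  note ct = cartan_string[OF assms(1) Rx_V[OF assms(2)] p]
  have bound: "\<bar>p + 2 * n\<bar> \<le> 3" if "n \<in> S" for n
  proof -
    have n: "\<beta> + zscale n \<alpha> \<in> Rx" "\<not> parallel (\<beta> + zscale n \<alpha>) \<alpha>"
      using string_root[OF assms] that by (auto simp: S_def)
    show ?thesis
      by (rule cartan_pair[OF assms(1) n]) (simp add: ct)
  qed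
  have refl: "- p - n \<in> S" if "n \<in> S" for n
  proof -
    have n: "\<beta> + zscale n \<alpha> \<in> Rx"
      using string_root[OF assms] that by (auto simp: S_def)
    have "reflection \<alpha> (\<beta> + zscale n \<alpha>) = \<beta> + zscale n \<alpha> - rscale (of_int (p + 2 * n)) \<alpha>"
      using reflection_eq[OF Rx_V[OF n] Rx_V[OF assms(1)]] ct[of n] by simp
    also have "\<dots> = \<beta> + zscale (- p - n) \<alpha>"
      by (simp add: rscale_def zscale_def cscale_def fun_eq_iff algebra_simps)
    finally show ?thesis
      using Rx_root[OF reflection_Rx[OF assms(1) n]] by (simp add: S_def)
  qed
  have down: "n - 1 \<in> S" if "n \<in> S" "p + 2 * n > 0" for n
  proof -
    have "\<beta> + zscale n \<alpha> - \<alpha> \<in> roots"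
      using root_string_step_down[of "\<beta> + zscale n \<alpha>" \<alpha>] that assms(1) ct[of n] by (simp add: S_def)
    moreover have e: "\<beta> + zscale (n - 1) \<alpha> = \<beta> + zscale n \<alpha> - \<alpha>"
      by (simp add: zscale_def cscale_def fun_eq_iff algebra_simps)
    ultimately show ?thesis unfolding S_def mem_Collect_eq e by blast
  qed
  have zero: "0 \<in> S"
    using Rx_root[OF assms(2)] by (simp add: S_def)
  have "S \<subseteq> {- 3 - \<bar>p\<bar>..3 + \<bar>p\<bar>}"
    using bound by force
  then have fin: "finite S"
    by (rule finite_subset) simp
  define U where "U = Max S"
  have U: "U \<in> S" "\<And>n. n \<in> S \<Longrightarrow> n \<le> U"
    unfolding U_def using fin zero by (blast intro: Max_in Max_ge)+
  have L: "- p - U \<le> n" if "n \<in> S" for n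
    using U(2)[OF refl[OF that]] by simp
  \<comment> \<open>The descent from the top reaches Cartan number -1, since the last admissible
    step starts at 1.\<close>
  have upper: "U - int k \<in> S" if "p + 2 * (U - int k) \<ge> -1" for k
    using that
  proof (induction k)
    case 0
    then show ?case using U by simp
  next
    case (Suc k)
    have e: "U - int (Suc k) = U - int k - 1" by simp
    have "U - int k \<in> S"
      using Suc by simp
    then show ?case
      unfolding e by (rule down) (use Suc.prems in simp)
  qed
  have mem: "n \<in> S" if n: "- p - U \<le> n" "n \<le> U" for n
  proof (cases "p + 2 * n \<ge> -1")
    case True
    then show ?thesis
      using upper[of "nat (U - n)"] n by simp
  next
    case False
    \<comment> \<open>In the lower half, the mirror image \<open>- p - n\<close> is in the upper
      half already treated.\<close>
    have "U - int (nat (U + p + n)) = - p - n"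
      using n by simp
    with upper[of "nat (U + p + n)"] False have "- p - n \<in> S"
      by simp
    from refl[OF this] show ?thesis by simp
  qed
  have "S = {- p - U..U}"
  proof (rule set_eqI)
    fix n
    show "n \<in> S \<longleftrightarrow> n \<in> {- p - U..U}"
      using mem[of n] U(2)[of n] L[of n] by auto
  qed
  moreover have "0 \<le> U" "- p - U \<le> 0"
    using U(2)[OF zero] L[OF zero] by simp_all
  moreover have "p + 2 * U \<le> 3"
    using bound[OF U(1)] by simp
  ultimately show ?thesis
    using that[of "nat (p + U)" "nat U"] p by (simp add: S_def)
qed

text \<open>The top of the string has weight \<open>d + u\<close>, and \<open>xv \<beta>\<close> is
  a non-zero multiple of the top vector lowered \<open>u\<close> times. The factor in
  \<open>sl2_raise_lower\<close> is therefore \<open>u * (d + u - (u - 1))\<close>.\<close>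

lemma xv_raise_lower:
  assumes "\<alpha> \<in> Rx" "\<beta> \<in> Rx" "\<not> parallel \<beta> \<alpha>"
    and "{n. \<beta> + zscale n \<alpha> \<in> roots} = {- int d..int u}"
    and "cartan \<beta> \<alpha> = of_int (int d - int u)"
  shows "\<^bold>[xv (- \<alpha>), \<^bold>[xv \<alpha>, xv \<beta>\<^bold>]\<^bold>] = of_nat (u * (d + 1)) *s xv \<beta>"
proof -
  let ?top = "\<beta> + zscale (int u) \<alpha>"
  let ?v = "xv ?top" and ?f = "xv (- \<alpha>)" and ?e = "xv \<alpha>"
  have "int u \<in> {n. \<beta> + zscale n \<alpha> \<in> roots}" "int u + 1 \<notin> {n. \<beta> + zscale n \<alpha> \<in> roots}"
    unfolding assms(4) by simp_all
  then have top: "?top \<in> roots" "\<beta> + zscale (int u + 1) \<alpha> \<notin> roots"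
    by simp_all
  note tRx = string_root(1)[OF assms(1-3) top(1)]
  have e1: "\<alpha> + ?top = \<beta> + zscale (int u + 1) \<alpha>"
    by (simp add: zscale_def cscale_def fun_eq_iff algebra_simps)
  have ev: "\<^bold>[?e, ?v\<^bold>] = 0"
    using root_space_bracket[OF xv_root_space xv_root_space, OF assms(1) tRx] top(2)
      nonroot_zero[OF dual_add[OF Rx_dual Rx_dual, OF assms(1) tRx]] unfolding e1 by blast
  have ct: "cartan ?top \<alpha> = of_nat (d + u)"
    using cartan_string[OF assms(1) Rx_V[OF assms(2)] assms(5), of "int u"] by simp
  have w: "\<^bold>[coroot_vec \<alpha>, ?v\<^bold>] = of_nat (d + u) *s ?v"
    using bracket_coroot_vec[OF Rx_V Rx_V xv_root_space, of ?top \<alpha>] tRx assms(1) ct by simp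
  note t = xv_triple[OF assms(1)]
  obtain M where M: "(bracket ?f ^^ M) ?v = 0"
    using xv_ad_nilpotent[OF Rx_uminus[OF assms(1)]] by (auto simp: ad_nilpotent_on_def)
  have nz: "(bracket ?f ^^ u) ?v \<noteq> 0"
  proof -
    from sl2_highest_weight[OF t w ev xv_nonzero[OF tRx] M] obtain m where
      m: "of_nat (d + u) = (of_nat m :: complex)" "\<And>k. k \<le> m \<Longrightarrow> (bracket ?f ^^ k) ?v \<noteq> 0" by blast
    from m(1) have "d + u = m" by (simp only: of_nat_eq_iff)
    with m(2)[of u] show ?thesis by simp
  qed
  have "(bracket ?f ^^ k) ?v \<in> root_space (?top - zscale (int k) \<alpha>)" for k
  proof (induction k)
    case (Suc k)
    have "- \<alpha> + (?top - zscale (int k) \<alpha>) = ?top - zscale (int (Suc k)) \<alpha>"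
      by (simp add: zscale_def cscale_def fun_eq_iff algebra_simps)
    then show ?case
      using root_space_bracket[OF xv_root_space[OF Rx_uminus[OF assms(1)]] Suc]
      unfolding funpow.simps comp_apply by (simp only:)
  qed (simp only: of_nat_0 funZ.scale_zero_left diff_zero funpow.simps id_apply xv_root_space[OF tRx])
  from this[of u] have "(bracket ?f ^^ u) ?v \<in> root_space \<beta>" by simp
  then obtain c where c: "(bracket ?f ^^ u) ?v = c *s xv \<beta>"
    using xv_multiple[OF assms(2)] by blast
  with nz have c0: "c \<noteq> 0" by auto
  have "\<^bold>[?f, \<^bold>[?e, (bracket ?f ^^ u) ?v\<^bold>]\<^bold>] = of_nat (u * (d + 1)) *s (bracket ?f ^^ u) ?v"
  proof (cases u)
    case 0
    then show ?thesis using ev by simp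
  next
    case (Suc k)
    have "of_nat (Suc k) * (of_nat (d + u) - of_nat k) = (of_nat (u * (d + 1)) :: complex)"
      using Suc by (simp add: algebra_simps)
    then show ?thesis
      using sl2_raise_lower[OF t w ev, of k] Suc by (simp add: bracket_scale_right del: of_nat_add of_nat_mult of_nat_Suc)
  qed
  then have "c *s \<^bold>[?f, \<^bold>[?e, xv \<beta>\<^bold>]\<^bold>] = c *s (of_nat (u * (d + 1)) *s xv \<beta>)"
    by (simp only: c bracket_scale_right scale_scale mult.commute)
  with c0 show ?thesis
    by (simp only: scale_cancel_left) simp
qed

section \<open>Structure constants\<close>

definition struct_const :: "'g functional \<Rightarrow> 'g functional \<Rightarrow> complex" where
  "struct_const \<alpha> \<beta> = (THE c. \<^bold>[xv \<alpha>, xv \<beta>\<^bold>] = c *s xv (\<alpha> + \<beta>))"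

lemma xv_bracket:
  assumes "\<alpha> \<in> Rx" "\<beta> \<in> Rx" "\<alpha> + \<beta> \<in> Rx"
  shows "\<^bold>[xv \<alpha>, xv \<beta>\<^bold>] = struct_const \<alpha> \<beta> *s xv (\<alpha> + \<beta>)"
proof -
  obtain c where "\<^bold>[xv \<alpha>, xv \<beta>\<^bold>] = c *s xv (\<alpha> + \<beta>)"
    using xv_multiple[OF assms(3) root_space_bracket[OF xv_root_space xv_root_space]] assms by blast
  then have "\<exists>!c. \<^bold>[xv \<alpha>, xv \<beta>\<^bold>] = c *s xv (\<alpha> + \<beta>)"
    using xv_nonzero[OF assms(3)] by auto
  then show ?thesis
    unfolding struct_const_def by (rule theI')
qed

text \<open>Apply \<open>\<tau>\<close>: the signs of the two factors cancel in the bracket, and the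
  sign of the result remains.\<close>

lemma struct_const_uminus:
  assumes "\<alpha> \<in> Rx" "\<beta> \<in> Rx" "\<alpha> + \<beta> \<in> Rx"
  shows "struct_const \<alpha> \<beta> = - struct_const (- \<alpha>) (- \<beta>)"
proof -
  have m: "- \<alpha> + - \<beta> = - (\<alpha> + \<beta>)" by simp
  have "\<^bold>[xv (- \<alpha>), xv (- \<beta>)\<^bold>] = \<tau> \<^bold>[xv \<alpha>, xv \<beta>\<^bold>]"
    by (simp add: \<tau>_bracket \<tau>_xv assms bracket_minus_left bracket_minus_right)
  also have "\<dots> = (- struct_const \<alpha> \<beta>) *s xv (- (\<alpha> + \<beta>))"
    by (simp only: xv_bracket[OF assms] \<tau>_scale \<tau>_xv[OF assms(3)] scale_minus_left scale_minus_right)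
  finally have "struct_const (- \<alpha>) (- \<beta>) *s xv (- (\<alpha> + \<beta>)) = (- struct_const \<alpha> \<beta>) *s xv (- (\<alpha> + \<beta>))"
    using xv_bracket[OF Rx_uminus Rx_uminus, OF assms(1,2)] Rx_uminus[OF assms(3)] unfolding m by simp
  then show ?thesis
    using xv_nonzero[OF Rx_uminus[OF assms(3)]] by (simp only: scale_cancel_right) simp
qed

text \<open>If \<beta> is \<alpha> modulo \<open>V0\<close>, the sum is 2 \<alpha> modulo
  \<open>V0\<close>, against reducedness; if it is - \<alpha>, the sum is isotropic.\<close>

lemma sum_not_parallel:
  assumes "\<alpha> \<in> Rx" "\<beta> \<in> Rx" "\<alpha> + \<beta> \<in> Rx"
  shows "\<not> parallel \<beta> \<alpha>"
proof
  assume "parallel \<beta> \<alpha>"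
  then consider "\<beta> - \<alpha> \<in> V0" | "\<beta> + \<alpha> \<in> V0"
    unfolding parallel_def by blast
  then show False
  proof cases
    case 1
    have "\<alpha> + \<beta> - rscale 2 \<alpha> = \<beta> - \<alpha>"
      by (simp add: rscale_def cscale_def fun_eq_iff)
    with 1 have "\<alpha> + \<beta> - rscale 2 \<alpha> \<in> V0" by (simp only:)
    from parallel_scale(1)[OF assms(1,3) this] show False by simp
  next
    case 2
    then show False
      using assms(3) by (simp add: Rx_iff add.commute)
  qed
qed

text \<open>Evaluates the form of [x (- \<alpha>), [x \<alpha>, x \<beta>]] with x (- \<beta>) in
  two ways: by \<open>xv_raise_lower\<close>, and by invariance, which brings in the constants of
  both (\<alpha>, \<beta>) and (- \<alpha>, - \<beta>).\<close>

lemma struct_const_square: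
  assumes "\<alpha> \<in> Rx" "\<beta> \<in> Rx" "\<alpha> + \<beta> \<in> Rx"
    and "{n. \<beta> + zscale n \<alpha> \<in> roots} = {- int d..int u}"
    and "cartan \<beta> \<alpha> = of_int (int d - int u)"
  shows "(struct_const \<alpha> \<beta>)\<^sup>2 = of_nat (u * (d + 1)) * dform (\<alpha> + \<beta>) (\<alpha> + \<beta>) / dform \<beta> \<beta>"
proof -
  let ?N = "struct_const \<alpha> \<beta>"
  have nz: "dform \<beta> \<beta> \<noteq> 0" "dform (\<alpha> + \<beta>) (\<alpha> + \<beta>) \<noteq> 0"
    using assms by (simp_all add: dform_re_form Rx_V re_form_neq0)
  have m: "- \<alpha> + - \<beta> = - (\<alpha> + \<beta>)" by simp
  have "of_nat (u * (d + 1)) * (2 / dform \<beta> \<beta>) = form \<^bold>[xv (- \<alpha>), \<^bold>[xv \<alpha>, xv \<beta>\<^bold>]\<^bold>] (xv (- \<beta>))"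
    by (simp only: xv_raise_lower[OF assms(1,2) sum_not_parallel[OF assms(1-3)] assms(4,5)]
        form_scale form_xv[OF assms(2)])
  also have "\<dots> = - form (?N *s xv (\<alpha> + \<beta>)) \<^bold>[xv (- \<alpha>), xv (- \<beta>)\<^bold>]"
    by (simp only: form_skew xv_bracket[OF assms(1-3)])
  also have "\<^bold>[xv (- \<alpha>), xv (- \<beta>)\<^bold>] = (- ?N) *s xv (- (\<alpha> + \<beta>))"
    using xv_bracket[OF Rx_uminus Rx_uminus, OF assms(1,2)] Rx_uminus[OF assms(3)]
      struct_const_uminus[OF assms(1-3)] unfolding m by simp
  also have "- form (?N *s xv (\<alpha> + \<beta>)) ((- ?N) *s xv (- (\<alpha> + \<beta>))) = ?N\<^sup>2 * (2 / dform (\<alpha> + \<beta>) (\<alpha> + \<beta>))"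
    by (simp only: form_scale form_scale_right form_xv[OF assms(3)]) (simp add: power2_eq_square)
  finally have e: "of_nat (u * (d + 1)) * (2 / dform \<beta> \<beta>) = ?N\<^sup>2 * (2 / dform (\<alpha> + \<beta>) (\<alpha> + \<beta>))" .
  have "n = k * c / b" if "k * (2 / b) = n * (2 / c)" "b \<noteq> 0" "c \<noteq> 0" for k n b c :: complex
    using that by (simp add: divide_simps)
  from this[OF e nz] show ?thesis .
qed

text \<open>By \<open>string_length_identity\<close> the ratio of lengths is
  \<open>(d + 1) / u\<close>, so the square of the constant is the square of
  \<open>d + 1\<close>.\<close>

lemma struct_const_Ints:
  assumes "\<alpha> \<in> Rx" "\<beta> \<in> Rx" "\<alpha> + \<beta> \<in> Rx"
    and S: "{n. \<beta> + zscale n \<alpha> \<in> roots} = {- int d..int u}"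
    and c: "cartan \<beta> \<alpha> = of_int (int d - int u)" and "d + u \<le> 3"
  shows "struct_const \<alpha> \<beta> \<in> \<int>"
proof -
  note np = sum_not_parallel[OF assms(1-3)]
  note V = Rx_V[OF assms(1)] Rx_V[OF assms(2)]
  have sum_eq: "\<beta> + zscale 1 \<alpha> = \<alpha> + \<beta>"
    by (simp add: zscale_def cscale_def fun_eq_iff)
  have "1 \<in> {n. \<beta> + zscale n \<alpha> \<in> roots}"
    unfolding mem_Collect_eq sum_eq by (rule Rx_root[OF assms(3)])
  then have u1: "1 \<le> u"
    unfolding S by simp
  let ?a = "re_form \<alpha> \<alpha>" and ?b = "re_form \<beta> \<beta>"
  obtain p q where pq: "cartan \<beta> \<alpha> = of_int p" "p * q < 4" "of_int p * ?a = of_int q * ?b"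
    by (rule cartan_pair[OF assms(1,2) np]) blast
  have p: "p = int d - int u"
    using c pq(1) by linarith
  have ab: "re_form (\<alpha> + \<beta>) (\<alpha> + \<beta>) = ?a + ?b + of_int p * ?a"
    using pq(1) V re_form_neq0[OF assms(1)]
    by (simp add: re_form_linear re_form_sym[of \<alpha> \<beta>] cartan_def field_simps)
  have np2: "\<not> parallel (\<alpha> + \<beta>) \<alpha>"
    using string_root(2)[OF assms(1,2) np, of 1] Rx_root[OF assms(3)] unfolding sum_eq by blast
  obtain p' r where r: "cartan (\<alpha> + \<beta>) \<alpha> = of_int p'" "p' * r < 4"
    "of_int p' * ?a = of_int r * re_form (\<alpha> + \<beta>) (\<alpha> + \<beta>)"
    by (rule cartan_pair[OF assms(1,3) np2]) blast
  have "p' = p + 2"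
    using r(1) pq(1) V by (simp add: cartan_add cartan_self assms)
  with r ab string_length_identity[of ?a ?b p q d u r] pq p u1 assms(6) re_form_pos[OF assms(1)]
    re_form_pos[OF assms(2)]
  have i: "real u * re_form (\<alpha> + \<beta>) (\<alpha> + \<beta>) = real (d + 1) * ?b"
    by simp
  have "of_nat u * dform (\<alpha> + \<beta>) (\<alpha> + \<beta>) = of_nat (d + 1) * dform \<beta> \<beta>"
    using arg_cong[OF i, of complex_of_real] V by (simp add: dform_re_form V_closed)
  then have "(struct_const \<alpha> \<beta>)\<^sup>2 = (of_nat (d + 1))\<^sup>2"
    using struct_const_square[OF assms(1-3) S c] V re_form_neq0[OF assms(2)]
    by (simp only: of_nat_mult mult.commute[of "of_nat u"] mult.assoc) (simp add: dform_re_form power2_eq_square del: of_nat_Suc)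
  then have "struct_const \<alpha> \<beta> = of_nat (d + 1) \<or> struct_const \<alpha> \<beta> = - of_nat (d + 1)"
    by (simp only: power2_eq_iff)
  then show ?thesis by (auto simp del: of_nat_Suc of_nat_add)
qed

lemma xv_bracket_int:
  assumes "\<alpha> \<in> Rx" "\<beta> \<in> Rx" "\<alpha> + \<beta> \<in> Rx"
  obtains k :: int where "\<^bold>[xv \<alpha>, xv \<beta>\<^bold>] = of_int k *s xv (\<alpha> + \<beta>)"
proof -
  have "struct_const \<alpha> \<beta> \<in> \<int>"
    by (rule root_string[OF assms(1,2) sum_not_parallel[OF assms]]) (rule struct_const_Ints[OF assms])
  then show ?thesis
    using that xv_bracket[OF assms] by (metis Ints_cases)
qed

lemma xv_bracket_zero:
  assumes "\<alpha> \<in> Rx" "\<beta> \<in> Rx" "\<alpha> + \<beta> \<notin> roots"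
  shows "\<^bold>[xv \<alpha>, xv \<beta>\<^bold>] = 0"
proof -
  have "\<alpha> + \<beta> \<in> dual"
    by (rule dual_add[OF Rx_dual[OF assms(1)] Rx_dual[OF assms(2)]])
  from nonroot_zero[OF this assms(3), of "\<^bold>[xv \<alpha>, xv \<beta>\<^bold>]"] show ?thesis
    using root_space_bracket[OF xv_root_space[OF assms(1)] xv_root_space[OF assms(2)]] by blast
qed

end

section \<open>Isotropic root spaces\<close>

context chevalley_eala
begin

section \<open>Action on isotropic vectors\<close>

lemma V0_double: "\<alpha> + \<alpha> \<in> V0 \<Longrightarrow> \<alpha> \<in> V0"
proof -
  assume "\<alpha> + \<alpha> \<in> V0"
  then have "rscale (1/2) (\<alpha> + \<alpha>) \<in> V0"
    by (rule V0_closed)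
  also have "rscale (1/2) (\<alpha> + \<alpha>) = \<alpha>"
    by (simp add: rscale_def cscale_def fun_eq_iff)
  finally show ?thesis .
qed

lemma double_not_root:
  assumes "\<alpha> \<in> Rx" "\<delta> \<in> V0"
  shows "\<alpha> + (\<alpha> + \<delta>) \<notin> roots"
proof
  assume r: "\<alpha> + (\<alpha> + \<delta>) \<in> roots"
  have "\<alpha> + (\<alpha> + \<delta>) \<notin> V0"
  proof
    assume "\<alpha> + (\<alpha> + \<delta>) \<in> V0"
    from V0_closed(5)[OF this assms(2)] have "\<alpha> + \<alpha> \<in> V0" by (simp add: algebra_simps)
    with V0_double assms(1) show False by (simp add: Rx_iff)
  qed
  with r have g: "\<alpha> + (\<alpha> + \<delta>) \<in> Rx" by (simp add: Rx_iff)
  have "\<alpha> + (\<alpha> + \<delta>) - rscale 2 \<alpha> = \<delta>"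
    by (simp add: rscale_def cscale_def fun_eq_iff)
  with assms(2) have "\<alpha> + (\<alpha> + \<delta>) - rscale 2 \<alpha> \<in> V0" by (simp only:)
  from parallel_scale(1)[OF assms(1) g this] show False by simp
qed

lemma parallel_trans: "parallel \<alpha> \<beta> \<Longrightarrow> parallel \<beta> \<gamma> \<Longrightarrow> parallel \<alpha> \<gamma>"
proof -
  have 1: "\<alpha> - \<gamma> = (\<alpha> - \<beta>) + (\<beta> - \<gamma>)" "\<alpha> + \<gamma> = (\<alpha> - \<beta>) + (\<beta> + \<gamma>)"
    "\<alpha> + \<gamma> = (\<alpha> + \<beta>) - (\<beta> - \<gamma>)" "\<alpha> - \<gamma> = (\<alpha> + \<beta>) - (\<beta> + \<gamma>)"
    by simp_all
  assume "parallel \<alpha> \<beta>" "parallel \<beta> \<gamma>"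
  then show ?thesis
    unfolding parallel_def using 1 V0_closed(1,5) by metis
qed

text \<open>Packages the conclusion of (vi), with its convention for non-roots, as an additive
  group, so that integrality can be added and bracketed.\<close>

definition int_mult :: "'g functional \<Rightarrow> 'g set" where
  "int_mult \<gamma> = {z. \<exists>k::int. z = of_int k *s (if \<gamma> \<in> roots then xv \<gamma> else 0)}"

lemma int_mult_zero: "0 \<in> int_mult \<gamma>"
  by (auto simp: int_mult_def intro!: exI[of _ 0])

lemma int_mult_scale:
  assumes "z \<in> int_mult \<gamma>"
  shows "of_int k *s z \<in> int_mult \<gamma>"
proof -
  obtain j where j: "z = of_int j *s (if \<gamma> \<in> roots then xv \<gamma> else 0)"
    using assms by (auto simp: int_mult_def)
  show ?thesis
    unfolding int_mult_def mem_Collect_eq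
    by (rule exI[of _ "k * j"]) (simp only: j scale_scale of_int_mult)
qed

lemma int_mult_uminus: "z \<in> int_mult \<gamma> \<Longrightarrow> - z \<in> int_mult \<gamma>"
  using int_mult_scale[of z \<gamma> "-1"] by simp

lemma int_mult_add:
  assumes "z \<in> int_mult \<gamma>" "y \<in> int_mult \<gamma>"
  shows "z + y \<in> int_mult \<gamma>"
proof -
  obtain j k where jk: "z = of_int j *s (if \<gamma> \<in> roots then xv \<gamma> else 0)"
    "y = of_int k *s (if \<gamma> \<in> roots then xv \<gamma> else 0)"
    using assms by (auto simp: int_mult_def)
  show ?thesis
    unfolding int_mult_def mem_Collect_eq
    by (rule exI[of _ "j + k"]) (simp only: jk scale_left_distrib of_int_add)
qed

lemma xv_bracket_int_mult:
  assumes "\<alpha> \<in> Rx" "\<beta> \<in> Rx" "\<alpha> + \<beta> \<notin> V0"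
  shows "\<^bold>[xv \<alpha>, xv \<beta>\<^bold>] \<in> int_mult (\<alpha> + \<beta>)"
proof (cases "\<alpha> + \<beta> \<in> roots")
  case True
  then obtain k :: int where "\<^bold>[xv \<alpha>, xv \<beta>\<^bold>] = of_int k *s xv (\<alpha> + \<beta>)"
    using xv_bracket_int[of \<alpha> \<beta>] assms by (auto simp: Rx_iff)
  with True show ?thesis
    by (auto simp: int_mult_def)
next
  case False
  then show ?thesis
    using xv_bracket_zero assms by (simp add: int_mult_zero)
qed

lemma xv_bracket_int_mult_right:
  assumes "\<alpha> \<in> Rx" "z \<in> int_mult \<gamma>" "\<gamma> \<notin> V0" "\<alpha> + \<gamma> \<notin> V0"
  shows "\<^bold>[xv \<alpha>, z\<^bold>] \<in> int_mult (\<alpha> + \<gamma>)"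
proof (cases "\<gamma> \<in> roots")
  case True
  then obtain k :: int where "z = of_int k *s xv \<gamma>"
    using assms(2) by (auto simp: int_mult_def)
  then show ?thesis
    using xv_bracket_int_mult[of \<alpha> \<gamma>] assms True by (simp add: bracket_scale_right int_mult_scale Rx_iff)
next
  case False
  then have "z = 0"
    using assms(2) by (auto simp: int_mult_def)
  then show ?thesis by (simp add: int_mult_zero)
qed

text \<open>The vector \<open>x_\<delta>^\<beta>\<close> of the theorem, with \<beta> allowed to be
  any non-isotropic root and not only one in \<open>\<Pi>\<close>.\<close>

definition iso_vec :: "'g functional \<Rightarrow> 'g functional \<Rightarrow> 'g" where
  "iso_vec \<delta> \<beta> = \<^bold>[xv (\<beta> + \<delta>), xv (- \<beta>)\<^bold>]"

lemma iso_vec_root_space: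
  assumes "\<beta> \<in> Rx" "\<beta> + \<delta> \<in> Rx"
  shows "iso_vec \<delta> \<beta> \<in> root_space \<delta>"
  using root_space_bracket[OF xv_root_space[OF assms(2)] xv_root_space[OF Rx_uminus[OF assms(1)]]]
  by (simp add: iso_vec_def)

lemma not_V0_add_iff: "\<delta> \<in> V0 \<Longrightarrow> v + \<delta> \<in> V0 \<longleftrightarrow> v \<in> V0"
  using V0_closed(1)[of v \<delta>] V0_closed(5)[of "v + \<delta>" \<delta>] by auto

lemma Rx_iff_root: "\<alpha> \<in> Rx \<Longrightarrow> \<delta> \<in> V0 \<Longrightarrow> \<alpha> + \<delta> \<in> Rx \<longleftrightarrow> \<alpha> + \<delta> \<in> roots"
  by (auto simp: Rx_iff not_V0_add_iff)

text \<open>In the Jacobi expansion the intermediate weights \<alpha> + \<beta> + \<delta> and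
  \<alpha> - \<beta> avoid \<open>V0\<close> because \<alpha> and \<beta> are not parallel, so the
  integral structure constants apply twice.\<close>

lemma xv_iso_vec_nonparallel:
  assumes "\<alpha> \<in> Rx" "\<beta> \<in> Rx" "\<beta> + \<delta> \<in> Rx" "\<delta> \<in> V0" "\<not> parallel \<alpha> \<beta>"
  shows "\<^bold>[xv \<alpha>, iso_vec \<delta> \<beta>\<^bold>] \<in> int_mult (\<alpha> + \<delta>)"
proof -
  have no: "\<alpha> + \<beta> \<notin> V0" "\<alpha> - \<beta> \<notin> V0"
    using assms(5) by (simp_all add: parallel_def)
  have a: "\<alpha> \<notin> V0"
    using assms(1) by (simp add: Rx_iff)
  have e: "\<alpha> + (\<beta> + \<delta>) = (\<alpha> + \<beta>) + \<delta>" "\<alpha> + - \<beta> = \<alpha> - \<beta>" "- \<beta> + (\<alpha> + (\<beta> + \<delta>)) = \<alpha> + \<delta>"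
    "(\<beta> + \<delta>) + (\<alpha> + - \<beta>) = \<alpha> + \<delta>"
    by simp_all
  have 1: "\<alpha> + (\<beta> + \<delta>) \<notin> V0" "\<alpha> + - \<beta> \<notin> V0" "- \<beta> + (\<alpha> + (\<beta> + \<delta>)) \<notin> V0"
    "(\<beta> + \<delta>) + (\<alpha> + - \<beta>) \<notin> V0"
    unfolding e(3,4) unfolding e(1,2) not_V0_add_iff[OF assms(4)] by (rule no a)+
  have "\<^bold>[xv (- \<beta>), \<^bold>[xv \<alpha>, xv (\<beta> + \<delta>)\<^bold>]\<^bold>] \<in> int_mult (\<alpha> + \<delta>)"
    using xv_bracket_int_mult_right[OF Rx_uminus[OF assms(2)] xv_bracket_int_mult[OF assms(1,3) 1(1)] 1(1,3)]
    unfolding e(3) .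
  then have "\<^bold>[\<^bold>[xv \<alpha>, xv (\<beta> + \<delta>)\<^bold>], xv (- \<beta>)\<^bold>] \<in> int_mult (\<alpha> + \<delta>)"
    using int_mult_uminus bracket_antisym by metis
  moreover have "\<^bold>[xv (\<beta> + \<delta>), \<^bold>[xv \<alpha>, xv (- \<beta>)\<^bold>]\<^bold>] \<in> int_mult (\<alpha> + \<delta>)"
    using xv_bracket_int_mult_right[OF assms(3)
        xv_bracket_int_mult[OF assms(1) Rx_uminus[OF assms(2)] 1(2)] 1(2,4)]
    unfolding e(4) .
  ultimately show ?thesis
    unfolding iso_vec_def bracket_derivation[of "xv \<alpha>"] by (rule int_mult_add)
qed

text \<open>A vector of weight 0 killed by \<open>xv \<gamma>\<close> is also killed by
  \<open>xv (- \<gamma>)\<close>: its image would be a highest weight vector of weight -2. So the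
  whole triple acts trivially on it.\<close>

lemma refl_aut_fixed:
  assumes "\<gamma> \<in> Rx" "\<delta> \<in> V0" "y \<in> root_space \<delta>" "\<^bold>[xv \<gamma>, y\<^bold>] = 0"
  shows "refl_aut \<gamma> y = y"
proof -
  note t = xv_triple[OF assms(1)]
  let ?v = "\<^bold>[xv (- \<gamma>), y\<^bold>]"
  have hy: "\<^bold>[coroot_vec \<gamma>, y\<^bold>] = 0"
    using bracket_coroot_vec[OF V0_V[OF assms(2)] Rx_V[OF assms(1)] assms(3)]
    by (simp add: cartan_V0 assms Rx_V)
  have "\<^bold>[xv \<gamma>, ?v\<^bold>] = 0"
    using assms(4) hy sl2_bracket_simps(1)[OF t] by (simp add: bracket_derivation[of "xv \<gamma>"])
  moreover have "\<^bold>[coroot_vec \<gamma>, ?v\<^bold>] = (-2) *s ?v"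
    using hy sl2_bracket_simps(5)[OF t]
    by (simp add: bracket_derivation[of "coroot_vec \<gamma>"] bracket_scale_left bracket_minus_left)
  moreover obtain N where "(bracket (xv (- \<gamma>)) ^^ N) ?v = 0"
    using xv_ad_nilpotent[OF Rx_uminus[OF assms(1)]] by (auto simp: ad_nilpotent_on_def)
  ultimately have "?v = 0"
    using sl2_injective_negative[OF t, of ?v "-2"] by simp
  then show ?thesis
    using assms(4) by (simp add: refl_aut_def sl2_reflection_def expad_1 bracket_minus_left)
qed

text \<open>\<open>A\<close>, \<open>B\<close>, \<open>C\<close> have weights 2, 0, -2 and behave
  like the adjoint module of the triple, as neither 2 \<gamma> + \<delta> nor - 2 \<gamma> +
  \<delta> is a root. The reflection is -1 on the zero weight of the adjoint module.\<close>

lemma refl_aut_iso_vec_self: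
  assumes "\<gamma> \<in> Rx" "\<delta> \<in> V0" "\<gamma> + \<delta> \<in> Rx"
  shows "\<^bold>[xv \<gamma>, iso_vec \<delta> \<gamma>\<^bold>] = (-2) *s xv (\<gamma> + \<delta>)" "refl_aut \<gamma> (iso_vec \<delta> \<gamma>) = - iso_vec \<delta> \<gamma>"
proof -
  define e f A B C where "e = xv \<gamma>" and "f = xv (- \<gamma>)" and "A = xv (\<gamma> + \<delta>)"
    and "B = iso_vec \<delta> \<gamma>" and "C = \<^bold>[f, B\<^bold>]"
  note t = sl2_bracket_simps[OF xv_triple[OF assms(1)], folded e_def f_def]
  note n = xv_ad_nilpotent[OF assms(1), folded e_def]
    ad_nilpotent_on_minus[OF xv_ad_nilpotent[OF Rx_uminus[OF assms(1)]], folded f_def]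
  have V: "\<gamma> \<in> V" "\<delta> \<in> V"
    using assms Rx_V V0_V by auto
  have Br: "B \<in> root_space \<delta>"
    unfolding B_def by (rule iso_vec_root_space[OF assms(1,3)])
  have "\<gamma> + (\<gamma> + \<delta>) \<in> dual" "- \<gamma> + (- \<gamma> + \<delta>) \<in> dual"
    using V by (simp_all only: V_dual V_closed)
  note nz = nonroot_zero[OF this(1) double_not_root[OF assms(1,2)]]
    nonroot_zero[OF this(2) double_not_root[OF Rx_uminus[OF assms(1)] assms(2)]]
  have eA: "\<^bold>[e, A\<^bold>] = 0"
    unfolding e_def A_def by (rule nz(1)[OF root_space_bracket[OF xv_root_space[OF assms(1)] xv_root_space[OF assms(3)]]])
  have fC: "\<^bold>[f, C\<^bold>] = 0"
    unfolding f_def C_def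
    by (rule nz(2)[OF root_space_bracket[OF xv_root_space[OF Rx_uminus[OF assms(1)]]
            root_space_bracket[OF xv_root_space[OF Rx_uminus[OF assms(1)]] Br]]])
  have AB: "\<^bold>[A, f\<^bold>] = B"
    by (simp add: A_def f_def B_def iso_vec_def)
  then have fA: "\<^bold>[f, A\<^bold>] = - B"
    using bracket_antisym[of f A] by simp
  have "\<^bold>[coroot_vec \<gamma>, A\<^bold>] = 2 *s A"
    using bracket_coroot_vec[OF Rx_V[OF assms(3)] V(1) xv_root_space[OF assms(3)]] assms V
    by (simp add: A_def cartan_add cartan_self cartan_V0)
  then have hA: "\<^bold>[A, coroot_vec \<gamma>\<^bold>] = (-2) *s A"
    using bracket_antisym[of A "coroot_vec \<gamma>"] by simp
  have eB: "\<^bold>[e, B\<^bold>] = (-2) *s A"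
    unfolding AB[symmetric] bracket_derivation[of e] by (simp add: eA t hA)
  then show "\<^bold>[xv \<gamma>, iso_vec \<delta> \<gamma>\<^bold>] = (-2) *s xv (\<gamma> + \<delta>)"
    by (simp add: e_def A_def B_def)
  have 1: "expad e B = B + (-2) *s A"
    by (subst expad_2; simp add: eB eA bracket_scale_right bracket_minus_right)
  have 2: "expad (- f) B = B + (-1) *s C"
    by (subst expad_2; simp add: fC bracket_minus_left bracket_minus_right flip: C_def)
  have 3: "expad (- f) A = A + B + (- 1 / 2) *s C"
    by (subst expad_3; simp add: fA fC bracket_minus_left bracket_minus_right flip: C_def)
  have 4: "expad e A = A"
    using eA by (rule expad_1)
  have "expad (- f) (expad e B) = (B + (-1) *s C) + (-2) *s (A + B + (- 1 / 2) *s C)"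
    by (simp only: 1 expad_add[OF n(2)] expad_scale[OF n(2)] 2 3)
  also have "\<dots> = (-1) *s B + (-2) *s A"
    by (simp add: scale_right_distrib scale_right_diff_distrib scale_double)
  finally have "refl_aut \<gamma> B = (-1) *s (B + (-2) *s A) + (-2) *s A"
    by (simp only: refl_aut_def sl2_reflection_def e_def[symmetric] f_def[symmetric]
        expad_add[OF n(1)] expad_scale[OF n(1)] 1 4)
  also have "\<dots> = - B"
    by (simp add: scale_right_distrib)
  finally show "refl_aut \<gamma> (iso_vec \<delta> \<gamma>) = - iso_vec \<delta> \<gamma>"
    by (simp add: B_def)
qed

text \<open>Splits \<open>y\<close> into an invariant part and a part on which the reflection is -1:
  adding \<open>k / 2\<close> times \<open>iso_vec \<delta> \<gamma>\<close> makes
  \<open>xv \<gamma>\<close> kill the sum.\<close>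

lemma refl_aut_isotropic:
  assumes "\<gamma> \<in> Rx" "\<delta> \<in> V0" "\<gamma> + \<delta> \<in> Rx" "y \<in> root_space \<delta>" "\<^bold>[xv \<gamma>, y\<^bold>] = k *s xv (\<gamma> + \<delta>)"
  shows "refl_aut \<gamma> y = y + k *s iso_vec \<delta> \<gamma>"
proof -
  let ?B = "iso_vec \<delta> \<gamma>"
  note h = refl_aut_hom[OF assms(1)]
  have Br: "?B \<in> root_space \<delta>"
    by (rule iso_vec_root_space[OF assms(1,3)])
  have "\<^bold>[xv \<gamma>, y + (k / 2) *s ?B\<^bold>] = 0"
    using assms(5) refl_aut_iso_vec_self(1)[OF assms(1-3)] by (simp add: bracket_add_right bracket_scale_right)
  then have "refl_aut \<gamma> (y + (k / 2) *s ?B) = y + (k / 2) *s ?B"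
    using refl_aut_fixed[OF assms(1,2)] assms(4) Br by (simp add: root_space_closed)
  then have "refl_aut \<gamma> y + (k / 2) *s (- ?B) = y + (k / 2) *s ?B"
    by (simp only: h refl_aut_iso_vec_self(2)[OF assms(1-3)])
  then have "refl_aut \<gamma> y = y + (k / 2) *s ?B + (k / 2) *s ?B"
    by (simp add: algebra_simps)
  also have "\<dots> = y + k *s ?B"
    by (simp add: add.assoc flip: scale_left_distrib)
  finally show ?thesis .
qed

lemma refl_aut_isotropic_nonroot:
  assumes "\<gamma> \<in> Rx" "\<delta> \<in> V0" "\<gamma> + \<delta> \<notin> roots" "y \<in> root_space \<delta>"
  shows "refl_aut \<gamma> y = y"
proof -
  have "\<gamma> + \<delta> \<in> dual"
    using assms V0_V Rx_V by (intro V_dual V_closed)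
  from nonroot_zero[OF this assms(3) root_space_bracket[OF xv_root_space[OF assms(1)] assms(4)]]
  show ?thesis by (rule refl_aut_fixed[OF assms(1,2,4)])
qed

lemma reflection_add_root:
  assumes "\<gamma> \<in> Rx" "\<beta> \<in> Rx" "\<delta> \<in> V0"
  shows "reflection \<gamma> \<beta> + \<delta> \<in> Rx \<longleftrightarrow> \<beta> + \<delta> \<in> Rx"
proof -
  have *: "reflection \<gamma> \<beta> + \<delta> \<in> Rx" if "\<beta> + \<delta> \<in> Rx" "\<beta> \<in> Rx" for \<beta>
    using reflection_Rx[OF assms(1) that(1)] reflection_add_V0[OF Rx_V[OF that(2)] Rx_V[OF assms(1)] assms(3)]
    by simp
  show ?thesis
    using *[of \<beta>] *[of "reflection \<gamma> \<beta>"] assms reflection_Rx[OF assms(1,2)]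
      reflection_involution[OF Rx_V[OF assms(2)] assms(1)] by auto
qed

lemma refl_aut_iso_vec:
  assumes "\<gamma> \<in> Rx" "\<beta> \<in> Rx" "\<beta> + \<delta> \<in> Rx" "\<delta> \<in> V0"
  obtains s :: int where "s = 1 \<or> s = -1"
    "refl_aut \<gamma> (iso_vec \<delta> \<beta>) = of_int s *s iso_vec \<delta> (reflection \<gamma> \<beta>)"
proof -
  obtain s1 :: int where s1: "s1 = 1 \<or> s1 = -1"
    "refl_aut \<gamma> (xv (\<beta> + \<delta>)) = of_int s1 *s xv (reflection \<gamma> (\<beta> + \<delta>))"
    using refl_aut_xv[OF assms(1,3)] .
  obtain s2 :: int where s2: "s2 = 1 \<or> s2 = -1"
    "refl_aut \<gamma> (xv (- \<beta>)) = of_int s2 *s xv (reflection \<gamma> (- \<beta>))"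
    using refl_aut_xv[OF assms(1) Rx_uminus[OF assms(2)]] .
  have e: "reflection \<gamma> (\<beta> + \<delta>) = reflection \<gamma> \<beta> + \<delta>" "reflection \<gamma> (- \<beta>) = - reflection \<gamma> \<beta>"
    using assms by (simp_all add: reflection_add_V0 reflection_uminus Rx_V)
  have "refl_aut \<gamma> (iso_vec \<delta> \<beta>) = of_int (s1 * s2) *s iso_vec \<delta> (reflection \<gamma> \<beta>)"
    unfolding iso_vec_def refl_aut_hom(3)[OF assms(1)] s1(2) s2(2) e
    by (simp only: bracket_scale_left bracket_scale_right scale_scale of_int_mult mult.commute)
  with s1(1) s2(1) that[of "s1 * s2"] show ?thesis by auto
qed

text \<open>The lift maps \<open>xv \<alpha>\<close> to the chosen vector of the reflected root up
  to a sign, so integrality can be checked after reflecting.\<close>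

lemma int_mult_refl_aut:
  assumes "\<gamma> \<in> Rx" "\<alpha> \<in> Rx" "z \<in> root_space \<alpha>" "refl_aut \<gamma> z \<in> int_mult (reflection \<gamma> \<alpha>)"
  shows "z \<in> int_mult \<alpha>"
proof -
  obtain k where k: "z = k *s xv \<alpha>"
    using xv_multiple[OF assms(2,3)] .
  obtain s :: int where s: "s = 1 \<or> s = -1" "refl_aut \<gamma> (xv \<alpha>) = of_int s *s xv (reflection \<gamma> \<alpha>)"
    using refl_aut_xv[OF assms(1,2)] .
  note wRx = reflection_Rx[OF assms(1,2)]
  obtain j :: int where "refl_aut \<gamma> z = of_int j *s xv (reflection \<gamma> \<alpha>)"
    using assms(4) Rx_root[OF wRx] by (auto simp: int_mult_def)
  then have "(k * of_int s) *s xv (reflection \<gamma> \<alpha>) = of_int j *s xv (reflection \<gamma> \<alpha>)"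
    by (simp add: k refl_aut_hom(2)[OF assms(1)] s(2))
  then have "k * of_int s = of_int j"
    using xv_nonzero[OF wRx] by (simp only: scale_cancel_right) simp
  then have "k = of_int (s * j)"
    using s(1) by (auto simp: minus_equation_iff[of k])
  then show ?thesis
    using k Rx_root[OF assms(2)] unfolding int_mult_def by (auto intro!: exI[of _ "s * j"])
qed

end

text \<open>Rank greater than one enters through the existence of two non-parallel roots.\<close>

locale chevalley_eala_rank_ge_2 = chevalley_eala scale bracket form h \<tau>
  for scale :: "complex \<Rightarrow> 'g::ab_group_add \<Rightarrow> 'g" (infixr \<open>*s\<close> 75)
    and bracket :: "'g \<Rightarrow> 'g \<Rightarrow> 'g" (\<open>\<^bold>[_, _\<^bold>]\<close>)
    and form :: "'g \<Rightarrow> 'g \<Rightarrow> complex"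
    and h :: "'g set"
    and \<tau> :: "'g \<Rightarrow> 'g" +
  assumes nonparallel_roots: "\<exists>\<alpha>\<in>nonisotropic_roots. \<exists>\<beta>\<in>nonisotropic_roots. \<not> parallel \<alpha> \<beta>"
begin

text \<open>Otherwise the roots parallel to \<alpha> and the remaining ones would be two non-empty,
  mutually orthogonal classes.\<close>

lemma nonparallel_nonorthogonal_root:
  assumes "\<alpha> \<in> Rx"
  obtains \<gamma> where "\<gamma> \<in> Rx" "\<not> parallel \<gamma> \<alpha>" "re_form \<gamma> \<alpha> \<noteq> 0"
proof -
  have "\<exists>\<gamma>\<in>Rx. \<not> parallel \<gamma> \<alpha> \<and> re_form \<gamma> \<alpha> \<noteq> 0"
  proof (rule ccontr)
    assume c: "\<not> ?thesis"
    define R1 R2 where "R1 = {\<gamma> \<in> Rx. parallel \<gamma> \<alpha>}" and "R2 = {\<gamma> \<in> Rx. \<not> parallel \<gamma> \<alpha>}"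
    have "\<alpha> \<in> R1"
      using assms V0_closed(3) by (simp add: R1_def parallel_def)
    moreover have "R2 \<noteq> {}"
    proof
      assume "R2 = {}"
      then have "parallel \<gamma> \<alpha>" if "\<gamma> \<in> Rx" for \<gamma>
        using that by (auto simp: R2_def)
      then show False
        using nonparallel_roots parallel_trans parallel_sym by metis
    qed
    moreover have "dform \<beta> \<gamma> = 0" if "\<beta> \<in> R1" "\<gamma> \<in> R2" for \<beta> \<gamma>
    proof -
      have bg: "\<beta> \<in> Rx" "parallel \<beta> \<alpha>" "\<gamma> \<in> Rx" "re_form \<gamma> \<alpha> = 0"
        using that c by (auto simp: R1_def R2_def)
      then have V: "\<beta> \<in> V" "\<alpha> \<in> V" "\<gamma> \<in> V"
        using assms Rx_V by auto
      have "re_form (\<beta> - \<alpha>) \<gamma> = re_form \<beta> \<gamma>" "re_form (\<beta> + \<alpha>) \<gamma> = re_form \<beta> \<gamma>"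
        using V bg(4) by (simp_all add: re_form_linear re_form_sym[of \<alpha> \<gamma>])
      then have "re_form \<beta> \<gamma> = 0"
        using bg(2) re_form_V0(1)[OF _ V(3)] unfolding parallel_def by metis
      then show ?thesis using V by (simp add: dform_re_form)
    qed
    moreover have "R1 \<inter> R2 = {}" "R1 \<union> R2 = Rx"
      by (auto simp: R1_def R2_def)
    ultimately show False
      using indecomposable by blast
  qed
  then show ?thesis using that by blast
qed

lemma xv_iso_vec:
  assumes "\<alpha> \<in> Rx" "\<beta> \<in> Rx" "\<beta> + \<delta> \<in> Rx" "\<delta> \<in> V0"
  shows "\<^bold>[xv \<alpha>, iso_vec \<delta> \<beta>\<^bold>] \<in> int_mult (\<alpha> + \<delta>)"
proof (cases "parallel \<alpha> \<beta>")
  case False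
  then show ?thesis using assms by (intro xv_iso_vec_nonparallel)
next
  case par: True
  let ?y = "iso_vec \<delta> \<beta>"
  have yr: "?y \<in> root_space \<delta>"
    by (rule iso_vec_root_space[OF assms(2,3)])
  have br: "\<^bold>[xv \<alpha>, ?y\<^bold>] \<in> root_space (\<alpha> + \<delta>)"
    by (rule root_space_bracket[OF xv_root_space[OF assms(1)] yr])
  show ?thesis
  proof (cases "\<alpha> + \<delta> \<in> roots")
    case False
    have "\<alpha> + \<delta> \<in> dual"
      using assms V0_V Rx_V by (intro V_dual V_closed)
    from nonroot_zero[OF this False br] show ?thesis by (simp add: int_mult_zero)
  next
    case True
    then have ad: "\<alpha> + \<delta> \<in> Rx"
      using Rx_iff_root assms by blast
    obtain \<gamma> where g: "\<gamma> \<in> Rx" "\<not> parallel \<gamma> \<alpha>" "re_form \<gamma> \<alpha> \<noteq> 0"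
      using nonparallel_nonorthogonal_root[OF assms(1)] .
    have gb: "\<not> parallel \<gamma> \<beta>"
      using g(2) par parallel_trans parallel_sym by blast
    let ?a = "reflection \<gamma> \<alpha>" and ?c = "cartan \<alpha> \<gamma>"
    have V: "\<alpha> \<in> V" "\<gamma> \<in> V" using assms(1) g(1) Rx_V by auto
    have aRx: "?a \<in> Rx"
      by (rule reflection_Rx[OF g(1) assms(1)])
    have a: "?a = \<alpha> - rscale ?c \<gamma>"
      by (rule reflection_eq[OF V])
    have c0: "?c \<noteq> 0"
      using g re_form_neq0 by (simp add: cartan_def re_form_sym[of \<alpha> \<gamma>])
    \<comment> \<open>The reflected root differs from \<alpha> by a multiple of \<gamma>; were it
      parallel to \<gamma>, so would \<alpha> be.\<close>
    have a\<gamma>: "\<not> parallel ?a \<gamma>"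
    proof
      assume "parallel ?a \<gamma>"
      moreover have "?a - \<gamma> = \<alpha> - rscale (?c + 1) \<gamma>" "?a + \<gamma> = \<alpha> - rscale (?c - 1) \<gamma>"
        by (simp_all add: a rscale_def cscale_def fun_eq_iff algebra_simps)
      ultimately have "parallel \<alpha> \<gamma>"
        unfolding parallel_def[of ?a] using parallel_scale(2)[OF g(1) assms(1)] by metis
      with g(2) parallel_sym show False by blast
    qed
    \<comment> \<open>Here \<gamma> is not orthogonal to \<alpha>, so \<open>?c\<close> can be
      inverted and \<gamma> would be a multiple of \<alpha> modulo \<open>V0\<close>.\<close>
    have "\<not> parallel ?a \<alpha>"
    proof
      assume "parallel ?a \<alpha>"
      moreover have "\<gamma> - rscale 0 \<alpha> = rscale (- (1 / ?c)) (?a - \<alpha>)"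
        "\<gamma> - rscale (2 / ?c) \<alpha> = rscale (- (1 / ?c)) (?a + \<alpha>)"
        using c0 by (simp_all add: a rscale_def cscale_def fun_eq_iff field_simps)
      ultimately have "\<gamma> - rscale 0 \<alpha> \<in> V0 \<or> \<gamma> - rscale (2 / ?c) \<alpha> \<in> V0"
        unfolding parallel_def[of ?a] using V0_closed(2) by metis
      then have "parallel \<gamma> \<alpha>"
        using parallel_scale(2)[OF assms(1) g(1)] by blast
      with g(2) show False by blast
    qed
    then have a\<beta>: "\<not> parallel ?a \<beta>"
      using par parallel_trans parallel_sym by blast
    have ay: "\<^bold>[xv ?a, ?y\<^bold>] \<in> int_mult (?a + \<delta>)"
      by (rule xv_iso_vec_nonparallel[OF aRx assms(2-4) a\<beta>])
    \<comment> \<open>The lift sends \<open>?y\<close> to itself or to \<open>?y\<close> plus an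
      integral multiple of \<open>iso_vec \<delta> \<gamma>\<close>. As \<open>?a\<close> is
      parallel to neither \<beta> nor \<gamma>, the non-parallel case covers both terms.\<close>
    have ry: "\<^bold>[xv ?a, refl_aut \<gamma> ?y\<^bold>] \<in> int_mult (?a + \<delta>)"
    proof (cases "\<gamma> + \<delta> \<in> roots")
      case True
      then have gd: "\<gamma> + \<delta> \<in> Rx"
        using Rx_iff_root g assms by blast
      obtain k :: int where k: "\<^bold>[xv \<gamma>, ?y\<^bold>] = of_int k *s xv (\<gamma> + \<delta>)"
        using xv_iso_vec_nonparallel[OF g(1) assms(2-4) gb] True by (auto simp: int_mult_def)
      have ag: "\<^bold>[xv ?a, iso_vec \<delta> \<gamma>\<^bold>] \<in> int_mult (?a + \<delta>)"
        by (rule xv_iso_vec_nonparallel[OF aRx g(1) gd assms(4) a\<gamma>])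
      show ?thesis
        unfolding refl_aut_isotropic[OF g(1) assms(4) gd yr k] bracket_add_right bracket_scale_right
        by (rule int_mult_add[OF ay int_mult_scale[OF ag]])
    next
      case False
      show ?thesis
        unfolding refl_aut_isotropic_nonroot[OF g(1) assms(4) False yr] by (rule ay)
    qed
    obtain s :: int where s: "refl_aut \<gamma> (xv \<alpha>) = of_int s *s xv ?a"
      using refl_aut_xv[OF g(1) assms(1)] by blast
    have "refl_aut \<gamma> \<^bold>[xv \<alpha>, ?y\<^bold>] \<in> int_mult (reflection \<gamma> (\<alpha> + \<delta>))"
      unfolding refl_aut_hom(3)[OF g(1)] s bracket_scale_left reflection_add_V0[OF V assms(4)]
      by (rule int_mult_scale[OF ry])
    then show ?thesis
      by (rule int_mult_refl_aut[OF g(1) ad br])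
  qed
qed

section \<open>Integral spans over a reflectable base\<close>

context
  fixes \<Pi> :: "'g functional set"
  assumes reflectable: "reflectable_base \<Pi>"
begin

lemma \<Pi>_Rx: "\<alpha> \<in> \<Pi> \<Longrightarrow> \<alpha> \<in> Rx"
  using reflectable by (auto simp: reflectable_base_def)

lemma x_iso_eq: "\<delta> \<in> V0 \<Longrightarrow> x_iso \<Pi> xv \<delta> = {iso_vec \<delta> \<alpha> |\<alpha>. \<alpha> \<in> \<Pi> \<and> \<alpha> + \<delta> \<in> Rx}"
  unfolding x_iso_def iso_vec_def using \<Pi>_Rx Rx_iff_root by blast

text \<open>The integral multiple is supplied by \<open>xv_iso_vec\<close>, and since the reflecting
  root is in \<open>\<Pi>\<close>, the vector it multiplies is a generator. Thus the lift keeps the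
  current vector inside the integral span.\<close>

lemma iso_vec_int_span:
  assumes "\<beta> \<in> Rx" "\<beta> + \<delta> \<in> Rx" "\<delta> \<in> V0"
  shows "iso_vec \<delta> \<beta> \<in> int_span (x_iso \<Pi> xv \<delta>)"
proof -
  let ?S = "int_span (x_iso \<Pi> xv \<delta>)"
  have orb: "weyl_orbit \<Pi> = Rx"
    using reflectable by (simp add: reflectable_base_def)
  with assms(1) obtain w \<alpha> where w: "w \<in> weyl \<Pi>" "\<alpha> \<in> \<Pi>" "\<beta> = w \<alpha>"
    unfolding weyl_orbit_def by blast
  have base: "iso_vec \<delta> \<gamma> \<in> ?S" if "\<gamma> \<in> \<Pi>" "\<gamma> + \<delta> \<in> Rx" for \<gamma>
    using that by (intro int_span_base) (auto simp: x_iso_eq assms(3))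
  have "w \<alpha> + \<delta> \<in> Rx \<Longrightarrow> iso_vec \<delta> (w \<alpha>) \<in> ?S"
    using w(1)
  proof (induction w rule: weyl.induct)
    case id
    then show ?case using base[OF w(2)] by (simp only: id_apply)
  next
    case (step \<gamma> w)
    let ?b = "w \<alpha>"
    have b: "?b \<in> Rx"
      using step.hyps w(2) orb unfolding weyl_orbit_def by blast
    have g: "\<gamma> \<in> Rx" by (rule \<Pi>_Rx[OF step.hyps(1)])
    \<comment> \<open>Reflections fix \<delta>, so translation by \<delta> stays within the roots at
      every letter of the word.\<close>
    have bd: "?b + \<delta> \<in> Rx"
      using step.prems reflection_add_root[OF g b assms(3)] by (simp only: comp_apply)
    have IH: "iso_vec \<delta> ?b \<in> ?S"
      by (rule step.IH[OF bd])
    have yr: "iso_vec \<delta> ?b \<in> root_space \<delta>"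
      by (rule iso_vec_root_space[OF b bd])
    have "refl_aut \<gamma> (iso_vec \<delta> ?b) \<in> ?S"
    proof (cases "\<gamma> + \<delta> \<in> roots")
      case True
      then have gd: "\<gamma> + \<delta> \<in> Rx"
        using Rx_iff_root g assms by blast
      obtain k :: int where k: "\<^bold>[xv \<gamma>, iso_vec \<delta> ?b\<^bold>] = of_int k *s xv (\<gamma> + \<delta>)"
        using xv_iso_vec[OF g b bd assms(3)] True by (auto simp: int_mult_def)
      show ?thesis
        unfolding refl_aut_isotropic[OF g assms(3) gd yr k]
        by (rule int_span_add[OF IH int_span_scale[OF base[OF step.hyps(1) gd]]])
    next
      case False
      show ?thesis
        unfolding refl_aut_isotropic_nonroot[OF g assms(3) False yr] by (rule IH)
    qed
    moreover obtain s :: int where s: "s = 1 \<or> s = -1"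
      "refl_aut \<gamma> (iso_vec \<delta> ?b) = of_int s *s iso_vec \<delta> (reflection \<gamma> ?b)"
      using refl_aut_iso_vec[OF g b bd assms(3)] .
    ultimately have "of_int s *s iso_vec \<delta> (reflection \<gamma> ?b) \<in> ?S"
      by (simp only:)
    \<comment> \<open>Multiplying by \<open>s\<close> once more removes the sign, as its square is
      1.\<close>
    from int_span_scale[OF this, of s]
    have "of_int s *s (of_int s *s iso_vec \<delta> (reflection \<gamma> ?b)) \<in> ?S" .
    moreover have "of_int s *s (of_int s *s iso_vec \<delta> (reflection \<gamma> ?b)) = iso_vec \<delta> (reflection \<gamma> ?b)"
      using \<open>s = 1 \<or> s = -1\<close> by auto
    ultimately show ?case by (simp only: comp_apply)
  qed
  with w assms show ?thesis by simp
qed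

text \<open>This bracket is \<open>iso_vec \<delta> (\<beta> - \<delta>)\<close>, the case of
  another non-isotropic root.\<close>

lemma opposite_int_span:
  assumes "\<beta> \<in> Rx" "- \<beta> + \<delta> \<in> roots" "\<delta> \<in> V0"
  shows "\<^bold>[xv \<beta>, xv (- \<beta> + \<delta>)\<^bold>] \<in> int_span (x_iso \<Pi> xv \<delta>)"
proof -
  have "- \<beta> + \<delta> \<in> Rx"
    using Rx_iff_root[OF Rx_uminus[OF assms(1)] assms(3)] assms(2) by simp
  from Rx_uminus[OF this] have b: "\<beta> - \<delta> \<in> Rx" by simp
  have "\<^bold>[xv \<beta>, xv (- \<beta> + \<delta>)\<^bold>] = iso_vec \<delta> (\<beta> - \<delta>)"
    by (simp add: iso_vec_def)
  then show ?thesis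
    using iso_vec_int_span[OF b _ assms(3)] assms(1) by simp
qed

text \<open>Bracketing \<open>?z\<close> with each of the two factors of
  \<open>iso_vec \<eta> \<alpha>\<close> gives an integral multiple of a root vector. What remains
  are brackets of total weight \<eta> + \<mu>, covered by \<open>iso_vec_int_span\<close> and
  \<open>opposite_int_span\<close>.\<close>

lemma iso_bracket_int_span:
  assumes "\<alpha> \<in> Rx" "\<alpha> + \<eta> \<in> Rx" "\<eta> \<in> V0" "\<beta> \<in> Rx" "\<beta> + \<mu> \<in> Rx" "\<mu> \<in> V0"
  shows "\<^bold>[iso_vec \<eta> \<alpha>, iso_vec \<mu> \<beta>\<^bold>] \<in> int_span (x_iso \<Pi> xv (\<eta> + \<mu>))"
proof -
  let ?z = "iso_vec \<mu> \<beta>" and ?S = "int_span (x_iso \<Pi> xv (\<eta> + \<mu>))"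
  have d: "\<eta> + \<mu> \<in> V0"
    using assms by (simp add: V0_closed)
  have 1: "\<^bold>[\<^bold>[xv (\<alpha> + \<eta>), ?z\<^bold>], xv (- \<alpha>)\<^bold>] \<in> ?S"
  proof -
    obtain k :: int where k: "\<^bold>[xv (\<alpha> + \<eta>), ?z\<^bold>] = of_int k *s (if \<alpha> + \<eta> + \<mu> \<in> roots then xv (\<alpha> + \<eta> + \<mu>) else 0)"
      using xv_iso_vec[OF assms(2,4-6)] by (auto simp: int_mult_def)
    show ?thesis
    proof (cases "\<alpha> + \<eta> + \<mu> \<in> roots")
      case True
      then have "\<alpha> + (\<eta> + \<mu>) \<in> Rx"
        using Rx_iff_root[OF assms(1) d] by (simp add: add.assoc)
      from int_span_scale[OF iso_vec_int_span[OF assms(1) this d]] show ?thesis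
        unfolding k iso_vec_def[of "\<eta> + \<mu>"] using True by (simp add: bracket_scale_left add.assoc)
    next
      case False
      then show ?thesis unfolding k by (simp add: int_span_zero)
    qed
  qed
  have 2: "\<^bold>[xv (\<alpha> + \<eta>), \<^bold>[xv (- \<alpha>), ?z\<^bold>]\<^bold>] \<in> ?S"
  proof -
    obtain k :: int where k: "\<^bold>[xv (- \<alpha>), ?z\<^bold>] = of_int k *s (if - \<alpha> + \<mu> \<in> roots then xv (- \<alpha> + \<mu>) else 0)"
      using xv_iso_vec[OF Rx_uminus[OF assms(1)] assms(4-6)] unfolding int_mult_def by blast
    have e: "- (\<alpha> + \<eta>) + (\<eta> + \<mu>) = - \<alpha> + \<mu>" by simp
    show ?thesis
    proof (cases "- \<alpha> + \<mu> \<in> roots")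
      case True
      from int_span_scale[OF opposite_int_span[OF assms(2) True[folded e] d], of k] show ?thesis
        unfolding k e using True by (simp add: bracket_scale_right)
    next
      case False
      then show ?thesis by (simp add: k int_span_zero)
    qed
  qed
  show ?thesis
    unfolding iso_vec_def[of \<eta> \<alpha>] bracket_derivation_left[of "xv (\<alpha> + \<eta>)" "xv (- \<alpha>)" ?z]
    by (rule int_span_add[OF 1 2])
qed

end

end

section \<open>Lattices and the core\<close>

text \<open>Used over the reals for the root lattice and over the complex numbers for the basis of
  the null lattice.\<close>

lemma (in vector_space) independent_spanning_card:
  assumes "finite S" "W \<subseteq> span S" "card S = dim W"
  shows "independent S"
proof -
  obtain B where B: "B \<subseteq> S" "independent B" "S \<subseteq> span B"
    using maximal_independent_subset[of S] by blast
  have "W \<subseteq> span B"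
    using assms(2) B(3) span_minimal[OF B(3) subspace_span] by blast
  then have "card S \<le> card B"
    using dim_le_card[of W B] finite_subset[OF B(1) assms(1)] assms(3) by simp
  then have "B = S"
    using card_seteq[OF assms(1) B(1)] by simp
  with B show ?thesis by simp
qed

lemma funZ_span_subset: "funZ.span S \<subseteq> funR.span S"
proof -
  have "funZ.subspace (funR.span S)"
    by (auto simp: funZ.subspace_def zscale_eq_rscale funR.span_zero funR.span_add funR.span_scale)
  then show ?thesis
    by (intro funZ.span_minimal) (auto intro: funR.span_base)
qed

text \<open>A subgroup of a lattice is free. Independence is kept over the reals and not merely over
  the integers, because the basis must later be counted by the dimension of
  \<open>V0\<close>.\<close>

lemma sublattice_basis:
  fixes E :: "'g functional set"
  assumes "finite E" "funR.independent E" "G \<subseteq> funZ.span E" "funZ.subspace G"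
  shows "\<exists>C. finite C \<and> funR.independent C \<and> funZ.span C = G"
  using assms
proof (induction E arbitrary: G rule: finite_induct)
  case empty
  then have "G = {0}"
    using funZ.subspace_0 by auto
  then show ?case
    by (intro exI[of _ "{}"]) (simp add: funR.independent_empty)
next
  case (insert e E)
  have E: "funR.independent E" "e \<notin> funR.span E"
    using insert.prems(1) insert.hyps(2) funR.independent_insert[of e E] by auto
  define G' where "G' = G \<inter> funZ.span E"
  have "funZ.subspace G'"
    unfolding G'_def using insert.prems(3) by (intro funZ.subspace_inter funZ.subspace_span)
  then obtain C' where C': "finite C'" "funR.independent C'" "funZ.span C' = G'"
    using insert.IH[OF E(1), of G'] by (auto simp: G'_def)
  show ?case
  proof (cases "G = G'")
    case True
    with C' show ?thesis by blast
  next
    case False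
    \<comment> \<open>The group of \<open>e\<close>-coordinates of elements of \<open>G\<close>. Its
      least positive member will be the coordinate of the new basis vector \<open>g0\<close>, and
      Euclidean division by it brings any element of \<open>G\<close> into
      \<open>G'\<close>.\<close>
    define I where "I = {n. \<exists>g\<in>G. g - zscale n e \<in> funZ.span E}"
    have coord: "\<exists>n. g - zscale n e \<in> funZ.span E" if "g \<in> G" for g
      using insert.prems(2) that funZ.span_breakdown_eq[of g e E] by blast
    obtain g n where g: "g \<in> G" "g - zscale n e \<in> funZ.span E" "n \<noteq> 0"
    proof -
      obtain g where "g \<in> G" "g \<notin> funZ.span E"
        using False unfolding G'_def by blast
      with coord[of g] that show ?thesis by force
    qed
    have neg: "- n \<in> I" if n: "n \<in> I" for n
    proof -
      obtain g where g: "g \<in> G" "g - zscale n e \<in> funZ.span E"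
        using n by (auto simp: I_def)
      have "- g - zscale (- n) e = - (g - zscale n e)"
        by (simp add: funZ.scale_minus_left)
      then have "- g \<in> G" "- g - zscale (- n) e \<in> funZ.span E"
        using g insert.prems(3) by (simp_all only: funZ.subspace_neg funZ.span_neg)
      then show ?thesis
        unfolding I_def by blast
    qed
    have "\<exists>k. 0 < k \<and> int k \<in> I"
    proof (cases "n > 0")
      case True
      then show ?thesis using g by (intro exI[of _ "nat n"]) (auto simp: I_def)
    next
      case False
      have "n \<in> I" using g by (auto simp: I_def)
      from neg[OF this] show ?thesis using False g(3) by (intro exI[of _ "nat (- n)"]) auto
    qed
    then obtain d where d: "0 < d" "int d \<in> I" "\<And>k. 0 < k \<Longrightarrow> int k \<in> I \<Longrightarrow> d \<le> k"
      using exists_least_iff[of "\<lambda>k. 0 < k \<and> int k \<in> I"] by (metis not_le)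
    obtain g0 where g0: "g0 \<in> G" "g0 - zscale (int d) e \<in> funZ.span E"
      using d(2) by (auto simp: I_def)
    have red: "\<exists>q. x - zscale q g0 \<in> G'" if x: "x \<in> G" for x
    proof -
      obtain m where m: "x - zscale m e \<in> funZ.span E"
        using coord[OF x] by blast
      define q r where "q = m div int d" and "r = m mod int d"
      have xq: "x - zscale q g0 \<in> G"
        using x g0(1) insert.prems(3) by (intro funZ.subspace_diff funZ.subspace_scale)
      have "m = q * int d + r"
        by (simp add: q_def r_def)
      then have "x - zscale q g0 - zscale r e = (x - zscale m e) - zscale q (g0 - zscale (int d) e)"
        by (simp add: zscale_def cscale_def fun_eq_iff algebra_simps)
      then have xr: "x - zscale q g0 - zscale r e \<in> funZ.span E"
        using m g0(2) by (simp only: funZ.span_diff funZ.span_scale)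
      have "r = 0"
      proof (rule ccontr)
        assume "r \<noteq> 0"
        moreover have "0 \<le> r" "r < int d"
          using d(1) by (simp_all add: r_def)
        moreover have "r \<in> I"
          unfolding I_def using xq xr by blast
        ultimately show False
          using d(3)[of "nat r"] by auto
      qed
      with xr xq have "x - zscale q g0 \<in> G'"
        by (simp add: G'_def)
      then show ?thesis ..
    qed
    \<comment> \<open>Otherwise \<open>e\<close>, which is a non-zero multiple of \<open>g0\<close>
      modulo the span of \<open>E\<close>, would be in that span.\<close>
    have "g0 \<notin> funR.span C'"
    proof
      assume "g0 \<in> funR.span C'"
      moreover have "C' \<subseteq> funR.span E"
        using C'(3) funZ.span_superset[of C'] funZ_span_subset[of E] by (auto simp: G'_def)
      ultimately have "g0 \<in> funR.span E"
        using funR.span_minimal[OF _ funR.subspace_span] by blast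
      moreover have "g0 - zscale (int d) e \<in> funR.span E"
        using g0(2) funZ_span_subset by blast
      ultimately have "g0 - (g0 - zscale (int d) e) \<in> funR.span E"
        by (rule funR.span_diff)
      then have "rscale (1 / real d) (zscale (int d) e) \<in> funR.span E"
        by (intro funR.span_scale) simp
      also have "rscale (1 / real d) (zscale (int d) e) = e"
        using d(1) by (simp add: zscale_eq_rscale)
      finally show False using E(2) by simp
    qed
    then have "funR.independent (insert g0 C')"
      using C'(2) funR.independent_insert[of g0 C'] by auto
    moreover have "funZ.span (insert g0 C') = G"
    proof
      have "C' \<subseteq> G"
        using C'(3) funZ.span_superset[of C'] by (auto simp: G'_def)
      then show "funZ.span (insert g0 C') \<subseteq> G"
        using g0(1) insert.prems(3) by (intro funZ.span_minimal) auto
      show "G \<subseteq> funZ.span (insert g0 C')"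
        using red unfolding funZ.span_breakdown_eq[of _ g0 C'] C'(3) subset_iff
        by (auto simp: funZ.span_breakdown_eq C'(3))
    qed
    ultimately show ?thesis
      using C'(1) by (intro exI[of _ "insert g0 C'"]) simp
  qed
qed

lemma common_denominator:
  fixes F :: "real set"
  assumes "finite F" "F \<subseteq> \<rat>"
  shows "\<exists>M::nat. 0 < M \<and> (\<forall>r\<in>F. \<exists>j::int. r = of_int j / of_nat M)"
  using assms
proof (induction F rule: finite_induct)
  case empty
  then show ?case by (intro exI[of _ 1]) simp
next
  case (insert x F)
  then obtain M :: nat where M: "0 < M" "\<forall>r\<in>F. \<exists>j::int. r = of_int j / of_nat M"
    by auto
  obtain a b :: int where ab: "b > 0" "x = of_int a / of_int b"
    using insert.prems by (metis Rats_cases' insert_subset)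
  have "\<exists>j::int. r = of_int j / of_nat (M * nat b)" if "r \<in> insert x F" for r
  proof (cases "r = x")
    case True
    then show ?thesis
      using ab M(1) by (intro exI[of _ "a * int M"]) simp
  next
    case False
    with that M obtain j :: int where "r = of_int j / of_nat M"
      by auto
    then show ?thesis
      using ab by (intro exI[of _ "j * b"]) simp
  qed
  then show ?case
    using M(1) ab(1) by (intro exI[of _ "M * nat b"]) simp
qed

section \<open>A graded spanning set of the core\<close>

context chevalley_eala_rank_ge_2
begin

text \<open>The part of degree \<gamma> of a spanning set of the core. Brackets of at most two root
  vectors suffice, so no iterated brackets need to be tracked.\<close>

definition core_gens :: "'g functional \<Rightarrow> 'g set" where
  "core_gens \<gamma> = {z. z = xv \<gamma> \<and> \<gamma> \<in> Rx} \<union> {coroot_vec \<beta> |\<beta>. \<gamma> = 0 \<and> \<beta> \<in> Rx} \<union>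
     {iso_vec \<gamma> \<beta> |\<beta>. \<gamma> \<in> isotropic_roots - {0} \<and> \<beta> \<in> Rx \<and> \<beta> + \<gamma> \<in> Rx}"

lemma core_gens_root_space: "core_gens \<gamma> \<subseteq> root_space \<gamma>"
  using coroot_vec_h Rx_representable root_space_zero
  by (auto simp: core_gens_def xv_root_space iso_vec_root_space)

lemma core_subalgebra: "subalgebra core"
  unfolding core_def
proof (rule hull_in)
  fix T :: "'g set set"
  assume "\<forall>t\<in>T. subalgebra t"
  then show "subalgebra (\<Inter>T)"
    by (auto simp: subalgebra_def intro!: subspace_Inter)
qed

lemma core_subspace: "subspace core"
  using core_subalgebra by (simp add: subalgebra_def)

lemma core_bracket: "x \<in> core \<Longrightarrow> y \<in> core \<Longrightarrow> \<^bold>[x, y\<^bold>] \<in> core"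
  using core_subalgebra by (simp add: subalgebra_def)

lemma xv_core: "\<alpha> \<in> Rx \<Longrightarrow> xv \<alpha> \<in> core"
  unfolding core_def using xv_root_space by (auto intro: hull_inc)

lemma coroot_vec_core: "\<alpha> \<in> Rx \<Longrightarrow> coroot_vec \<alpha> \<in> core"
  using core_bracket[OF xv_core xv_core, of \<alpha> "- \<alpha>"] by (simp add: xv_opposite Rx_uminus)

lemma iso_vec_core: "\<beta> \<in> Rx \<Longrightarrow> \<beta> + \<delta> \<in> Rx \<Longrightarrow> iso_vec \<delta> \<beta> \<in> core"
  unfolding iso_vec_def by (intro core_bracket xv_core Rx_uminus)

text \<open>Every generator is some \<open>xv \<alpha>\<close> or a bracket of two of them, so
  closure of the span under brackets reduces to stability under each \<open>xv \<alpha>\<close>; on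
  isotropic vectors this is \<open>xv_iso_vec\<close>.\<close>

lemma core_eq: "core = span (\<Union>\<gamma>\<in>dual. core_gens \<gamma>)"
proof
  let ?G = "\<Union>\<gamma>\<in>dual. core_gens \<gamma>"
  let ?S = "span ?G"
  have "?G \<subseteq> core"
    by (auto simp: core_gens_def xv_core coroot_vec_core iso_vec_core)
  then show "?S \<subseteq> core"
    using core_subspace by (rule span_minimal)
  have xS: "xv \<alpha> \<in> ?S" if "\<alpha> \<in> Rx" for \<alpha>
    using that Rx_dual by (intro span_base) (auto simp: core_gens_def)
  have hS: "coroot_vec \<alpha> \<in> ?S" if "\<alpha> \<in> Rx" for \<alpha>
    using that dual_zero by (intro span_base UN_I[of 0]) (auto simp: core_gens_def)
  have iS: "iso_vec \<delta> \<beta> \<in> ?S" if "\<beta> \<in> Rx" "\<beta> + \<delta> \<in> Rx" "\<delta> \<in> isotropic_roots - {0}" for \<beta> \<delta>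
    using that root_dual by (intro span_base UN_I[of \<delta>]) (auto simp: core_gens_def isotropic_iff)
  \<comment> \<open>The elements whose adjoint action preserves the span. They are closed under
    brackets by the Jacobi identity.\<close>
  define Nrm where "Nrm = {a. \<forall>s\<in>?S. \<^bold>[a, s\<^bold>] \<in> ?S}"
  have Nrm: "subspace Nrm"
    unfolding Nrm_def subspace_def
    by (auto simp: bracket_add_left bracket_scale_left intro: span_add span_scale span_zero)
  have Nbr: "\<^bold>[a, b\<^bold>] \<in> Nrm" if "a \<in> Nrm" "b \<in> Nrm" for a b
  proof -
    have "\<^bold>[\<^bold>[a, b\<^bold>], s\<^bold>] \<in> ?S" if s: "s \<in> ?S" for s
    proof -
      have "\<^bold>[\<^bold>[a, b\<^bold>], s\<^bold>] = \<^bold>[a, \<^bold>[b, s\<^bold>]\<^bold>] - \<^bold>[b, \<^bold>[a, s\<^bold>]\<^bold>]"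
        using bracket_derivation[of a b s] by simp
      then show ?thesis
        using \<open>a \<in> Nrm\<close> \<open>b \<in> Nrm\<close> s by (auto simp: Nrm_def intro!: span_diff)
    qed
    then show ?thesis by (simp add: Nrm_def)
  qed
  have gen: "\<^bold>[xv \<alpha>, s\<^bold>] \<in> ?S" if a: "\<alpha> \<in> Rx" and s: "s \<in> ?G" for \<alpha> s
  proof -
    consider \<beta> where "\<beta> \<in> Rx" "s = xv \<beta>" | \<beta> where "\<beta> \<in> Rx" "s = coroot_vec \<beta>"
      | \<beta> \<delta> where "\<delta> \<in> isotropic_roots - {0}" "\<beta> \<in> Rx" "\<beta> + \<delta> \<in> Rx" "s = iso_vec \<delta> \<beta>"
      using s by (auto simp: core_gens_def)
    then show ?thesis
    proof cases
      case 1
      consider "\<alpha> + \<beta> \<in> Rx" | "\<alpha> + \<beta> \<notin> roots" | "\<alpha> + \<beta> = 0" | "\<alpha> + \<beta> \<in> isotropic_roots - {0}"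
        unfolding nonisotropic_roots_def by blast
      then show ?thesis
      proof cases
        case 1
        then show ?thesis
          using xv_bracket[of \<alpha> \<beta>] a \<open>\<beta> \<in> Rx\<close> \<open>s = xv \<beta>\<close> by (auto intro: span_scale xS)
      next
        case 2
        then show ?thesis
          using xv_bracket_zero[of \<alpha> \<beta>] a \<open>\<beta> \<in> Rx\<close> \<open>s = xv \<beta>\<close> by (auto intro: span_zero)
      next
        case 3
        then have "\<beta> = - \<alpha>"
          by (simp add: eq_neg_iff_add_eq_0 add.commute)
        then show ?thesis
          using xv_opposite[OF a] hS[OF a] \<open>s = xv \<beta>\<close> by simp
      next
        case 4
        have "\<^bold>[xv \<alpha>, s\<^bold>] = iso_vec (\<alpha> + \<beta>) (- \<beta>)"
          by (simp add: iso_vec_def \<open>s = xv \<beta>\<close>)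
        then show ?thesis
          using iS[OF Rx_uminus[OF \<open>\<beta> \<in> Rx\<close>] _ 4] a by simp
      qed
    next
      case 2
      then show ?thesis
        using bracket_antisym[of "xv \<alpha>" s] bracket_coroot_vec[OF Rx_V[OF a] Rx_V xv_root_space[OF a], of \<beta>]
        by (auto intro!: span_neg span_scale xS[OF a])
    next
      case 3
      then have d: "\<delta> \<in> V0" by (simp add: isotropic_iff)
      obtain k :: int where k: "\<^bold>[xv \<alpha>, s\<^bold>] = of_int k *s (if \<alpha> + \<delta> \<in> roots then xv (\<alpha> + \<delta>) else 0)"
        using xv_iso_vec[OF a 3(2,3) d] unfolding int_mult_def 3(4) by blast
      have "(if \<alpha> + \<delta> \<in> roots then xv (\<alpha> + \<delta>) else 0) \<in> ?S"
        using xS Rx_iff_root[OF a d] span_zero by auto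
      then show ?thesis
        unfolding k by (rule span_scale)
    qed
  qed
  have xN: "xv \<alpha> \<in> Nrm" if a: "\<alpha> \<in> Rx" for \<alpha>
  proof -
    have "subspace {s. \<^bold>[xv \<alpha>, s\<^bold>] \<in> ?S}"
      by (auto simp: subspace_def bracket_add_right bracket_scale_right intro: span_add span_scale span_zero)
    moreover have "?G \<subseteq> {s. \<^bold>[xv \<alpha>, s\<^bold>] \<in> ?S}"
      using gen[OF a] by blast
    ultimately have "?S \<subseteq> {s. \<^bold>[xv \<alpha>, s\<^bold>] \<in> ?S}"
      by (intro span_minimal)
    then show ?thesis by (auto simp: Nrm_def)
  qed
  have "?G \<subseteq> Nrm"
  proof
    fix s assume s: "s \<in> ?G"
    consider \<beta> where "\<beta> \<in> Rx" "s = xv \<beta>" | \<beta> where "\<beta> \<in> Rx" "s = coroot_vec \<beta>"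
      | \<beta> \<delta> where "\<beta> \<in> Rx" "\<beta> + \<delta> \<in> Rx" "s = iso_vec \<delta> \<beta>"
      using s by (auto simp: core_gens_def)
    then show "s \<in> Nrm"
    proof cases
      case 1
      then show ?thesis using xN by simp
    next
      case 2
      then show ?thesis
        using Nbr[OF xN xN, of \<beta> "- \<beta>"] by (simp add: xv_opposite Rx_uminus)
    next
      case 3
      then show ?thesis
        using Nbr[OF xN xN, of "\<beta> + \<delta>" "- \<beta>"] by (simp add: iso_vec_def Rx_uminus)
    qed
  qed
  then have "?S \<subseteq> Nrm"
    using Nrm by (rule span_minimal)
  then have "subalgebra ?S"
    by (auto simp: subalgebra_def Nrm_def)
  moreover have "(\<Union>\<alpha>\<in>Rx. root_space \<alpha>) \<subseteq> ?S"
  proof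
    fix z assume "z \<in> (\<Union>\<alpha>\<in>Rx. root_space \<alpha>)"
    then obtain \<alpha> where z: "\<alpha> \<in> Rx" "z \<in> root_space \<alpha>" by blast
    obtain c where "z = c *s xv \<alpha>"
      using xv_multiple[OF z] .
    with xS[OF z(1)] show "z \<in> ?S"
      by (simp add: span_scale)
  qed
  ultimately show "core \<subseteq> ?S"
    unfolding core_def by (intro hull_minimal)
qed

lemma root_space_core:
  assumes "\<delta> \<in> dual"
  shows "root_space \<delta> \<inter> core = span (core_gens \<delta>)"
proof
  show "root_space \<delta> \<inter> core \<subseteq> span (core_gens \<delta>)"
    using span_graded[of core_gens _ \<delta>] core_gens_root_space assms unfolding core_eq by blast
  show "span (core_gens \<delta>) \<subseteq> root_space \<delta> \<inter> core"
    using span_minimal[OF core_gens_root_space root_space_subspace]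
      span_mono[of "core_gens \<delta>" "\<Union>\<gamma>\<in>dual. core_gens \<gamma>"] assms unfolding core_eq by blast
qed

end

section \<open>Bases modulo the radical\<close>

context eala
begin

lemma base_not_parallel:
  assumes "root_base_mod V0 roots A" "a \<in> A" "b \<in> A" "a \<noteq> b"
  shows "\<not> parallel a b"
proof -
  have A: "finite A" "\<And>f. (\<Sum>x\<in>A. rscale (f x) x) \<in> V0 \<Longrightarrow> \<forall>x\<in>A. f x = 0"
    using assms(1) unfolding root_base_mod_def by blast+
  have no: "a + rscale s b \<notin> V0" for s
  proof
    define f where "f x = (if x = a then 1 else if x = b then s else 0)" for x
    have "(\<Sum>x\<in>A. rscale (f x) x) = (\<Sum>x\<in>A. (if x = a then x else 0) + (if x = b then rscale s x else 0))"
      using assms(4) by (intro sum.cong) (auto simp: f_def)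
    also have "\<dots> = a + rscale s b"
      using A(1) assms(2,3) by (simp add: sum.distrib)
    finally have e: "(\<Sum>x\<in>A. rscale (f x) x) = a + rscale s b" .
    assume "a + rscale s b \<in> V0"
    with A(2)[of f] assms(2) have "f a = 0" unfolding e by blast
    then show False by (simp add: f_def)
  qed
  show ?thesis
    using no[of 1] no[of "-1"] by (simp add: parallel_def funR.scale_minus_left)
qed

text \<open>The span of \<open>P\<close> meets \<open>V0\<close> only in 0, so relations among
  \<open>A\<close> modulo \<open>V0\<close> are genuine relations. The part of a root in the span of
  \<open>P\<close> is a member of \<open>dot_roots P\<close> and supplies the coordinates.\<close>

lemma root_base_mod_of_dot_roots:
  assumes "preimage_of_base P" "root_base (dot_roots P) A" "A \<subseteq> roots"
  shows "root_base_mod V0 roots A"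
proof -
  have P: "finite P" "P \<subseteq> roots" "\<And>f. (\<Sum>b\<in>P. rscale (f b) b) \<in> V0 \<Longrightarrow> \<forall>b\<in>P. f b = 0"
    "\<And>\<beta>. \<beta> \<in> roots \<Longrightarrow> \<exists>k. \<beta> - (\<Sum>b\<in>P. zscale (k b) b) \<in> V0"
    using assms(1) unfolding preimage_of_base_def root_base_mod_def by blast+
  have A: "finite A" "A \<subseteq> dot_roots P" "\<And>f. (\<Sum>b\<in>A. rscale (f b) b) = 0 \<Longrightarrow> \<forall>b\<in>A. f b = 0"
    "\<And>\<beta>. \<beta> \<in> dot_roots P \<Longrightarrow> \<exists>k. \<beta> - (\<Sum>b\<in>A. zscale (k b) b) = 0 \<and> ((\<forall>b\<in>A. 0 \<le> k b) \<or> (\<forall>b\<in>A. k b \<le> 0))"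
    using assms(2) unfolding root_base_mod_def singleton_iff by blast+
  have span0: "v = 0" if v: "v \<in> funR.span P" "v \<in> V0" for v
  proof -
    obtain f where "v = (\<Sum>b\<in>P. rscale (f b) b)"
      using v(1) unfolding funR.span_finite[OF P(1)] by blast
    with P(3)[of f] v(2) show ?thesis by simp
  qed
  have "(\<Sum>b\<in>A. rscale (f b) b) \<in> funR.span P" for f
    using A(2) by (intro funR.span_sum funR.span_scale) (auto simp: dot_roots_def)
  then have "\<forall>b\<in>A. f b = 0" if "(\<Sum>b\<in>A. rscale (f b) b) \<in> V0" for f
    using A(3) span0 that by blast
  moreover have "\<exists>k. \<beta> - (\<Sum>b\<in>A. zscale (k b) b) \<in> V0 \<and> ((\<forall>b\<in>A. 0 \<le> k b) \<or> (\<forall>b\<in>A. k b \<le> 0))"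
    if b: "\<beta> \<in> roots" for \<beta>
  proof -
    obtain k where k: "\<beta> - (\<Sum>b\<in>P. zscale (k b) b) \<in> V0"
      using P(4)[OF b] by blast
    define b' where "b' = (\<Sum>b\<in>P. zscale (k b) b)"
    have "b' \<in> funR.span P"
      unfolding b'_def zscale_eq_rscale by (intro funR.span_sum funR.span_scale funR.span_base)
    moreover have "b' + (\<beta> - b') \<in> roots"
      using b by simp
    ultimately have "b' \<in> dot_roots P"
      using k unfolding dot_roots_def b'_def by blast
    from A(4)[OF this] obtain k' where k': "b' - (\<Sum>b\<in>A. zscale (k' b) b) = 0"
      "(\<forall>b\<in>A. 0 \<le> k' b) \<or> (\<forall>b\<in>A. k' b \<le> 0)" by blast
    then have "\<beta> - (\<Sum>b\<in>A. zscale (k' b) b) \<in> V0"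
      using k by (simp add: b'_def)
    with k'(2) show ?thesis by blast
  qed
  ultimately show ?thesis
    unfolding root_base_mod_def using A(1) assms(3) by blast
qed

end

section \<open>Coordinates of coroots, and root lengths\<close>

locale based_chevalley_eala = chevalley_eala_rank_ge_2 scale bracket form h \<tau>
  for scale :: "complex \<Rightarrow> 'g::ab_group_add \<Rightarrow> 'g" (infixr \<open>*s\<close> 75)
    and bracket :: "'g \<Rightarrow> 'g \<Rightarrow> 'g" (\<open>\<^bold>[_, _\<^bold>]\<close>)
    and form :: "'g \<Rightarrow> 'g \<Rightarrow> complex"
    and h :: "'g set"
    and \<tau> :: "'g \<Rightarrow> 'g" +
  fixes A :: "'g functional set"
  assumes base: "root_base_mod V0 roots A"
    and A_Rx: "A \<subseteq> nonisotropic_roots"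
begin

definition base_sum :: "('g functional \<Rightarrow> int) \<Rightarrow> 'g functional" where
  "base_sum k = (\<Sum>b\<in>A. zscale (k b) b)"

lemma A_finite: "finite A"
  using base by (simp add: root_base_mod_def)

lemma A_V: "b \<in> A \<Longrightarrow> b \<in> V"
  using A_Rx Rx_V by blast

lemma A_independent: "(\<Sum>b\<in>A. rscale (f b) b) \<in> V0 \<Longrightarrow> b \<in> A \<Longrightarrow> f b = 0"
  using base unfolding root_base_mod_def by blast

lemma base_coords:
  assumes "\<beta> \<in> roots"
  obtains k where "\<beta> - base_sum k \<in> V0" "(\<forall>b\<in>A. 0 \<le> k b) \<or> (\<forall>b\<in>A. k b \<le> 0)"
  using base assms unfolding root_base_mod_def base_sum_def by blast

lemma base_sum_V: "base_sum k \<in> V"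
  unfolding base_sum_def zscale_eq_rscale by (intro V_closed A_V)

lemma base_sum_diff: "base_sum k - base_sum j = base_sum (\<lambda>b. k b - j b)"
  by (simp add: base_sum_def funZ.scale_left_diff_distrib sum_subtractf)

lemma base_coords_unique:
  assumes "\<beta> - base_sum k \<in> V0" "\<beta> - base_sum j \<in> V0" "b \<in> A"
  shows "k b = j b"
proof -
  have "base_sum k - base_sum j = (\<beta> - base_sum j) - (\<beta> - base_sum k)"
    by simp
  also have "\<dots> \<in> V0"
    by (rule V0_closed(5)[OF assms(2,1)])
  finally have "(\<Sum>b\<in>A. rscale (of_int (k b - j b)) b) \<in> V0"
    by (simp only: base_sum_diff) (simp add: base_sum_def zscale_eq_rscale)
  from A_independent[OF this assms(3)] show ?thesis by simp
qed

lemma re_form_base_sum: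
  "v \<in> V \<Longrightarrow> re_form (base_sum k) v = (\<Sum>b\<in>A. of_int (k b) * re_form b v)"
  unfolding base_sum_def zscale_eq_rscale by (simp add: re_form_sum V_closed A_V re_form_rscale)

lemma re_form_mod_V0: "v - w \<in> V0 \<Longrightarrow> v \<in> V \<Longrightarrow> w \<in> V \<Longrightarrow> x \<in> V \<Longrightarrow> re_form v x = re_form w x"
  using re_form_V0(1)[of "v - w" x] by (simp add: re_form_diff)

text \<open>The coroot of \<open>\<beta>\<close> is, modulo \<open>V0\<close>, the combination of the coroots of the base with
  coefficients \<open>k b * (b, b) / (\<beta>, \<beta>)\<close>.\<close>

lemma coroot_coords_integral_pos:
  assumes "\<beta> \<in> Rx" "\<beta> - base_sum k \<in> V0" "\<And>b. b \<in> A \<Longrightarrow> 0 \<le> k b" "b \<in> A"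
  shows "\<exists>m::int. of_int (k b) * re_form b b = of_int m * re_form \<beta> \<beta>"
  using assms
proof (induction "nat (\<Sum>b\<in>A. k b)" arbitrary: \<beta> k b rule: less_induct)
  case less
  note bV = Rx_V[OF less.prems(1)]
  have "0 < re_form \<beta> \<beta>"
    by (rule re_form_pos[OF less.prems(1)])
  also have "re_form \<beta> \<beta> = (\<Sum>b\<in>A. of_int (k b) * re_form b \<beta>)"
    using re_form_mod_V0[OF less.prems(2) bV base_sum_V bV] re_form_base_sum[OF bV] by simp
  \<comment> \<open>The positive square length of \<beta> forces a summand with positive coefficient
    and positive product; reflecting in \<open>a\<close> lowers the height.\<close>
  finally obtain a where a: "a \<in> A" "0 < of_int (k a) * re_form a \<beta>"
    using sum_nonpos[of A "\<lambda>b. of_int (k b) * re_form b \<beta>"] by (metis not_le)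
  have ka: "0 < k a" and ra: "0 < re_form a \<beta>"
    using a(2) less.prems(3)[OF a(1)] by (auto simp: zero_less_mult_iff)
  have aRx: "a \<in> Rx" using a(1) A_Rx by blast
  note aV = Rx_V[OF aRx]
  obtain n where n: "cartan \<beta> a = of_int n"
    using cartan_int[OF Rx_root[OF less.prems(1)] aRx] .
  obtain n' where n': "cartan a \<beta> = of_int n'"
    using cartan_int[OF Rx_root[OF aRx] less.prems(1)] .
  have "0 < cartan \<beta> a"
    using ra re_form_pos[OF aRx] by (simp add: cartan_def re_form_sym[of \<beta> a])
  then have n0: "0 < n" using n by simp
  show ?case
  proof (cases "\<exists>b1\<in>A. b1 \<noteq> a \<and> 0 < k b1")
    case True
    then obtain b1 where b1: "b1 \<in> A" "b1 \<noteq> a" "0 < k b1" by blast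
    define k' where "k' = k(a := k a - n)"
    let ?b = "reflection a \<beta>"
    have rRx: "?b \<in> Rx"
      by (rule reflection_Rx[OF aRx less.prems(1)])
    have "base_sum k' = base_sum k - zscale n a"
    proof -
      have "base_sum k - base_sum k' = base_sum (\<lambda>b. if b = a then n else 0)"
        unfolding base_sum_diff by (rule arg_cong[where f = base_sum]) (auto simp: k'_def)
      also have "\<dots> = (\<Sum>b\<in>A. if b = a then zscale n b else 0)"
        unfolding base_sum_def by (intro sum.cong) auto
      also have "\<dots> = zscale n a"
        using a(1) A_finite by simp
      finally show ?thesis by (simp add: algebra_simps)
    qed
    then have "?b - base_sum k' = \<beta> - base_sum k"
      by (simp add: reflection_eq bV aV n zscale_eq_rscale)
    with less.prems(2) have r: "?b - base_sum k' \<in> V0" by (simp only:)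
    obtain j where j: "?b - base_sum j \<in> V0" "(\<forall>b\<in>A. 0 \<le> j b) \<or> (\<forall>b\<in>A. j b \<le> 0)"
      using base_coords[OF Rx_root[OF rRx]] .
    have jk: "j b = k' b" if "b \<in> A" for b
      by (rule base_coords_unique[OF j(1) r that])
    \<comment> \<open>The reflection changes only the coefficient at \<open>a\<close>. The one at
      \<open>b1\<close> stays positive, and since all have one sign the reflected root is positive
      again.\<close>
    have "j b1 > 0"
      using jk[OF b1(1)] b1 by (simp add: k'_def)
    then have pos: "0 \<le> k' b" if "b \<in> A" for b
      using j(2) b1(1) jk[OF that] that by force
    have "(\<Sum>b\<in>A. k' b) < (\<Sum>b\<in>A. k b)"
      using n0 a(1) A_finite by (intro sum_strict_mono_ex1) (auto simp: k'_def)
    moreover have "0 \<le> (\<Sum>b\<in>A. k' b)"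
      by (intro sum_nonneg pos)
    ultimately have "nat (\<Sum>b\<in>A. k' b) < nat (\<Sum>b\<in>A. k b)"
      by simp
    from less.hyps[OF this rRx r pos less.prems(4)] obtain m :: int where
      m: "of_int (k' b) * re_form b b = of_int m * re_form \<beta> \<beta>"
      by (auto simp: re_form_reflection_self bV aRx)
    show ?thesis
    proof (cases "b = a")
      case True
      \<comment> \<open>Both sides are twice (\<beta>, a), so the loss \<open>n\<close> of the
        coefficient at \<open>a\<close> is again integral after the change of scale.\<close>
      have "of_int n * re_form a a = of_int n' * re_form \<beta> \<beta>"
        using n n' re_form_neq0[OF aRx] re_form_neq0[OF less.prems(1)]
        by (simp add: cartan_def re_form_sym[of \<beta> a] field_simps)
      with m True have "of_int (k b) * re_form b b = of_int (m + n') * re_form \<beta> \<beta>"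
        by (simp add: k'_def algebra_simps)
      then show ?thesis ..
    next
      case False
      with m have "of_int (k b) * re_form b b = of_int m * re_form \<beta> \<beta>"
        by (simp add: k'_def)
      then show ?thesis ..
    qed
  next
    case False
    \<comment> \<open>Now \<beta> is a multiple of \<open>a\<close> modulo \<open>V0\<close>, and
      reducedness makes the multiple 1.\<close>
    then have k0: "k b = 0" if "b \<in> A" "b \<noteq> a" for b
      using less.prems(3) that by force
    have "base_sum k = (\<Sum>b\<in>A. if b = a then zscale (k a) b else 0)"
      unfolding base_sum_def by (intro sum.cong) (auto simp: k0)
    also have "\<dots> = rscale (of_int (k a)) a"
      using a(1) A_finite by (simp add: zscale_eq_rscale)
    finally have s: "\<beta> - rscale (of_int (k a)) a \<in> V0"
      using less.prems(2) by simp
    from parallel_scale(1)[OF aRx less.prems(1) this] have k1: "k a = 1"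
      using ka by auto
    then have "\<beta> - a \<in> V0" using s by simp
    then have "re_form \<beta> \<beta> = re_form a a"
      using re_form_mod_V0[of \<beta> a \<beta>] re_form_mod_V0[of \<beta> a a] bV aV re_form_sym[of a \<beta>] by simp
    then have "of_int (k b) * re_form b b = of_int (if b = a then 1 else 0) * re_form \<beta> \<beta>"
      using k1 k0[OF less.prems(4)] by auto
    then show ?thesis ..
  qed
qed

lemma coroot_coords_integral:
  assumes "\<beta> \<in> Rx" "\<beta> - base_sum k \<in> V0" "b \<in> A"
  shows "\<exists>m::int. of_int (k b) * re_form b b = of_int m * re_form \<beta> \<beta>"
proof -
  obtain j where j: "\<beta> - base_sum j \<in> V0" "(\<forall>b\<in>A. 0 \<le> j b) \<or> (\<forall>b\<in>A. j b \<le> 0)"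
    using base_coords[OF Rx_root[OF assms(1)]] .
  have jk: "j b = k b" if "b \<in> A" for b
    by (rule base_coords_unique[OF j(1) assms(2) that])
  from j(2) show ?thesis
  proof
    assume "\<forall>b\<in>A. 0 \<le> j b"
    then show ?thesis
      using coroot_coords_integral_pos[OF assms(1,2) _ assms(3)] jk by simp
  next
    assume n: "\<forall>b\<in>A. j b \<le> 0"
    have "- \<beta> - base_sum (\<lambda>b. - k b) = - (\<beta> - base_sum k)"
      by (simp add: base_sum_def funZ.scale_minus_left sum_negf)
    then have "- \<beta> - base_sum (\<lambda>b. - k b) \<in> V0"
      using assms(2) V0_uminus_iff by metis
    from coroot_coords_integral_pos[OF Rx_uminus[OF assms(1)] this _ assms(3)]
    obtain m :: int where "of_int (- k b) * re_form b b = of_int m * re_form \<beta> \<beta>"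
      using n jk by (auto simp: re_form_linear Rx_V assms)
    then have "of_int (k b) * re_form b b = of_int (- m) * re_form \<beta> \<beta>"
      by simp
    then show ?thesis ..
  qed
qed

text \<open>The ratio of the two square lengths is the ratio of the two Cartan integers, each
  bounded by 3; parallel roots have equal length.\<close>

lemma nonorthogonal_length_ratio:
  assumes "\<alpha> \<in> Rx" "\<beta> \<in> Rx" "re_form \<beta> \<alpha> \<noteq> 0"
  obtains p q :: int where "re_form \<beta> \<beta> = of_int p / of_int q * re_form \<alpha> \<alpha>" "\<bar>p\<bar> \<le> 3" "\<bar>q\<bar> \<le> 3"
proof (cases "parallel \<beta> \<alpha>")
  case True
  have V: "\<alpha> \<in> V" "\<beta> \<in> V" using assms Rx_V by auto
  have "re_form \<beta> \<beta> = re_form \<alpha> \<alpha>"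
  proof (cases "\<beta> - \<alpha> \<in> V0")
    case True
    then show ?thesis
      using re_form_mod_V0[of \<beta> \<alpha> \<beta>] re_form_mod_V0[of \<beta> \<alpha> \<alpha>] V re_form_sym[of \<alpha> \<beta>] by simp
  next
    case False
    with \<open>parallel \<beta> \<alpha>\<close> have "\<beta> - (- \<alpha>) \<in> V0"
      by (simp add: parallel_def)
    then show ?thesis
      using re_form_mod_V0[of \<beta> "- \<alpha>" \<beta>] re_form_mod_V0[of \<beta> "- \<alpha>" \<alpha>] V re_form_sym[of \<alpha> \<beta>]
      by (simp add: re_form_linear)
  qed
  then show ?thesis using that[of 1 1] by simp
next
  case False
  obtain p q :: int where pq: "cartan \<beta> \<alpha> = of_int p" "cartan \<alpha> \<beta> = of_int q"
    "of_int p * re_form \<alpha> \<alpha> = of_int q * re_form \<beta> \<beta>" "\<bar>p\<bar> \<le> 3"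
    by (rule cartan_pair[OF assms(1,2) False]) blast
  have False': "\<not> parallel \<alpha> \<beta>"
    using False parallel_sym by blast
  obtain q' :: int where q': "cartan \<alpha> \<beta> = of_int q'" "\<bar>q'\<bar> \<le> 3"
    by (rule cartan_pair[OF assms(2,1) False']) blast
  have "q' = q" using q'(1) pq(2) by simp
  moreover have "q \<noteq> 0"
    using pq(2) assms re_form_neq0[OF assms(2)] by (auto simp: cartan_def re_form_sym[of \<alpha> \<beta>])
  ultimately show ?thesis
    using that[of p q] pq q' by (simp add: field_simps)
qed

text \<open>Every root is non-orthogonal to some base element, so its square length is one of
  finitely many rational multiples of the square length of that element.\<close>

lemma finite_lengths: "finite ((\<lambda>\<beta>. re_form \<beta> \<beta>) ` Rx)"
proof (rule finite_subset)
  let ?F = "(\<lambda>(b, p, q). of_int p / of_int q * re_form b b) ` (A \<times> {-3..3::int} \<times> {-3..3::int})"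
  show "finite ?F" using A_finite by simp
  show "(\<lambda>\<beta>. re_form \<beta> \<beta>) ` Rx \<subseteq> ?F"
  proof clarify
    fix \<beta> assume b: "\<beta> \<in> Rx"
    note bV = Rx_V[OF b]
    obtain k where k: "\<beta> - base_sum k \<in> V0"
      using base_coords[OF Rx_root[OF b]] .
    have "re_form \<beta> \<beta> = (\<Sum>b\<in>A. of_int (k b) * re_form b \<beta>)"
      using re_form_mod_V0[OF k bV base_sum_V bV] re_form_base_sum[OF bV] by simp
    then obtain a where a: "a \<in> A" "re_form a \<beta> \<noteq> 0"
      using re_form_neq0[OF b] by (metis (mono_tags, lifting) mult_zero_right sum.neutral)
    have aRx: "a \<in> Rx" using a(1) A_Rx by blast
    obtain p q :: int where pq: "re_form \<beta> \<beta> = of_int p / of_int q * re_form a a" "\<bar>p\<bar> \<le> 3" "\<bar>q\<bar> \<le> 3"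
      by (rule nonorthogonal_length_ratio[OF aRx b]) (use a(2) re_form_sym[of a \<beta>] in auto)
    then show "re_form \<beta> \<beta> \<in> ?F"
      using a(1) by (intro image_eqI[of _ _ "(a, p, q)"]) auto
  qed
qed

text \<open>Finiteness gives a shortest root, whose square length is 2 by normalization. Rationality
  passes between non-orthogonal roots, and indecomposability lets it reach all of them.\<close>

lemma rational_lengths: "\<beta> \<in> Rx \<Longrightarrow> re_form \<beta> \<beta> \<in> \<rat>"
proof -
  obtain \<alpha> where a: "\<alpha> \<in> Rx" using nonparallel_roots by blast
  define L where "L = (\<lambda>\<beta>. re_form \<beta> \<beta>) ` Rx"
  have "Min L \<in> L"
    using finite_lengths a by (intro Min_in) (auto simp: L_def)
  then obtain \<mu> where m: "\<mu> \<in> Rx" "re_form \<mu> \<mu> = Min L"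
    by (auto simp: L_def)
  then have "\<forall>\<beta>\<in>Rx. Re (dform \<mu> \<mu>) \<le> Re (dform \<beta> \<beta>)"
    using finite_lengths by (auto simp: L_def re_form_def)
  then have "dform \<mu> \<mu> = 2"
    using normalized m(1) unfolding normalized_def by blast
  then have m2: "re_form \<mu> \<mu> \<in> \<rat>"
    by (simp add: re_form_def)
  define R1 R2 where "R1 = {\<beta> \<in> Rx. re_form \<beta> \<beta> \<in> \<rat>}" and "R2 = {\<beta> \<in> Rx. re_form \<beta> \<beta> \<notin> \<rat>}"
  have "dform \<beta> \<gamma> = 0" if bg: "\<beta> \<in> R1" "\<gamma> \<in> R2" for \<beta> \<gamma>
  proof (rule ccontr)
    have Rx: "\<beta> \<in> Rx" "\<gamma> \<in> Rx" using bg by (auto simp: R1_def R2_def)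
    assume "dform \<beta> \<gamma> \<noteq> 0"
    then have n: "re_form \<gamma> \<beta> \<noteq> 0"
      using Rx by (auto simp: dform_re_form Rx_V re_form_sym[of \<gamma>])
    obtain p q :: int where "re_form \<gamma> \<gamma> = of_int p / of_int q * re_form \<beta> \<beta>"
      by (rule nonorthogonal_length_ratio[OF Rx n])
    with bg show False
      by (auto simp: R1_def R2_def)
  qed
  moreover have "R1 \<inter> R2 = {}" "R1 \<union> R2 = Rx" "R1 \<noteq> {}"
    using m(1) m2 by (auto simp: R1_def R2_def)
  ultimately have "R2 = {}"
    using indecomposable by blast
  then show "\<beta> \<in> Rx \<Longrightarrow> re_form \<beta> \<beta> \<in> \<rat>"
    by (auto simp: R2_def)
qed

lemma length_denominator:
  obtains M :: nat where "0 < M" "\<And>\<beta>. \<beta> \<in> Rx \<Longrightarrow> \<exists>j::int. 2 / re_form \<beta> \<beta> = of_int j / of_nat M"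
proof -
  let ?F = "(\<lambda>r. 2 / r) ` (\<lambda>\<beta>. re_form \<beta> \<beta>) ` Rx"
  have "finite ?F"
    using finite_lengths by (rule finite_imageI)
  moreover have "?F \<subseteq> \<rat>"
    using rational_lengths by auto
  ultimately obtain M :: nat where "0 < M" "\<forall>r\<in>?F. \<exists>j::int. r = of_int j / of_nat M"
    using common_denominator by blast
  then show ?thesis
    by (intro that) auto
qed

text \<open>The null parts of the coroots: if \<sigma> is the difference between \<beta> and an
  integral combination of the base, the coroot of \<beta> has this multiple of \<sigma> as its
  component in \<open>V0\<close>. The elements \<open>c j\<close> come from the group they
  generate.\<close>

definition null_gens :: "'g functional set" where
  "null_gens = {rscale (2 / re_form \<beta> \<beta>) \<sigma> |\<beta> \<sigma>. \<beta> \<in> Rx \<and> \<sigma> \<in> V0 \<and> (\<exists>k. \<beta> - \<sigma> = base_sum k)}"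

lemma null_gens_V0: "null_gens \<subseteq> V0"
  by (auto simp: null_gens_def V0_closed)

lemma Rx_decomposition:
  assumes "\<beta> \<in> Rx"
  obtains k \<sigma> where "\<sigma> \<in> V0" "\<beta> - \<sigma> = base_sum k" "rscale (2 / re_form \<beta> \<beta>) \<sigma> \<in> null_gens"
proof -
  obtain k where k: "\<beta> - base_sum k \<in> V0"
    using base_coords[OF Rx_root[OF assms]] .
  have e: "\<beta> - (\<beta> - base_sum k) = base_sum k" by simp
  have "rscale (2 / re_form \<beta> \<beta>) (\<beta> - base_sum k) \<in> null_gens"
    unfolding null_gens_def using assms k e by blast
  with k e show ?thesis by (rule that)
qed

text \<open>The coefficient of \<open>coroot_vec b\<close> is the coordinate of \<beta> rescaled by
  the ratio of square lengths; \<open>coroot_coords_integral\<close> makes it an integer.\<close>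

lemma coroot_vec_decomposition:
  assumes "\<beta> \<in> Rx" "\<sigma> \<in> V0" "\<beta> - \<sigma> = base_sum k"
  obtains m :: "'g functional \<Rightarrow> int" where
    "coroot_vec \<beta> = (\<Sum>b\<in>A. of_int (m b) *s coroot_vec b) + dual_vec (rscale (2 / re_form \<beta> \<beta>) \<sigma>)"
proof -
  have bk: "\<beta> - base_sum k = \<sigma>"
    using assms(3) by (simp add: algebra_simps)
  then have "\<forall>b\<in>A. \<exists>m::int. of_int (k b) * re_form b b = of_int m * re_form \<beta> \<beta>"
    using coroot_coords_integral[OF assms(1)] assms(2) by blast
  then obtain m :: "'g functional \<Rightarrow> int"
    where m: "\<And>b. b \<in> A \<Longrightarrow> of_int (k b) * re_form b b = of_int (m b) * re_form \<beta> \<beta>"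
    by metis
  have rep: "\<sigma> \<in> representable" "base_sum k \<in> representable" "\<beta> \<in> representable"
    using assms V0_V base_sum_V V_representable Rx_representable by auto
  have bd: "dform \<beta> \<beta> = of_real (re_form \<beta> \<beta>)"
    using assms(1) by (simp add: dform_re_form Rx_V)
  have "\<beta> = base_sum k + \<sigma>"
    using bk by (simp add: algebra_simps)
  then have "dual_vec \<beta> = dual_vec (base_sum k) + dual_vec \<sigma>"
    using representable_add(2)[OF rep(2,1)] by simp
  also have "dual_vec (base_sum k) = (\<Sum>b\<in>A. of_int (k b) *s dual_vec b)"
    using representable_sum[of A "\<lambda>b. zscale (k b) b"] A_V V_representable
    by (simp add: base_sum_def zscale_def representable_cscale)
  finally have "coroot_vec \<beta> = (\<Sum>b\<in>A. (2 / dform \<beta> \<beta> * of_int (k b)) *s dual_vec b) + (2 / dform \<beta> \<beta>) *s dual_vec \<sigma>"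
    by (simp add: coroot_vec_eq rep scale_right_distrib scale_sum_right)
  also have "(2 / dform \<beta> \<beta>) *s dual_vec \<sigma> = dual_vec (rscale (2 / re_form \<beta> \<beta>) \<sigma>)"
    by (simp add: rscale_def representable_cscale rep bd)
  also have "(\<Sum>b\<in>A. (2 / dform \<beta> \<beta> * of_int (k b)) *s dual_vec b) = (\<Sum>b\<in>A. of_int (m b) *s coroot_vec b)"
  proof (rule sum.cong)
    fix b assume b: "b \<in> A"
    then have bRx: "b \<in> Rx" using A_Rx by blast
    have "complex_of_int (k b) * of_real (re_form b b) = of_int (m b) * of_real (re_form \<beta> \<beta>)"
      using arg_cong[OF m[OF b], of complex_of_real] by simp
    then have "2 / dform \<beta> \<beta> * of_int (k b) = of_int (m b) * (2 / dform b b)"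
      using re_form_neq0[OF bRx] re_form_neq0[OF assms(1)]
      by (simp add: bd dform_re_form A_V[OF b] field_simps)
    then show "(2 / dform \<beta> \<beta> * of_int (k b)) *s dual_vec b = of_int (m b) *s coroot_vec b"
      by (simp only: coroot_vec_eq[OF Rx_representable[OF bRx]] scale_scale)
  qed simp
  finally show ?thesis by (rule that)
qed

text \<open>The sum \<open>Q\<close> of the real spans of \<open>A\<close> and
  \<open>null_gens\<close> contains the non-isotropic roots, hence their differences, hence
  \<open>V\<close>. For an element of \<open>V0\<close> the component in the span of
  \<open>A\<close> vanishes.\<close>

lemma V0_span_null_gens: "V0 \<subseteq> funR.span null_gens"
proof
  define Q where "Q = {v. \<exists>w\<in>funR.span A. v - w \<in> funR.span null_gens}"
  have Qdiff: "v - v' \<in> Q" if vv: "v \<in> Q" "v' \<in> Q" for v v'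
  proof -
    obtain w w' where w: "w \<in> funR.span A" "v - w \<in> funR.span null_gens"
      "w' \<in> funR.span A" "v' - w' \<in> funR.span null_gens"
      using vv by (auto simp: Q_def)
    have "(v - v') - (w - w') = (v - w) - (v' - w')" by simp
    with w have "(v - v') - (w - w') \<in> funR.span null_gens"
      by (simp only: funR.span_diff)
    moreover have "w - w' \<in> funR.span A"
      using w by (intro funR.span_diff)
    ultimately show ?thesis unfolding Q_def by blast
  qed
  have Q0: "0 \<in> Q"
    unfolding Q_def by (auto intro!: bexI[of _ 0] funR.span_zero)
  have Q: "funR.subspace Q"
    unfolding funR.subspace_def
  proof (intro conjI allI ballI)
    show "0 \<in> Q" by (rule Q0)
    fix x assume x: "x \<in> Q"
    show "x + y \<in> Q" if "y \<in> Q" for y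
      using Qdiff[OF x Qdiff[OF Q0 that]] by simp
    show "rscale c x \<in> Q" for c
    proof -
      obtain w where w: "w \<in> funR.span A" "x - w \<in> funR.span null_gens"
        using x by (auto simp: Q_def)
      have "rscale c x - rscale c w = rscale c (x - w)"
        by (simp add: funR.scale_right_diff_distrib)
      with w have "rscale c x - rscale c w \<in> funR.span null_gens"
        by (simp only: funR.span_scale)
      with w(1) show ?thesis
        unfolding Q_def by (auto intro: funR.span_scale)
    qed
  qed
  have RxQ: "\<beta> \<in> Q" if b: "\<beta> \<in> Rx" for \<beta>
  proof -
    obtain k \<sigma> where k: "\<beta> - \<sigma> = base_sum k" "rscale (2 / re_form \<beta> \<beta>) \<sigma> \<in> null_gens"
      using Rx_decomposition[OF b] .
    have "rscale (re_form \<beta> \<beta> / 2) (rscale (2 / re_form \<beta> \<beta>) \<sigma>) \<in> funR.span null_gens"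
      by (intro funR.span_scale funR.span_base k)
    moreover have "\<beta> - base_sum k = rscale (re_form \<beta> \<beta> / 2) (rscale (2 / re_form \<beta> \<beta>) \<sigma>)"
      using k(1) re_form_neq0[OF b] by (simp add: algebra_simps)
    moreover have "base_sum k \<in> funR.span A"
      unfolding base_sum_def zscale_eq_rscale by (intro funR.span_sum funR.span_scale funR.span_base)
    ultimately have "\<beta> - base_sum k \<in> funR.span null_gens" "base_sum k \<in> funR.span A"
      by (simp_all only:)
    then show ?thesis
      unfolding Q_def by blast
  qed
  have "roots \<subseteq> Q"
  proof
    fix \<beta> assume b: "\<beta> \<in> roots"
    show "\<beta> \<in> Q"
    proof (cases "\<beta> \<in> Rx")
      case True
      then show ?thesis by (rule RxQ)
    next
      case False
      with b have "\<beta> \<in> isotropic_roots"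
        by (simp add: nonisotropic_roots_def)
      then obtain \<gamma> \<gamma>' where "\<beta> = \<gamma> - \<gamma>'" "\<gamma> \<in> Rx" "\<gamma>' \<in> Rx"
        using isotropic_eq by blast
      then show ?thesis
        using Qdiff RxQ by blast
    qed
  qed
  then have VQ: "V \<subseteq> Q"
    unfolding V_def using Q by (intro funR.span_minimal)
  fix v assume v: "v \<in> V0"
  then obtain w where w: "w \<in> funR.span A" "v - w \<in> funR.span null_gens"
    using VQ V0_V by (auto simp: Q_def)
  have "funR.span null_gens \<subseteq> V0"
    by (rule funR.span_minimal[OF null_gens_V0 V0_subspace])
  then have "v - (v - w) \<in> V0"
    using v w(2) by (blast intro: V0_closed)
  then have w0: "w \<in> V0" by simp
  obtain f where f: "w = (\<Sum>b\<in>A. rscale (f b) b)"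
    using w(1) unfolding funR.span_finite[OF A_finite] by auto
  have "w = 0"
    unfolding f using A_independent[of f] w0 f by (intro sum.neutral) auto
  with w(2) show "v \<in> funR.span null_gens" by simp
qed

text \<open>The rank condition in the axiom equates the size of an integral basis with the dimension
  of \<open>V\<close>, so that basis is independent over the reals.\<close>

lemma root_lattice_basis:
  obtains B where "finite B" "funR.independent B" "roots \<subseteq> funZ.span B" "funZ.span B = funZ.span roots"
proof -
  obtain B where B: "finite B" "funZ.span B = funZ.span roots" "card B = funR.dim V"
    using root_lattice by blast
  have r: "roots \<subseteq> funZ.span B"
    unfolding B(2) by (rule funZ.span_superset)
  then have "V \<subseteq> funR.span B"
    unfolding V_def using funZ_span_subset by (intro funR.span_minimal) auto
  then have "funR.independent B"
    using funR.independent_spanning_card B by blast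
  with B r that show ?thesis by blast
qed

text \<open>Each \<sigma> in \<open>null_gens\<close> is a difference of elements of the root
  lattice, and the factors \<open>2 / re_form \<beta> \<beta>\<close> have a common denominator
  \<open>M\<close>. Hence the lattice scaled by \<open>1 / M\<close> contains all the
  generators.\<close>

lemma null_gens_lattice:
  obtains E where "finite E" "funR.independent E" "null_gens \<subseteq> funZ.span E"
proof -
  obtain B where B: "finite B" "funR.independent B" "roots \<subseteq> funZ.span B"
    using root_lattice_basis by metis
  obtain M :: nat where M: "0 < M" "\<And>\<beta>. \<beta> \<in> Rx \<Longrightarrow> \<exists>j::int. 2 / re_form \<beta> \<beta> = of_int j / of_nat M"
    using length_denominator by blast
  define s where "s = (1 / real M)"
  have s0: "s \<noteq> 0" using M(1) by (simp add: s_def)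
  let ?E = "rscale s ` B"
  have inj: "inj_on (rscale s) UNIV"
    using s0 by (auto simp: inj_on_def)
  have "funR.independent ?E"
  proof (rule funR.independent_if_scalars_zero)
    show "finite ?E" using B(1) by simp
    fix f x assume f: "(\<Sum>x\<in>?E. rscale (f x) x) = 0" and x: "x \<in> ?E"
    have "(\<Sum>b\<in>B. rscale (f (rscale s b) * s) b) = 0"
      using f by (simp add: sum.reindex[OF inj_on_subset[OF inj subset_UNIV]])
    then have "f (rscale s b) * s = 0" if "b \<in> B" for b
      using funR.independentD[OF B(2,1) subset_refl, of "\<lambda>b. f (rscale s b) * s"] that by blast
    with x s0 show "f x = 0" by auto
  qed
  moreover have "null_gens \<subseteq> funZ.span ?E"
  proof
    fix d assume "d \<in> null_gens"
    then obtain \<beta> \<sigma> k where d: "d = rscale (2 / re_form \<beta> \<beta>) \<sigma>" "\<beta> \<in> Rx" "\<beta> - \<sigma> = base_sum k"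
      unfolding null_gens_def by blast
    obtain j :: int where "2 / re_form \<beta> \<beta> = of_int j / of_nat M"
      using M(2)[OF d(2)] by blast
    then have dj: "d = zscale j (rscale s \<sigma>)"
      by (simp add: d(1) s_def zscale_eq_rscale)
    have "base_sum k \<in> funZ.span B"
      unfolding base_sum_def using A_Rx Rx_root B(3) by (intro funZ.span_sum funZ.span_scale) blast
    then have "\<beta> - base_sum k \<in> funZ.span B"
      using B(3) Rx_root[OF d(2)] by (blast intro: funZ.span_diff)
    also have "\<beta> - base_sum k = \<sigma>"
      using d(3) by (simp add: algebra_simps)
    finally have \<sigma>: "\<sigma> \<in> funZ.span B" .
    have "funZ.subspace {v. rscale s v \<in> funZ.span ?E}"
    proof -
      have comm: "rscale s (zscale c x) = zscale c (rscale s x)" for c x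
        by (simp add: zscale_eq_rscale mult.commute)
      show ?thesis
        by (auto simp: funZ.subspace_def funR.scale_right_distrib comm
            intro: funZ.span_zero funZ.span_add funZ.span_scale)
    qed
    then have "funZ.span B \<subseteq> {v. rscale s v \<in> funZ.span ?E}"
      by (intro funZ.span_minimal) (auto intro: funZ.span_base)
    with \<sigma> show "d \<in> funZ.span ?E"
      unfolding dj by (blast intro: funZ.span_scale)
  qed
  ultimately show ?thesis
    using that[of ?E] B(1) by simp
qed

text \<open>\<open>C\<close> is a real basis of \<open>V0\<close>, which fixes its size. It spans
  \<open>V0\<close> over the complex numbers as well, and non-degeneracy says that the complex
  dimension is the same number.\<close>

lemma null_lattice_basis:
  obtains C where "finite C" "C \<subseteq> V0" "funZ.span C = funZ.span null_gens" "card C = nullity"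
    "nondegenerate \<Longrightarrow> funC.independent C"
proof -
  obtain E where E: "finite E" "funR.independent E" "null_gens \<subseteq> funZ.span E"
    using null_gens_lattice .
  have "funZ.span null_gens \<subseteq> funZ.span E"
    using E(3) funZ.subspace_span by (rule funZ.span_minimal)
  then obtain C where C: "finite C" "funR.independent C" "funZ.span C = funZ.span null_gens"
    using sublattice_basis[OF E(1,2) _ funZ.subspace_span] by blast
  have CV: "C \<subseteq> V0"
  proof -
    have "C \<subseteq> funR.span null_gens"
      using C(3) funZ.span_superset[of C] funZ_span_subset by blast
    also have "\<dots> \<subseteq> V0"
      by (rule funR.span_minimal[OF null_gens_V0 V0_subspace])
    finally show ?thesis .
  qed
  have VC: "V0 \<subseteq> funR.span C"
  proof -
    have "null_gens \<subseteq> funR.span C"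
      using C(3) funZ.span_superset[of null_gens] funZ_span_subset[of C] by blast
    then have "funR.span null_gens \<subseteq> funR.span C"
      by (intro funR.span_minimal funR.subspace_span)
    then show ?thesis using V0_span_null_gens by blast
  qed
  have card: "card C = nullity"
    unfolding nullity_def by (rule funR.basis_card_eq_dim[OF CV VC C(2)])
  have "funC.independent C" if nd: nondegenerate
  proof (rule funC.independent_spanning_card[OF C(1)])
    have "funR.subspace (funC.span C)"
      by (auto simp: funR.subspace_def rscale_def intro: funC.span_zero funC.span_add funC.span_scale)
    then have "funR.span C \<subseteq> funC.span C"
      by (intro funR.span_minimal) (auto intro: funC.span_base)
    then show "V0 \<subseteq> funC.span C" using VC by blast
    show "card C = funC.dim V0"
      using nd card by (simp add: nondegenerate_def)
  qed
  with C CV card that show ?thesis by blast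
qed

section \<open>The part of the basis inside \<open>h\<close>\<close>

lemma coroot_A: "b \<in> A \<Longrightarrow> coroot b = rscale (2 / re_form b b) b"
  by (simp add: coroot_def rscale_def dform_re_form A_V)

lemma coroot_inj: "inj_on coroot A"
proof (rule inj_onI)
  fix a b assume ab: "a \<in> A" "b \<in> A" "coroot a = coroot b"
  have Rx: "a \<in> Rx" "b \<in> Rx" using ab A_Rx by auto
  have "rscale (re_form a a / 2) (coroot a) = rscale (re_form a a / 2) (coroot b)"
    using ab(3) by simp
  then have "rscale (re_form a a / 2 * (2 / re_form a a)) a = rscale (re_form a a / 2 * (2 / re_form b b)) b"
    by (simp only: coroot_A ab(1,2) funR.scale_scale)
  then have e: "a = rscale (re_form a a / re_form b b) b"
    using re_form_neq0[OF Rx(1)] by simp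
  then have "a - rscale (re_form a a / re_form b b) b \<in> V0"
    using V0_closed(3) by simp
  from parallel_scale(1)[OF Rx(2,1) this] have "re_form a a / re_form b b = 1"
    using re_form_pos[OF Rx(1)] re_form_pos[OF Rx(2)] by (auto simp: field_simps)
  with e show "a = b" by simp
qed

text \<open>Pairing with \<open>V\<close> removes \<open>w\<close>. The form is real there, so the
  real and imaginary parts of the coefficients satisfy separate real relations, and the Gram matrix
  of \<open>A\<close> is non-degenerate.\<close>

lemma complex_combination_zero:
  assumes w: "\<And>v. v \<in> V \<Longrightarrow> dform w v = 0" "w \<in> representable"
    and s: "(\<Sum>b\<in>A. cscale (g b) b) + w = 0" and "b \<in> A"
  shows "g b = 0"
proof -
  have rep: "b \<in> representable" if "b \<in> A" for b
    using that A_V V_representable by blast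
  have zero: "(\<Sum>b\<in>A. g b * dform b v) = 0" if v: "v \<in> V" for v
  proof -
    have "dform ((\<Sum>b\<in>A. cscale (g b) b) + w) v = dform (\<Sum>b\<in>A. cscale (g b) b) v + dform w v"
      using v w(2) rep V_representable representable_cscale representable_sum[of A "\<lambda>b. cscale (g b) b"]
      by (intro dform_add) auto
    then have "0 = (\<Sum>b\<in>A. dform (cscale (g b) b) v)"
      using s w(1)[OF v] rep by (simp add: dform_sum representable_cscale)
    also have "\<dots> = (\<Sum>b\<in>A. g b * dform b v)"
      using v rep by (intro sum.cong) (auto simp: dform_cscale V_representable)
    finally show ?thesis by simp
  qed
  have part: "\<forall>b\<in>A. f b = 0" if f: "\<And>v. v \<in> A \<Longrightarrow> (\<Sum>b\<in>A. f b * re_form b v) = 0" for f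
  proof -
    let ?v = "\<Sum>b\<in>A. rscale (f b) b"
    have vV: "?v \<in> V"
      by (intro V_closed A_V)
    have vb: "re_form ?v b = 0" if "b \<in> A" for b
      using f[OF that] that by (simp add: re_form_sum V_closed A_V re_form_rscale)
    have "re_form ?v ?v = (\<Sum>b\<in>A. f b * re_form b ?v)"
      using vV by (subst re_form_sum) (simp_all add: V_closed A_V re_form_rscale)
    also have "\<dots> = 0"
      using vb re_form_sym[of _ ?v] by simp
    finally have "?v \<in> V0"
      using vV by (simp add: V0_iff)
    with A_independent show ?thesis by blast
  qed
  have ri: "(\<Sum>b\<in>A. Re (g b) * re_form b v) = 0" "(\<Sum>b\<in>A. Im (g b) * re_form b v) = 0" if "v \<in> A" for v
    using arg_cong[OF zero[OF A_V[OF that]], of Re] arg_cong[OF zero[OF A_V[OF that]], of Im]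
    by (simp_all add: dform_re_form A_V that cong: sum.cong)
  with part[OF ri(1)] part[OF ri(2)] \<open>b \<in> A\<close> show ?thesis by (simp add: complex_eq_iff)
qed

text \<open>The combination of elements of \<open>C\<close> is orthogonal to \<open>V\<close>, so
  the coefficients of the coroots vanish by \<open>complex_combination_zero\<close>; independence of
  \<open>C\<close> settles the rest.\<close>

lemma coroot_null_independent:
  assumes "finite C" "C \<subseteq> V0" "funC.independent C"
  shows "funC.independent (coroot ` A \<union> C)" "coroot ` A \<inter> C = {}"
proof -
  show disj: "coroot ` A \<inter> C = {}"
  proof -
    have "coroot b \<notin> V0" if b: "b \<in> A" for b
    proof
      assume "coroot b \<in> V0"
      then have "rscale (re_form b b / 2) (coroot b) \<in> V0"
        by (rule V0_closed)
      moreover have "b \<in> Rx" using b A_Rx by blast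
      ultimately show False
        using re_form_neq0 by (simp add: coroot_A b Rx_iff)
    qed
    then show ?thesis using assms(2) by blast
  qed
  show "funC.independent (coroot ` A \<union> C)"
  proof (rule funC.independent_if_scalars_zero)
    show "finite (coroot ` A \<union> C)" using A_finite assms(1) by simp
    fix f x assume f: "(\<Sum>x\<in>coroot ` A \<union> C. cscale (f x) x) = 0" and x: "x \<in> coroot ` A \<union> C"
    define w where "w = (\<Sum>x\<in>C. cscale (f x) x)"
    have Crep: "c \<in> representable" if "c \<in> C" for c
      using that assms(2) V0_V V_representable by blast
    have "(\<Sum>x\<in>coroot ` A \<union> C. cscale (f x) x) = (\<Sum>b\<in>A. cscale (f (coroot b)) (coroot b)) + w"
      unfolding w_def using disj A_finite assms(1) coroot_inj
      by (simp add: sum.union_disjoint sum.reindex)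
    also have "(\<Sum>b\<in>A. cscale (f (coroot b)) (coroot b)) = (\<Sum>b\<in>A. cscale (f (coroot b) * (2 / dform b b)) b)"
      by (intro sum.cong) (simp_all add: coroot_def)
    finally have s: "(\<Sum>b\<in>A. cscale (f (coroot b) * (2 / dform b b)) b) + w = 0"
      unfolding f by (rule sym)
    have wrep: "w \<in> representable"
      using representable_sum[of C "\<lambda>x. cscale (f x) x"] Crep by (auto simp: w_def representable_cscale)
    have wd: "dform w v = 0" if v: "v \<in> V" for v
    proof -
      have "dform w v = (\<Sum>x\<in>C. dform (cscale (f x) x) v)"
        unfolding w_def by (rule dform_sum) (simp add: Crep representable_cscale)
      also have "\<dots> = 0"
        using v assms(2) Crep by (intro sum.neutral) (auto simp: dform_cscale V_representable dform_V0)
      finally show ?thesis .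
    qed
    have "f (coroot b) * (2 / dform b b) = 0" if "b \<in> A" for b
      by (rule complex_combination_zero[OF wd wrep s that])
    then have fA: "f (coroot b) = 0" if "b \<in> A" for b
      using that A_Rx by (force simp: dform_re_form A_V re_form_neq0)
    have "w = 0"
      using s fA by simp
    then have "f c = 0" if "c \<in> C" for c
      using funC.independentD[OF assms(3,1) subset_refl, of f c] that by (simp add: w_def)
    with fA x show "f x = 0" by auto
  qed
qed

text \<open>On the root space of \<beta> the vector acts by the scalar (\<beta>, \<sigma>), which is
  0.\<close>

lemma null_vec_central:
  assumes "\<sigma> \<in> V0"
  shows "\<^bold>[dual_vec \<sigma>, y\<^bold>] = 0"
proof -
  have rep: "\<sigma> \<in> representable"
    using assms V0_V V_representable by blast
  have "(\<Union>\<alpha>\<in>dual. root_space \<alpha>) \<subseteq> {y. \<^bold>[dual_vec \<sigma>, y\<^bold>] = 0}"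
  proof clarify
    fix \<beta> z assume b: "\<beta> \<in> dual" and z: "z \<in> root_space \<beta>"
    show "\<^bold>[dual_vec \<sigma>, z\<^bold>] = 0"
    proof (cases "\<beta> \<in> roots")
      case True
      have "\<^bold>[dual_vec \<sigma>, z\<^bold>] = dform \<beta> \<sigma> *s z"
        using root_spaceD[OF z dual_vec(1)[OF rep]] dform_apply[OF root_representable[OF True] rep] by simp
      then show ?thesis
        using dform_V0(2)[OF assms root_V[OF True]] by simp
    next
      case False
      then show ?thesis using nonroot_zero[OF b False z] by simp
    qed
  qed
  moreover have "subspace {y. \<^bold>[dual_vec \<sigma>, y\<^bold>] = 0}"
    by (auto simp: subspace_def bracket_add_right bracket_scale_right)
  ultimately have "span (\<Union>\<alpha>\<in>dual. root_space \<alpha>) \<subseteq> {y. \<^bold>[dual_vec \<sigma>, y\<^bold>] = 0}"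
    by (rule span_minimal)
  then show ?thesis
    unfolding root_decomposition by blast
qed

lemma dual_vec_int_span:
  assumes "funZ.subspace Z" "Z \<subseteq> V0" "C \<subseteq> Z" "funZ.span C = Z" "\<sigma> \<in> Z"
  shows "dual_vec \<sigma> \<in> int_span (dual_vec ` C)"
proof -
  have rep: "x \<in> representable" if "x \<in> Z" for x
    using that assms(2) V0_V V_representable by blast
  have "funZ.subspace {v \<in> Z. dual_vec v \<in> int_span (dual_vec ` C)}"
    using assms(1) rep
    by (auto simp: funZ.subspace_def representable_zero representable_add zscale_def representable_cscale
        intro: int_span_zero int_span_add int_span_scale)
  moreover have "C \<subseteq> {v \<in> Z. dual_vec v \<in> int_span (dual_vec ` C)}"
    using assms(3) by (auto intro: int_span_base)
  ultimately have "funZ.span C \<subseteq> {v \<in> Z. dual_vec v \<in> int_span (dual_vec ` C)}"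
    by (intro funZ.span_minimal)
  with assms(4,5) show ?thesis by blast
qed

lemma null_gens_span_V0: "funZ.span null_gens \<subseteq> V0"
  using funZ_span_subset[of null_gens] funR.span_minimal[OF null_gens_V0 V0_subspace] by blast

text \<open>A null generator gives the difference between one coroot vector and a combination of
  others, all of which lie in the core.\<close>

lemma null_vec_core: "\<sigma> \<in> funZ.span null_gens \<Longrightarrow> dual_vec \<sigma> \<in> core"
proof -
  let ?Z = "{v \<in> representable. dual_vec v \<in> core}"
  note cs = subspace_add[OF core_subspace] subspace_scale[OF core_subspace]
    subspace_diff[OF core_subspace] subspace_sum[OF core_subspace] subspace_0[OF core_subspace]
  have "funZ.subspace ?Z"
    by (auto simp: funZ.subspace_def representable_zero representable_add zscale_def representable_cscale cs)
  moreover have "null_gens \<subseteq> ?Z"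
  proof
    fix d assume d: "d \<in> null_gens"
    then obtain \<beta> \<sigma> k where b: "d = rscale (2 / re_form \<beta> \<beta>) \<sigma>" "\<beta> \<in> Rx" "\<sigma> \<in> V0" "\<beta> - \<sigma> = base_sum k"
      unfolding null_gens_def by blast
    obtain m :: "'g functional \<Rightarrow> int"
      where "coroot_vec \<beta> = (\<Sum>b\<in>A. of_int (m b) *s coroot_vec b) + dual_vec d"
      using coroot_vec_decomposition[OF b(2-4)] unfolding b(1) .
    then have "dual_vec d = coroot_vec \<beta> - (\<Sum>b\<in>A. of_int (m b) *s coroot_vec b)"
      by simp
    also have "\<dots> \<in> core"
      using A_Rx by (intro cs coroot_vec_core b(2)) blast
    finally show "d \<in> ?Z"
      using d null_gens_V0 V0_V V_representable by blast
  qed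
  ultimately have "funZ.span null_gens \<subseteq> ?Z"
    by (intro funZ.span_minimal)
  then show "\<sigma> \<in> funZ.span null_gens \<Longrightarrow> dual_vec \<sigma> \<in> core" by blast
qed

lemma coroot_vec_int_span:
  assumes "funZ.span C = funZ.span null_gens" "\<beta> \<in> Rx"
  shows "coroot_vec \<beta> \<in> int_span (coroot_vec ` A \<union> dual_vec ` C)"
proof -
  obtain k \<sigma> where k: "\<sigma> \<in> V0" "\<beta> - \<sigma> = base_sum k" "rscale (2 / re_form \<beta> \<beta>) \<sigma> \<in> null_gens"
    using Rx_decomposition[OF assms(2)] .
  obtain m :: "'g functional \<Rightarrow> int"
    where m: "coroot_vec \<beta> = (\<Sum>b\<in>A. of_int (m b) *s coroot_vec b) + dual_vec (rscale (2 / re_form \<beta> \<beta>) \<sigma>)"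
    using coroot_vec_decomposition[OF assms(2) k(1,2)] .
  have "dual_vec (rscale (2 / re_form \<beta> \<beta>) \<sigma>) \<in> int_span (dual_vec ` C)"
  proof (rule dual_vec_int_span[OF funZ.subspace_span null_gens_span_V0 _ assms(1)])
    show "C \<subseteq> funZ.span null_gens"
      using assms(1) funZ.span_superset[of C] by simp
    show "rscale (2 / re_form \<beta> \<beta>) \<sigma> \<in> funZ.span null_gens"
      by (rule funZ.span_base[OF k(3)])
  qed
  then have "dual_vec (rscale (2 / re_form \<beta> \<beta>) \<sigma>) \<in> int_span (coroot_vec ` A \<union> dual_vec ` C)"
    using int_span_mono[of "dual_vec ` C"] by blast
  then show ?thesis
    unfolding m by (intro int_span_add int_span_sum int_span_scale) (auto intro: int_span_base)
qed

section \<open>Assembly of the basis of the core\<close>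

lemma core_gens_isotropic:
  assumes "\<delta> \<in> isotropic_roots - {0}" "reflectable_base \<Pi>"
  shows "x_iso \<Pi> xv \<delta> \<subseteq> core_gens \<delta>" "core_gens \<delta> \<subseteq> span (x_iso \<Pi> xv \<delta>)"
proof -
  have d: "\<delta> \<in> V0" "\<delta> \<noteq> 0" "\<delta> \<notin> Rx"
    using assms(1) by (auto simp: isotropic_iff Rx_iff)
  then show "x_iso \<Pi> xv \<delta> \<subseteq> core_gens \<delta>"
    using x_iso_eq[OF assms(2) d(1)] \<Pi>_Rx[OF assms(2)] assms(1) by (auto simp: core_gens_def)
  show "core_gens \<delta> \<subseteq> span (x_iso \<Pi> xv \<delta>)"
    using d iso_vec_int_span[OF assms(2) _ _ d(1)] int_span_span by (force simp: core_gens_def)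
qed

theorem chevalley_basis:
  fixes \<alpha> :: "nat \<Rightarrow> 'g functional" and l :: nat
  assumes A: "A = \<alpha> ` {1..l}" and inj: "inj_on \<alpha> {1..l}"
    and reflectable: "reflectable_base \<Pi>" and nondeg: nondegenerate
  shows "\<exists>x hh c X N.
    core_basis \<Pi> l nullity x hh c X \<and>
    (\<forall>j\<in>{1..nullity}. \<forall>y. \<^bold>[c j, y\<^bold>] = 0) \<and>
    (\<forall>i\<in>{1..l}. \<forall>j\<in>{1..l}. \<^bold>[hh i, hh j\<^bold>] = 0) \<and>
    (\<forall>i\<in>{1..l}. \<forall>\<beta>\<in>roots - {0}. \<forall>y \<in> basis_set l nullity x hh c X \<inter> root_space \<beta>.
         \<^bold>[hh i, y\<^bold>] = dform \<beta> (coroot (\<alpha> i)) *s y) \<and>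
    (\<forall>\<beta>\<in>Rx. \<^bold>[x \<beta>, x (- \<beta>)\<^bold>] \<in> int_span (hh ` {1..l} \<union> c ` {1..nullity})) \<and>
    (\<forall>\<beta>\<in>Rx. \<forall>\<gamma>\<in>Rx. \<beta> + \<gamma> \<notin> roots \<longrightarrow> \<^bold>[x \<beta>, x \<gamma>\<^bold>] = 0) \<and>
    (\<forall>\<beta>\<in>Rx. \<forall>\<gamma>\<in>Rx. \<beta> + \<gamma> \<in> Rx \<longrightarrow>
       \<^bold>[x \<beta>, x \<gamma>\<^bold>] = N \<beta> \<gamma> *s x (\<beta> + \<gamma>) \<and>
       N \<beta> \<gamma> = - N (- \<beta>) (- \<gamma>) \<and>
       (\<exists>u d :: nat. {n. \<gamma> + zscale n \<beta> \<in> roots} = {- int d..int u} \<and>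
          (N \<beta> \<gamma>)\<^sup>2 = of_nat (u * (d + 1)) * dform (\<beta> + \<gamma>) (\<beta> + \<gamma>) / dform \<gamma> \<gamma>) \<and>
       N \<beta> \<gamma> \<in> \<int>) \<and>
    (\<forall>\<beta>\<in>Rx. \<forall>\<delta>\<in>isotropic_roots - {0}. \<forall>y\<in>X \<delta>.
       \<exists>k :: int. \<^bold>[x \<beta>, y\<^bold>] = of_int k *s (if \<beta> + \<delta> \<in> roots then x (\<beta> + \<delta>) else 0)) \<and>
    (\<forall>\<delta>\<in>isotropic_roots - {0}.
       (\<forall>\<beta>\<in>Rx. - \<beta> + \<delta> \<in> roots \<longrightarrow> \<^bold>[x \<beta>, x (- \<beta> + \<delta>)\<^bold>] \<in> int_span (x_iso \<Pi> x \<delta>)) \<and>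
       (\<forall>\<eta>\<in>isotropic_roots - {0}. \<forall>\<mu>\<in>isotropic_roots - {0}. \<eta> + \<mu> = \<delta> \<longrightarrow>
          (\<forall>y\<in>X \<eta>. \<forall>z\<in>X \<mu>. \<^bold>[y, z\<^bold>] \<in> int_span (x_iso \<Pi> x \<delta>))))"
proof -
  obtain C where C: "finite C" "C \<subseteq> V0" "funZ.span C = funZ.span null_gens" "card C = nullity"
    "funC.independent C"
    using null_lattice_basis nondeg by metis
  obtain g where g: "bij_betw g {1..nullity} C"
    using ex_bij_betw_nat_finite_1[OF C(1)] C(4) by auto
  define hh where "hh i = coroot_vec (\<alpha> i)" for i
  define c where "c j = dual_vec (g j)" for j
  \<comment> \<open>Independence is over the complex numbers. Since (vi) and (vii) hold for every
    vector of \<open>x_iso\<close>, any maximal independent subset can serve.\<close>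
  have "\<forall>\<delta>. \<exists>B. B \<subseteq> x_iso \<Pi> xv \<delta> \<and> independent B \<and> x_iso \<Pi> xv \<delta> \<subseteq> span B"
    using maximal_independent_subset by metis
  then obtain X where X: "\<And>\<delta>. X \<delta> \<subseteq> x_iso \<Pi> xv \<delta>" "\<And>\<delta>. independent (X \<delta>)" "\<And>\<delta>. x_iso \<Pi> xv \<delta> \<subseteq> span (X \<delta>)"
    by metis
  have img: "hh ` {1..l} = coroot_vec ` A" "c ` {1..nullity} = dual_vec ` C"
    using bij_betw_imp_surj_on[OF g] by (auto simp: A hh_def c_def)
  have cv: "coroot_vec ` A = dual_vec ` coroot ` A"
    by (auto simp: coroot_vec_def)
  have Arep: "a \<in> representable" if "a \<in> A" for a
    using that A_V V_representable by blast
  have Crep: "C \<subseteq> representable"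
    using C(2) V0_V V_representable by blast
  have ACrep: "coroot ` A \<union> C \<subseteq> representable"
    using Crep Arep coroot_representable by blast
  note ACind = coroot_null_independent[OF C(1,2,5)]
  have Hind: "independent (hh ` {1..l} \<union> c ` {1..nullity})"
    unfolding img cv image_Un[symmetric] by (rule dual_vec_independent[OF ACind(1) ACrep])
  have disj: "hh ` {1..l} \<inter> c ` {1..nullity} = {}"
    unfolding img cv using inj_on_image_Int[OF dual_vec_inj, of "coroot ` A" C] ACrep ACind(2) by auto
  have hh_inj: "inj_on hh {1..l}"
  proof -
    have "inj_on (dual_vec \<circ> (coroot \<circ> \<alpha>)) {1..l}"
    proof (rule comp_inj_on)
      show "inj_on (coroot \<circ> \<alpha>) {1..l}"
        using inj coroot_inj unfolding A by (rule comp_inj_on)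
      show "inj_on dual_vec ((coroot \<circ> \<alpha>) ` {1..l})"
        by (rule inj_on_subset[OF dual_vec_inj]) (use ACrep in \<open>auto simp: A\<close>)
    qed
    moreover have "hh = dual_vec \<circ> (coroot \<circ> \<alpha>)"
      by (auto simp: hh_def coroot_vec_def)
    ultimately show ?thesis by (simp only:)
  qed
  have c_inj: "inj_on c {1..nullity}"
  proof -
    have "inj_on (dual_vec \<circ> g) {1..nullity}"
      using bij_betw_imp_inj_on[OF g] inj_on_subset[OF dual_vec_inj Crep]
      unfolding bij_betw_imp_surj_on[OF g, symmetric] by (rule comp_inj_on)
    moreover have "c = dual_vec \<circ> g"
      by (auto simp: c_def)
    ultimately show ?thesis by (simp only:)
  qed
  have gC: "g j \<in> C" if "j \<in> {1..nullity}" for j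
    using that bij_betw_imp_surj_on[OF g] by blast
  have \<alpha>A: "\<alpha> i \<in> A" "\<alpha> i \<in> Rx" if "i \<in> {1..l}" for i
    using that A A_Rx by auto
  have hh_h: "hh i \<in> h" if "i \<in> {1..l}" for i
    unfolding hh_def by (rule coroot_vec_h[OF Arep[OF \<alpha>A(1)[OF that]]])
  have c_h: "c j \<in> h" if "j \<in> {1..nullity}" for j
    unfolding c_def using gC[OF that] Crep by (blast intro: dual_vec)
  have Xspan: "span (X \<delta>) = root_space \<delta> \<inter> core" if d: "\<delta> \<in> isotropic_roots - {0}" for \<delta>
  proof -
    have dd: "\<delta> \<in> dual"
      using d by (auto simp: isotropic_iff root_dual)
    note cg = core_gens_isotropic[OF d reflectable]
    have "span (X \<delta>) = span (x_iso \<Pi> xv \<delta>)"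
      using X(1,3)[of \<delta>] by (intro antisym span_mono span_minimal[OF _ subspace_span])
    also have "\<dots> = span (core_gens \<delta>)"
      using cg by (intro antisym span_mono span_minimal[OF _ subspace_span])
    finally show ?thesis
      using root_space_core[OF dd] by simp
  qed
  let ?B = "basis_set l nullity xv hh c X"
  \<comment> \<open>The degree \<gamma> part of the basis. The case \<gamma> = 0 must come first,
    because 0 is itself an isotropic root while \<open>X 0\<close> is not part of the basis.\<close>
  define T where "T \<gamma> = (if \<gamma> = 0 then hh ` {1..l} \<union> c ` {1..nullity} else if \<gamma> \<in> Rx then {xv \<gamma>}
    else if \<gamma> \<in> isotropic_roots then X \<gamma> else {})" for \<gamma>
  have zRx: "0 \<notin> Rx" using Rx_nonzero by blast
  have RI: "\<gamma> \<notin> Rx" "\<gamma> \<in> dual" if "\<gamma> \<in> isotropic_roots" for \<gamma>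
    using that by (auto simp: isotropic_iff Rx_iff root_dual)
  have BT: "?B = (\<Union>\<gamma>\<in>dual. T \<gamma>)"
  proof
    show "?B \<subseteq> (\<Union>\<gamma>\<in>dual. T \<gamma>)"
      unfolding basis_set_def
    proof (intro Un_least)
      show "xv ` Rx \<subseteq> (\<Union>\<gamma>\<in>dual. T \<gamma>)"
        using zRx Rx_dual by (fastforce simp: T_def)
      show "hh ` {1..l} \<subseteq> (\<Union>\<gamma>\<in>dual. T \<gamma>)" "c ` {1..nullity} \<subseteq> (\<Union>\<gamma>\<in>dual. T \<gamma>)"
        using dual_zero by (force simp: T_def)+
      show "(\<Union>\<delta>\<in>isotropic_roots - {0}. X \<delta>) \<subseteq> (\<Union>\<gamma>\<in>dual. T \<gamma>)"
        using RI by (fastforce simp: T_def)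
    qed
    show "(\<Union>\<gamma>\<in>dual. T \<gamma>) \<subseteq> ?B"
      by (auto simp: T_def basis_set_def split: if_splits)
  qed
  have Tr: "T \<gamma> \<subseteq> root_space \<gamma> \<and> independent (T \<gamma>)" for \<gamma>
  proof -
    consider "\<gamma> = 0" | "\<gamma> \<noteq> 0" "\<gamma> \<in> Rx" | "\<gamma> \<in> isotropic_roots - {0}"
      | "\<gamma> \<noteq> 0" "\<gamma> \<notin> Rx" "\<gamma> \<notin> isotropic_roots"
      by blast
    then show ?thesis
    proof cases
      case 1
      then show ?thesis
        using Hind hh_h c_h by (auto simp: T_def root_space_zero)
    next
      case 2
      then show ?thesis
        using xv_root_space xv_nonzero by (simp add: T_def)
    next
      case 3
      then have "T \<gamma> = X \<gamma>" using RI by (auto simp: T_def)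
      then show ?thesis
        using X(2) Xspan[OF 3] span_superset[of "X \<gamma>"] by auto
    next
      case 4
      then show ?thesis by (simp add: T_def independent_empty)
    qed
  qed
  have Bind: "independent ?B"
    unfolding BT by (rule independent_graded) (rule Tr)
  have Bspan: "span ?B = core"
  proof
    have "?B \<subseteq> core"
      unfolding basis_set_def
    proof (intro Un_least)
      show "xv ` Rx \<subseteq> core" using xv_core by blast
      show "hh ` {1..l} \<subseteq> core"
        using coroot_vec_core \<alpha>A(2) by (auto simp: hh_def)
      have "C \<subseteq> funZ.span null_gens"
        using C(3) funZ.span_superset[of C] by simp
      then show "c ` {1..nullity} \<subseteq> core"
        unfolding img using null_vec_core by blast
      show "(\<Union>\<delta>\<in>isotropic_roots - {0}. X \<delta>) \<subseteq> core"
        using Xspan span_superset by blast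
    qed
    then show "span ?B \<subseteq> core"
      using core_subspace by (rule span_minimal)
    have "core_gens \<gamma> \<subseteq> span ?B" for \<gamma>
    proof
      fix s assume "s \<in> core_gens \<gamma>"
      then consider "\<gamma> \<in> Rx" "s = xv \<gamma>" | \<beta> where "\<beta> \<in> Rx" "s = coroot_vec \<beta>"
        | "\<gamma> \<in> isotropic_roots - {0}"
        by (auto simp: core_gens_def)
      then show "s \<in> span ?B"
      proof cases
        case 1
        then show ?thesis
          by (intro span_base) (simp add: basis_set_def)
      next
        case 2
        have "hh ` {1..l} \<union> c ` {1..nullity} \<subseteq> ?B"
          by (auto simp: basis_set_def)
        then have "span (hh ` {1..l} \<union> c ` {1..nullity}) \<subseteq> span ?B"
          by (rule span_mono)
        moreover have "s \<in> span (hh ` {1..l} \<union> c ` {1..nullity})"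
          using coroot_vec_int_span[OF C(3) 2(1)] int_span_span unfolding img 2(2) by blast
        ultimately show ?thesis by blast
      next
        case 3
        have "X \<gamma> \<subseteq> ?B"
          using 3 by (auto simp: basis_set_def)
        then have "span (X \<gamma>) \<subseteq> span ?B"
          by (rule span_mono)
        moreover have "s \<in> span (X \<gamma>)"
          unfolding Xspan[OF 3] root_space_core[OF RI(2)[OF DiffD1[OF 3]]]
          by (rule span_base[OF \<open>s \<in> core_gens \<gamma>\<close>])
        ultimately show ?thesis by blast
      qed
    qed
    then show "core \<subseteq> span ?B"
      unfolding core_eq by (intro span_minimal subspace_span) blast
  qed
  have basis: "core_basis \<Pi> l nullity xv hh c X"
    unfolding core_basis_def
    using xv_root_space hh_h c_h hh_inj c_inj disj X(1,2) Xspan Bind Bspan by blast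
  have iii: "\<^bold>[hh i, y\<^bold>] = dform \<beta> (coroot (\<alpha> i)) *s y"
    if "i \<in> {1..l}" "\<beta> \<in> roots - {0}" "y \<in> root_space \<beta>" for i \<beta> y
    using bracket_coroot_vec[OF root_V A_V[OF \<alpha>A(1)[OF that(1)]] that(3)] that(2)
      dform_coroot[OF root_V A_V[OF \<alpha>A(1)[OF that(1)]], of \<beta>]
    by (simp add: hh_def)
  have v: "\<^bold>[xv \<beta>, xv \<gamma>\<^bold>] = struct_const \<beta> \<gamma> *s xv (\<beta> + \<gamma>) \<and>
       struct_const \<beta> \<gamma> = - struct_const (- \<beta>) (- \<gamma>) \<and>
       (\<exists>u d :: nat. {n. \<gamma> + zscale n \<beta> \<in> roots} = {- int d..int u} \<and>
          (struct_const \<beta> \<gamma>)\<^sup>2 = of_nat (u * (d + 1)) * dform (\<beta> + \<gamma>) (\<beta> + \<gamma>) / dform \<gamma> \<gamma>) \<and>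
       struct_const \<beta> \<gamma> \<in> \<int>"
    if b: "\<beta> \<in> Rx" "\<gamma> \<in> Rx" "\<beta> + \<gamma> \<in> Rx" for \<beta> \<gamma>
  proof -
    obtain u d where ud: "{n. \<gamma> + zscale n \<beta> \<in> roots} = {- int d..int u}"
      "cartan \<gamma> \<beta> = of_int (int d - int u)" "d + u \<le> 3"
      using root_string[OF b(1,2) sum_not_parallel[OF b]] .
    show ?thesis
      using xv_bracket[OF b] struct_const_uminus[OF b] ud(1) struct_const_square[OF b ud(1,2)]
        struct_const_Ints[OF b ud] by blast
  qed
  have XD: "\<exists>\<beta>\<in>Rx. \<beta> + \<delta> \<in> Rx \<and> y = iso_vec \<delta> \<beta>" if d: "\<delta> \<in> isotropic_roots - {0}" "y \<in> X \<delta>" for \<delta> y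
  proof -
    have "\<delta> \<in> V0" using d(1) by (simp add: isotropic_iff)
    then have "y \<in> {iso_vec \<delta> \<alpha> |\<alpha>. \<alpha> \<in> \<Pi> \<and> \<alpha> + \<delta> \<in> Rx}"
      using d(2) X(1)[of \<delta>] x_iso_eq[OF reflectable, of \<delta>] by blast
    then show ?thesis
      using \<Pi>_Rx[OF reflectable] by blast
  qed
  have vi: "\<exists>k :: int. \<^bold>[xv \<beta>, y\<^bold>] = of_int k *s (if \<beta> + \<delta> \<in> roots then xv (\<beta> + \<delta>) else 0)"
    if "\<beta> \<in> Rx" "\<delta> \<in> isotropic_roots - {0}" "y \<in> X \<delta>" for \<beta> \<delta> y
    using XD[OF that(2,3)] xv_iso_vec[OF that(1), of _ \<delta>] that(2) by (auto simp: int_mult_def isotropic_iff)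
  have vii1: "\<^bold>[xv \<beta>, xv (- \<beta> + \<delta>)\<^bold>] \<in> int_span (x_iso \<Pi> xv \<delta>)"
    if "\<delta> \<in> isotropic_roots - {0}" "\<beta> \<in> Rx" "- \<beta> + \<delta> \<in> roots" for \<beta> \<delta>
    using opposite_int_span[OF reflectable that(2,3)] that(1) by (simp add: isotropic_iff)
  have vii2: "\<^bold>[y, z\<^bold>] \<in> int_span (x_iso \<Pi> xv (\<eta> + \<mu>))"
    if m: "\<eta> \<in> isotropic_roots - {0}" "\<mu> \<in> isotropic_roots - {0}" "y \<in> X \<eta>" "z \<in> X \<mu>" for \<eta> \<mu> y z
  proof -
    obtain \<beta> \<gamma> where "\<beta> \<in> Rx" "\<beta> + \<eta> \<in> Rx" "y = iso_vec \<eta> \<beta>" "\<gamma> \<in> Rx" "\<gamma> + \<mu> \<in> Rx" "z = iso_vec \<mu> \<gamma>"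
      using XD[OF m(1,3)] XD[OF m(2,4)] by blast
    moreover have "\<eta> \<in> V0" "\<mu> \<in> V0"
      using m(1,2) by (simp_all add: isotropic_iff)
    ultimately show ?thesis
      using iso_bracket_int_span[OF reflectable] by blast
  qed
  show ?thesis
  proof (rule exI[of _ xv], rule exI[of _ hh], rule exI[of _ c], rule exI[of _ X],
      rule exI[of _ struct_const], intro conjI ballI allI impI)
    show "core_basis \<Pi> l nullity xv hh c X" by (rule basis)
    show "\<^bold>[c j, y\<^bold>] = 0" if "j \<in> {1..nullity}" for j y
      unfolding c_def using gC[OF that] C(2) by (blast intro: null_vec_central)
    show "\<^bold>[hh i, hh j\<^bold>] = 0" if "i \<in> {1..l}" "j \<in> {1..l}" for i j
      by (rule h_abelian[OF hh_h[OF that(1)] hh_h[OF that(2)]])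
    show "\<^bold>[hh i, y\<^bold>] = dform \<beta> (coroot (\<alpha> i)) *s y"
      if "i \<in> {1..l}" "\<beta> \<in> roots - {0}" "y \<in> ?B \<inter> root_space \<beta>" for i \<beta> y
      using iii[OF that(1,2)] that(3) by blast
    show "\<^bold>[xv \<beta>, xv (- \<beta>)\<^bold>] \<in> int_span (hh ` {1..l} \<union> c ` {1..nullity})" if "\<beta> \<in> Rx" for \<beta>
      unfolding xv_opposite[OF that] img by (rule coroot_vec_int_span[OF C(3) that])
    show "\<^bold>[xv \<beta>, xv \<gamma>\<^bold>] = 0" if "\<beta> \<in> Rx" "\<gamma> \<in> Rx" "\<beta> + \<gamma> \<notin> roots" for \<beta> \<gamma>
      by (rule xv_bracket_zero[OF that])
  qed (use v vi vii1 vii2 in blast)+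
qed

end

theorem theorem5p9:
  fixes scale :: "complex \<Rightarrow> 'g::ab_group_add \<Rightarrow> 'g" (infixr \<open>*s\<close> 75)
    and bracket :: "'g \<Rightarrow> 'g \<Rightarrow> 'g" (\<open>\<^bold>[_, _\<^bold>]\<close>)
    and form :: "'g \<Rightarrow> 'g \<Rightarrow> complex"
    and h :: "'g set"
    and \<tau> :: "'g \<Rightarrow> 'g"
    and \<alpha> :: "nat \<Rightarrow> 'g functional"
    and P \<Pi> R R0 Rx :: "'g functional set"
    and root_space :: "'g functional \<Rightarrow> 'g set"
    and dform :: "'g functional \<Rightarrow> 'g functional \<Rightarrow> complex"
    and l \<nu> :: nat
  assumes eala: "eala scale bracket form h"
    and normalized: "eala_data.normalized scale bracket form h"
    and tame: "eala_data.tame scale bracket form h"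
    and reduced: "eala_data.reduced scale bracket form h"
    and nondegenerate: "eala_data.nondegenerate scale bracket form h"
    and rank: "l = eala_data.rank scale bracket form h" and "l > 1"
    and nullity: "\<nu> = eala_data.nullity scale bracket form h"
    and chevalley: "eala_data.chevalley_automorphism scale bracket h \<tau>"
    and preimages: "eala_data.preimage_of_base scale bracket form h P"
    and base: "root_base (eala_data.dot_roots scale bracket form h P) (\<alpha> ` {1..l})"
    and base_inj: "inj_on \<alpha> {1..l}"
    and reflectable: "eala_data.reflectable_base scale bracket form h \<Pi>"
    and base_subset: "\<alpha> ` {1..l} \<subseteq> \<Pi>"
    and R_eq: "R = eala_data.roots scale bracket h"
    and R0_eq: "R0 = eala_data.isotropic_roots scale bracket form h"
    and Rx_eq: "Rx = eala_data.nonisotropic_roots scale bracket form h"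
    and root_space_eq: "root_space = eala_data.root_space scale bracket h"
    and dform_eq: "dform = eala_data.dform form h"
  shows "\<exists>x hh c X N.
    eala_data.core_basis scale bracket form h \<Pi> l \<nu> x hh c X \<and>
    \<comment> \<open>(i)\<close>
    (\<forall>j\<in>{1..\<nu>}. \<forall>y. \<^bold>[c j, y\<^bold>] = 0) \<and>
    \<comment> \<open>(ii)\<close>
    (\<forall>i\<in>{1..l}. \<forall>j\<in>{1..l}. \<^bold>[hh i, hh j\<^bold>] = 0) \<and>
    \<comment> \<open>(iii)\<close>
    (\<forall>i\<in>{1..l}. \<forall>\<beta>\<in>R - {0}.
       \<forall>y \<in> eala_data.basis_set scale bracket form h l \<nu> x hh c X \<inter> root_space \<beta>.
         \<^bold>[hh i, y\<^bold>] = dform \<beta> (eala_data.coroot form h (\<alpha> i)) *s y) \<and>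
    \<comment> \<open>(iv)\<close>
    (\<forall>\<beta>\<in>Rx. \<^bold>[x \<beta>, x (- \<beta>)\<^bold>] \<in> lie_algebra.int_span scale (hh ` {1..l} \<union> c ` {1..\<nu>})) \<and>
    \<comment> \<open>(v)\<close>
    (\<forall>\<beta>\<in>Rx. \<forall>\<gamma>\<in>Rx. \<beta> + \<gamma> \<notin> R \<longrightarrow> \<^bold>[x \<beta>, x \<gamma>\<^bold>] = 0) \<and>
    (\<forall>\<beta>\<in>Rx. \<forall>\<gamma>\<in>Rx. \<beta> + \<gamma> \<in> Rx \<longrightarrow>
       \<^bold>[x \<beta>, x \<gamma>\<^bold>] = N \<beta> \<gamma> *s x (\<beta> + \<gamma>) \<and>
       N \<beta> \<gamma> = - N (- \<beta>) (- \<gamma>) \<and>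
       (\<exists>u d :: nat. {n. \<gamma> + zscale n \<beta> \<in> R} = {- int d..int u} \<and>
          (N \<beta> \<gamma>)\<^sup>2 = of_nat (u * (d + 1)) * dform (\<beta> + \<gamma>) (\<beta> + \<gamma>) / dform \<gamma> \<gamma>) \<and>
       N \<beta> \<gamma> \<in> \<int>) \<and>
    \<comment> \<open>(vi)\<close>
    (\<forall>\<beta>\<in>Rx. \<forall>\<delta>\<in>R0 - {0}. \<forall>y\<in>X \<delta>.
       \<exists>k :: int. \<^bold>[x \<beta>, y\<^bold>] = of_int k *s (if \<beta> + \<delta> \<in> R then x (\<beta> + \<delta>) else 0)) \<and>
    \<comment> \<open>(vii)\<close>
    (\<forall>\<delta>\<in>R0 - {0}.
       (\<forall>\<beta>\<in>Rx. - \<beta> + \<delta> \<in> R \<longrightarrow>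
          \<^bold>[x \<beta>, x (- \<beta> + \<delta>)\<^bold>] \<in> lie_algebra.int_span scale (eala_data.x_iso scale bracket h \<Pi> x \<delta>)) \<and>
       (\<forall>\<eta>\<in>R0 - {0}. \<forall>\<mu>\<in>R0 - {0}. \<eta> + \<mu> = \<delta> \<longrightarrow> (\<forall>y\<in>X \<eta>. \<forall>z\<in>X \<mu>.
          \<^bold>[y, z\<^bold>] \<in> lie_algebra.int_span scale (eala_data.x_iso scale bracket h \<Pi> x \<delta>))))"
proof -
  interpret eala scale bracket form h by (rule eala)
  have A_Rx: "\<alpha> ` {1..l} \<subseteq> nonisotropic_roots"
    using base_subset reflectable unfolding reflectable_base_def by blast
  then have "\<alpha> ` {1..l} \<subseteq> roots"
    by (auto simp: nonisotropic_roots_def)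
  with preimages base have base_mod: "root_base_mod V0 roots (\<alpha> ` {1..l})"
    by (rule root_base_mod_of_dot_roots)
  \<comment> \<open>From \<open>l > 1\<close> come two distinct base roots; being independent modulo
    \<open>V0\<close>, they are the non-parallel pair that the locale asks for.\<close>
  have ends: "1 \<in> {1..l}" "2 \<in> {1..l}"
    using \<open>l > 1\<close> by auto
  have "\<alpha> 1 \<noteq> \<alpha> 2"
    using inj_onD[OF base_inj _ ends] by auto
  then have np: "\<not> parallel (\<alpha> 1) (\<alpha> 2)"
    using base_not_parallel[OF base_mod] ends by blast
  interpret based_chevalley_eala scale bracket form h \<tau> "\<alpha> ` {1..l}"
  proof unfold_locales
    show "\<exists>a\<in>nonisotropic_roots. \<exists>b\<in>nonisotropic_roots. \<not> parallel a b"
      using np A_Rx ends by blast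
  qed (fact normalized reduced chevalley base_mod A_Rx)+
  show ?thesis
    unfolding nullity R_eq R0_eq Rx_eq root_space_eq dform_eq
    by (rule chevalley_basis[where \<alpha> = \<alpha> and l = l, OF refl base_inj reflectable nondegenerate])
qed

end
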